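(* Let $f,g:\mathbb{Z}^+\to\mathbb{Z}^+$ be functions with $f(n)\ge g(n)$ for all $n$, and suppose $$\lim_{n\to\infty}\frac{f(n)}{n}=0\quad\text{and}\quad \lim_{n\to\infty}f(n)=\infty .$$ Consider the random transposition walk on $S_{M_n}$, where $M_n=M(\vec b_n(f,g))$, with transition matrix $P$ and stationary (uniform) distribution $\pi$, and let $\Delta$ be the degree of the graph induced on $S_{M_n}$, so that $n+2\Delta=n^2-2ng(n)+2f(n)g(n)$. Then there is chi-squared cutoff around $$\frac{(n+2\Delta)(\log f(n)+\log g(n))}{4f(n)}$$ with a window of size $\frac{n+2\Delta}{4f(n)}$. More precisely: 1. For every $c>10$, if $$t=\frac{(n+2\Delta)(\log f(n)+\log g(n))}{4f(n)}+c\,\frac{n+2\Delta}{4f(n)},$$ then $\left\|P^t(x,\cdot)-\pi\right\|_{2,\pi}\le 4e^{-c/2}$ for every $x\in S_{M_n}$ and all sufficiently large $n$. 2. For every $c>0$, if $$t=\frac{(n+2\Delta)(\log f(n)+\log g(n))}{4f(n)}-c\,\frac{n+2\Delta}{4f(n)},$$ then $\left\|P^t(x,\cdot)-\pi\right\|_{2,\pi}\ge \frac12 e^{c/2}$ for every $x\in S_{M_n}$ and all sufficiently large $n$. (When $t$ is not an integer, it is to be rounded up in part 1 and rounded down in part 2.)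
   Context: For an $n\times n$ $\{0,1\}$-matrix $M$ let $S_M=\{\sigma\in S_n : M(i,\sigma(i))=1 \text{ for all } i\}$. For $\vec b=(b_1,\dots,b_n)$ with entries in $\{1,\dots,n\}$, $M(\vec b)$ is the matrix with $M(\vec b)(i,j)=1$ iff $j\ge b_i$. The vector $\vec b_n(f,g)=(b_1,\dots,b_n)$ has $b_i=1$ for $i\le f(n)$ and $b_i=g(n)+1$ for $f(n)<i\le n$; $M_n=M(\vec b_n(f,g))$. Thus $S_{M_n}=\{\sigma\in S_n:\sigma(i)\ge g(n)+1\text{ for all } i>f(n)\}$ (only $n$ with $f(n)<n$ matter, which holds for all large $n$). Random transposition walk on $S_M$: from $\sigma$, choose an ordered pair $(i,j)\in\{1,\dots,n\}^2$ ($i=j$ allowed) uniformly among those pairs for which the permutation obtained from $\sigma$ by exchanging the values in positions $i$ and $j$ is in $S_M$, and move to that permutation. The induced graph on $S_M$ joins $\sigma\ne\tau$ if $\tau$ is obtained from $\sigma$ by exchanging the values in two positions. On $S_{M_n}$ this graph is regular of degree $\Delta=\sum_{i=1}^n(i-b_i)$, so $P(\sigma,\sigma)=\frac{n}{n+2\Delta}$, $P(\sigma,\tau)=\frac{2}{n+2\Delta}$ for adjacent $\sigma,\tau$, and $\pi$ is the uniform distribution. The chi-squared distance is $\|\mu-\pi\|_{2,\pi}=\sqrt{\sum_x\left(\frac{\mu(x)}{\pi(x)}-1\right)^2\pi(x)}$. The chi-squared mixing time $\tau^n(\epsilon)$ is the least $t$ such that the chi-squared distance at time $t$ is at most $\epsilon$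 (here the distance does not depend on the starting point, since the walk is vertex transitive). Cutoff means $\lim_{n\to\infty}\tau^n(\epsilon)/\tau^n(1-\epsilon)=1$ for all $\epsilon\in(0,1)$. *)

theory Defs
  imports "HOL-Probability.Probability" "HOL-Combinatorics.Permutations"
begin

text \<open>Vectors of length n and n by n matrices are functions on \<^typ>\<open>nat\<close>
  whose values matter only at indices in {1..n}.\<close>

definition restricted_perms :: "nat \<Rightarrow> (nat \<Rightarrow> nat \<Rightarrow> nat) \<Rightarrow> (nat \<Rightarrow> nat) set" where
  "restricted_perms n M = {\<sigma>. \<sigma> permutes {1..n} \<and> (\<forall>i\<in>{1..n}. M i (\<sigma> i) = 1)}"

definition one_sided_matrix :: "(nat \<Rightarrow> nat) \<Rightarrow> nat \<Rightarrow> nat \<Rightarrow> nat" where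
  "one_sided_matrix b i j = (if b i \<le> j then 1 else 0)"

definition two_step_vector :: "(nat \<Rightarrow> nat) \<Rightarrow> (nat \<Rightarrow> nat) \<Rightarrow> nat \<Rightarrow> nat \<Rightarrow> nat" where
  "two_step_vector f g n i = (if i \<le> f n then 1 else g n + 1)"

definition two_step_matrix :: "(nat \<Rightarrow> nat) \<Rightarrow> (nat \<Rightarrow> nat) \<Rightarrow> nat \<Rightarrow> nat \<Rightarrow> nat \<Rightarrow> nat" where
  "two_step_matrix f g n = one_sided_matrix (two_step_vector f g n)"

text \<open>Composing with a transposition on the right exchanges the values in two positions.\<close>

definition exchange :: "(nat \<Rightarrow> nat) \<Rightarrow> nat \<Rightarrow> nat \<Rightarrow> nat \<Rightarrow> nat" where
  "exchange \<sigma> i j = \<sigma> \<circ> Transposition.transpose i j"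

definition neighbours ::
    "nat \<Rightarrow> (nat \<Rightarrow> nat \<Rightarrow> nat) \<Rightarrow> (nat \<Rightarrow> nat) \<Rightarrow> (nat \<Rightarrow> nat) set" where
  "neighbours n M \<sigma> =
     {\<tau> \<in> restricted_perms n M. \<tau> \<noteq> \<sigma> \<and> (\<exists>i\<in>{1..n}. \<exists>j\<in>{1..n}. \<tau> = exchange \<sigma> i j)}"

text \<open>The degree of the induced graph; meaningful only when that graph is nonempty and regular.\<close>

definition graph_degree :: "nat \<Rightarrow> (nat \<Rightarrow> nat \<Rightarrow> nat) \<Rightarrow> nat" where
  "graph_degree n M = (THE d. \<forall>\<sigma>\<in>restricted_perms n M. card (neighbours n M \<sigma>) = d)"

definition admissible_pairs ::
    "nat \<Rightarrow> (nat \<Rightarrow> nat \<Rightarrow> nat) \<Rightarrow> (nat \<Rightarrow> nat) \<Rightarrow> (nat \<times> nat) set" where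
  "admissible_pairs n M \<sigma> =
     {(i, j). i \<in> {1..n} \<and> j \<in> {1..n} \<and> exchange \<sigma> i j \<in> restricted_perms n M}"

text \<open>For \<sigma> in \<^term>\<open>restricted_perms n M\<close> and n at least 1 the diagonal pairs are
  admissible, so the uniform distribution below is over a nonempty set.\<close>

definition walk_step ::
    "nat \<Rightarrow> (nat \<Rightarrow> nat \<Rightarrow> nat) \<Rightarrow> (nat \<Rightarrow> nat) \<Rightarrow> (nat \<Rightarrow> nat) pmf" where
  "walk_step n M \<sigma> =
     map_pmf (\<lambda>(i, j). exchange \<sigma> i j) (pmf_of_set (admissible_pairs n M \<sigma>))"

text \<open>The t-step distribution started at x, that is, row x of the t-th power of the
  transition matrix.\<close>

definition walk_dist ::
    "nat \<Rightarrow> (nat \<Rightarrow> nat \<Rightarrow> nat) \<Rightarrow> nat \<Rightarrow> (nat \<Rightarrow> nat) \<Rightarrow> (nat \<Rightarrow> nat) pmf" where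
  "walk_dist n M t x = ((\<lambda>\<mu>. bind_pmf \<mu> (walk_step n M)) ^^ t) (return_pmf x)"

definition chi2_dist :: "'a set \<Rightarrow> 'a pmf \<Rightarrow> 'a pmf \<Rightarrow> real" where
  "chi2_dist S \<mu> \<pi> = sqrt (\<Sum>x\<in>S. (pmf \<mu> x / pmf \<pi> x - 1)\<^sup>2 * pmf \<pi> x)"

definition walk_chi2 :: "nat \<Rightarrow> (nat \<Rightarrow> nat \<Rightarrow> nat) \<Rightarrow> nat \<Rightarrow> (nat \<Rightarrow> nat) \<Rightarrow> real" where
  "walk_chi2 n M t x =
     chi2_dist (restricted_perms n M) (walk_dist n M t x) (pmf_of_set (restricted_perms n M))"

text \<open>The bound is required from every starting point. When the walk is vertex transitive the
  distance does not depend on the starting point, so requiring it from one is the same.\<close>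

definition chi2_mixing_time :: "nat \<Rightarrow> (nat \<Rightarrow> nat \<Rightarrow> nat) \<Rightarrow> real \<Rightarrow> nat" where
  "chi2_mixing_time n M \<epsilon> = (LEAST t. \<forall>x\<in>restricted_perms n M. walk_chi2 n M t x \<le> \<epsilon>)"

definition chi2_cutoff :: "(nat \<Rightarrow> nat \<Rightarrow> nat \<Rightarrow> nat) \<Rightarrow> bool" where
  "chi2_cutoff M \<longleftrightarrow>
     (\<forall>\<epsilon>\<in>{0<..<1}.
        (\<lambda>n. real (chi2_mixing_time n (M n) \<epsilon>) / real (chi2_mixing_time n (M n) (1 - \<epsilon>)))
          \<longlonglongrightarrow> 1)"

text \<open>The quantity n + 2 Delta: the number of admissible ordered pairs at any state.\<close>

definition pair_count :: "(nat \<Rightarrow> nat) \<Rightarrow> (nat \<Rightarrow> nat) \<Rightarrow> nat \<Rightarrow> nat" where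
  "pair_count f g n = n + 2 * graph_degree n (two_step_matrix f g n)"

definition cutoff_location :: "(nat \<Rightarrow> nat) \<Rightarrow> (nat \<Rightarrow> nat) \<Rightarrow> nat \<Rightarrow> real" where
  "cutoff_location f g n =
     real (pair_count f g n) * (ln (real (f n)) + ln (real (g n))) / (4 * real (f n))"

definition cutoff_window :: "(nat \<Rightarrow> nat) \<Rightarrow> (nat \<Rightarrow> nat) \<Rightarrow> nat \<Rightarrow> real" where
  "cutoff_window f g n = real (pair_count f g n) / (4 * real (f n))"

end

theory Submission
  imports Defs "HOL-Real_Asymp.Real_Asymp"
begin

text \<open>
  Write \<open>F = f n\<close>, \<open>G = g n\<close> and \<open>N = n + 2 \<Delta>\<close>. The values \<open>1..G\<close> are confined to the positions
  \<open>1..F\<close>, and the walk is a mixture of two commuting parts: random transpositions of the \<open>n - G\<close>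
  large values, acting from the left, and exchanges of positions that involve a small value, acting
  from the right. Functions of the places of the small values alone see a lazy random transposition
  walk of \<open>G\<close> labelled cards on \<open>F\<close> sites, which determines the cutoff; on the complement the large
  values mix on the scale \<open>n ln n\<close>, negligible compared with \<open>N ln F / F\<close>.

  No representation theory is used. The functions depending on at most \<open>j\<close> coordinates form an
  invariant filtration. On its \<open>j\<close>-th graded piece, of dimension at most \<open>(F G)^j / j!\<close>, transpositions
  act by an explicit matrix modulo lower levels, which gives the spectral drop \<open>j (F - j + 1)\<close>; for
  \<open>j > F / 2\<close> the drop \<open>j F / 2\<close> comes from bounding each star sum \<open>\<Sum>\<^sub>i (i p)\<close> by \<open>m - 2\<close> on a
  representation without vectors fixed by the symmetric group of an \<open>m\<close>-set. Summing dimensions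
  against eigenvalue powers bounds the return probability as in the classical upper bound lemma.
  The lower bound uses the number of small values found at their initial place, an eigenfunction
  with eigenvalue \<open>1 - 2 F / N\<close>.
\<close>

section \<open>Symmetric operators and orthonormal systems\<close>

text \<open>The obstacle is that the two commuting parts do not act on independent coordinates:
  which positions may be exchanged from the right depends on where the small values sit. So the
  complement is not treated by a product of spectra. The left walk is bounded pointwise by a
  nonnegative combination of powers \<open>\<theta>^k\<close>, uniformly in the number
  \<open>k\<close> of left steps. Right moves enter with nonnegative coefficients, so replacing each
  left step by the scalar \<theta> majorises the walk, and what remains is a walk with killing on
  the places of the small values. This is why the trace estimate is proved with an extra factor
  \<alpha> at most 1. Cylinder functions of one degree are linearly dependent, so no well-defined
  matrix acts on them. Only the growth of some choice of coefficients under powers is controlled,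
  and symmetry converts growth into a norm bound. The two spectral drops are both needed: the
  row-sum drop is sharp for small \<open>j\<close> but is only \<open>F\<close> at
  \<open>j = F\<close>, far too little against the dimension \<open>(F G)^j / j!\<close>, whereas
  \<open>j F / 2\<close> is too small at \<open>j = 1\<close>.\<close>

definition symmetric_op :: "('v::real_inner \<Rightarrow> 'v) \<Rightarrow> bool" where
  "symmetric_op A \<longleftrightarrow> linear A \<and> (\<forall>x y. A x \<bullet> y = x \<bullet> A y)"

lemma symmetric_opD:
  assumes "symmetric_op A"
  shows "linear A" "A x \<bullet> y = x \<bullet> A y"
  using assms by (auto simp: symmetric_op_def)

lemma symmetric_op_funpow:
  assumes "symmetric_op A"
  shows "symmetric_op (A ^^ k)"
proof (induction k)
  case 0
  then show ?case by (simp add: symmetric_op_def linear_id[unfolded id_def] id_def)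
next
  case (Suc k)
  have "linear (A \<circ> (A ^^ k))"
    using symmetric_opD(1)[OF assms] symmetric_opD(1)[OF Suc] by (rule linear_compose[rotated])
  moreover have "(A \<circ> (A ^^ k)) x \<bullet> y = x \<bullet> (A \<circ> (A ^^ k)) y" for x y
    using symmetric_opD(2)[OF assms] symmetric_opD(2)[OF Suc] by (metis comp_apply funpow_swap1)
  ultimately show ?case by (simp add: symmetric_op_def comp_def)
qed

lemma symmetric_op_scaled_add:
  assumes "symmetric_op A"
  shows "symmetric_op (\<lambda>v. a *\<^sub>R v + b *\<^sub>R A v)"
proof -
  interpret A: linear A using symmetric_opD(1)[OF assms] .
  show ?thesis
    unfolding symmetric_op_def
    by (auto intro!: linearI simp: A.add A.scale algebra_simps inner_add_left inner_add_right
        symmetric_opD(2)[OF assms])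
qed

lemma invariant_funpow:
  assumes "\<And>v. v \<in> V \<Longrightarrow> A v \<in> V" "v \<in> V"
  shows "(A ^^ k) v \<in> V"
  using assms by (induction k) auto

text \<open>Log-convexity of \<open>k \<mapsto> norm (A ^ k u)\<close>: the growth rate bounds the first ratio.\<close>

lemma norm_le_growth_rate:
  fixes A :: "'v::real_inner \<Rightarrow> 'v"
  assumes A: "symmetric_op A" and \<beta>: "\<beta> \<ge> 0"
    and growth: "\<And>k. norm ((A ^^ k) u) \<le> C * \<beta> ^ k"
  shows "norm (A u) \<le> \<beta> * norm u"
proof (rule ccontr)
  define a where "a k = norm ((A ^^ k) u)" for k
  assume "\<not> ?thesis"
  then have gt: "a 1 > \<beta> * a 0" by (simp add: a_def)
  interpret A: linear A using symmetric_opD(1)[OF A] .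
  have a0: "a 0 > 0"
    using gt by (cases "u = 0") (auto simp: a_def A.zero)
  define \<rho> where "\<rho> = a 1 / a 0"
  have \<rho>: "\<rho> > \<beta>" using gt a0 by (simp add: \<rho>_def field_simps)
  have conv: "a (Suc k) ^ 2 \<le> a k * a (Suc (Suc k))" for k
  proof -
    have "a (Suc k) ^ 2 = (A ((A ^^ k) u)) \<bullet> (A ((A ^^ k) u))"
      by (simp add: a_def power2_norm_eq_inner)
    also have "\<dots> = ((A ^^ k) u) \<bullet> (A (A ((A ^^ k) u)))"
      by (rule symmetric_opD(2)[OF A])
    also have "\<dots> \<le> a k * a (Suc (Suc k))"
      using norm_cauchy_schwarz by (simp add: a_def)
    finally show ?thesis .
  qed
  have grow: "a k > 0 \<and> a (Suc k) \<ge> \<rho> * a k" for k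
  proof (induction k)
    case 0
    then show ?case using a0 by (simp add: \<rho>_def)
  next
    case (Suc k)
    have pos: "a (Suc k) > 0"
      using Suc \<rho> \<beta> by (smt (verit) mult_pos_pos)
    have "\<rho> * a k * a (Suc k) \<le> a (Suc k) * a (Suc k)"
      using Suc pos by (intro mult_right_mono) auto
    also have "\<dots> \<le> a k * a (Suc (Suc k))" using conv[of k] by (simp add: power2_eq_square)
    finally have "a k * (\<rho> * a (Suc k)) \<le> a k * a (Suc (Suc k))" by (simp add: mult_ac)
    then show ?case using Suc pos by simp
  qed
  have low: "\<rho> ^ k * a 0 \<le> a k" for k
  proof (induction k)
    case (Suc k)
    have "\<rho> ^ Suc k * a 0 \<le> \<rho> * a k"
      using Suc \<rho> \<beta> by (simp add: mult.assoc mult_left_mono)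
    then show ?case using grow[of k] by simp
  qed simp
  show False
  proof (cases "\<beta> = 0")
    case True
    then show ?thesis using growth[of 1] gt a0 by (simp add: a_def)
  next
    case False
    with \<beta> have \<beta>0: "\<beta> > 0" by simp
    have "(\<rho> / \<beta>) ^ k \<le> C / a 0" for k
      using low[of k] growth[of k] \<beta>0 a0 by (simp add: a_def power_divide field_simps)
    moreover have "1 < \<rho> / \<beta>" using \<rho> \<beta>0 by simp
    then obtain k where "(\<rho> / \<beta>) ^ k > C / a 0"
      using real_arch_pow by blast
    ultimately show ?thesis by (meson not_less)
  qed
qed

text \<open>Polarisation replaces diagonalisation: with \<open>w\<close> the multiple of
  \<open>A v\<close> that has the length of \<open>v\<close>, the forms at \<open>v + w\<close> and
  \<open>v - w\<close> differ by four times \<open>A v \<bullet> w\<close>, and the parallelogram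
  law adds up their norms.\<close>

lemma norm_le_of_quadratic_form:
  fixes A :: "'v::real_inner \<Rightarrow> 'v"
  assumes A: "symmetric_op A" and V: "subspace V" "\<And>v. v \<in> V \<Longrightarrow> A v \<in> V"
    and form: "\<And>v. v \<in> V \<Longrightarrow> \<bar>v \<bullet> A v\<bar> \<le> r * (norm v)\<^sup>2"
    and v: "v \<in> V"
  shows "norm (A v) \<le> r * norm v"
proof (cases "A v = 0 \<or> v = 0")
  case True
  interpret A: linear A using symmetric_opD(1)[OF A] .
  have "r * norm v \<ge> 0"
    using order_trans[OF abs_ge_zero form[OF v]] by (cases "v = 0") (auto simp: zero_le_mult_iff)
  then show ?thesis using True A.zero by auto
next
  case False
  interpret A: linear A using symmetric_opD(1)[OF A] .
  define s where "s = norm v / norm (A v)"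
  define w where "w = s *\<^sub>R A v"
  have w: "w \<in> V" using V v by (simp add: w_def subspace_scale)
  have nw: "norm w = norm v" using False by (simp add: w_def s_def)
  have "(v + w) \<bullet> A (v + w) \<le> r * (norm (v + w))\<^sup>2"
    using form[of "v + w"] V v w by (auto simp: subspace_add)
  moreover have "- ((v - w) \<bullet> A (v - w)) \<le> r * (norm (v - w))\<^sup>2"
    using form[of "v - w"] V v w by (auto simp: subspace_diff)
  moreover have "(v + w) \<bullet> A (v + w) - (v - w) \<bullet> A (v - w) = 4 * (A v \<bullet> w)"
    using symmetric_opD(2)[OF A, of v w]
    by (simp add: A.add A.diff inner_add_left inner_add_right inner_diff_left inner_diff_right inner_commute)
  moreover have "(norm (v + w))\<^sup>2 + (norm (v - w))\<^sup>2 = 2 * (norm v)\<^sup>2 + 2 * (norm w)\<^sup>2"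
    by (simp add: power2_norm_eq_inner inner_add_left inner_add_right inner_diff_left inner_diff_right)
  ultimately have "4 * (A v \<bullet> w) \<le> r * (4 * (norm v)\<^sup>2)"
    using nw by (smt (verit, best) distrib_left)
  moreover have "A v \<bullet> w = norm v * norm (A v)"
    using False by (simp add: w_def s_def dot_square_norm power2_eq_square)
  ultimately have "norm v * norm (A v) \<le> norm v * (r * norm v)"
    by (simp add: power2_eq_square mult_ac)
  then show ?thesis using False by simp
qed

section \<open>Orthonormal systems and traces along a filtration\<close>

definition orthonormal :: "'v::real_inner set \<Rightarrow> bool" where
  "orthonormal U \<longleftrightarrow> pairwise orthogonal U \<and> (\<forall>u\<in>U. norm u = 1)"

lemma orthonormal_inner:
  assumes "orthonormal U" "u \<in> U" "v \<in> U"
  shows "u \<bullet> v = (if u = v then 1 else 0)"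
  using assms unfolding orthonormal_def pairwise_def orthogonal_def
  by (auto simp: dot_square_norm)

lemma orthonormal_expansion:
  assumes U: "orthonormal U" "finite U" and v: "v \<in> span U"
  shows "v = (\<Sum>u\<in>U. (v \<bullet> u) *\<^sub>R u)"
proof -
  obtain c where c: "v = (\<Sum>u\<in>U. c u *\<^sub>R u)"
    using v U by (auto simp: span_finite)
  have "v \<bullet> u = c u" if "u \<in> U" for u
  proof -
    have "v \<bullet> u = (\<Sum>w\<in>U. c w * (w \<bullet> u))" by (simp add: c inner_sum_left)
    also have "\<dots> = (\<Sum>w\<in>U. if w = u then c w else 0)"
      by (intro sum.cong) (auto simp: orthonormal_inner[OF U(1) _ that])
    finally show ?thesis using that U by simp
  qed
  then show ?thesis using c by simp
qed

lemma orthonormal_parseval: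
  assumes U: "orthonormal U" "finite U" and v: "v \<in> span U"
  shows "(norm v)\<^sup>2 = (\<Sum>u\<in>U. (v \<bullet> u)\<^sup>2)"
proof -
  have "(norm v)\<^sup>2 = v \<bullet> (\<Sum>u\<in>U. (v \<bullet> u) *\<^sub>R u)"
    using orthonormal_expansion[OF assms] by (simp add: power2_norm_eq_inner)
  then show ?thesis by (simp add: inner_sum_right power2_eq_square)
qed

text \<open>The bound on \<open>card U'\<close> turns a count of possibly dependent generators into
  a bound on the dimension that they add to the span.\<close>

lemma gram_schmidt_extend:
  fixes U E :: "'v::real_inner set"
  assumes "orthonormal U" "finite U" "finite E"
  shows "\<exists>U'. finite U' \<and> card U' \<le> card E \<and> U \<inter> U' = {} \<and> orthonormal (U \<union> U')
    \<and> span (U \<union> U') = span (U \<union> E)"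
  using assms(3)
proof (induction E rule: finite_induct)
  case empty
  then show ?case using assms by (intro exI[of _ "{}"]) auto
next
  case (insert e E)
  then obtain U' where U': "finite U'" "card U' \<le> card E" "U \<inter> U' = {}" "orthonormal (U \<union> U')"
    "span (U \<union> U') = span (U \<union> E)" by blast
  define T where "T = U \<union> U'"
  have T: "finite T" "orthonormal T" using U' assms by (auto simp: T_def)
  define p where "p = (\<Sum>u\<in>T. (e \<bullet> u) *\<^sub>R u)"
  define r where "r = e - p"
  have p: "p \<in> span T" unfolding p_def by (intro span_sum span_scale span_base)
  have span_eq: "span (insert e T) = span (U \<union> insert e E)"
  proof -
    have "span (insert e T) = span (insert e (U \<union> E))"
      using U'(5) by (simp add: T_def span_insert)
    then show ?thesis by simp
  qed
  have orth: "r \<bullet> u = 0" if "u \<in> T" for u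
  proof -
    have "p \<bullet> u = (\<Sum>w\<in>T. (e \<bullet> w) * (w \<bullet> u))" by (simp add: p_def inner_sum_left)
    also have "\<dots> = (\<Sum>w\<in>T. if w = u then e \<bullet> w else 0)"
      by (intro sum.cong) (auto simp: orthonormal_inner[OF T(2) _ that])
    finally show ?thesis using that T by (simp add: r_def inner_diff_left)
  qed
  show ?case
  proof (cases "r = 0")
    case True
    then have "e \<in> span T" using p by (simp add: r_def)
    then have "span (U \<union> U') = span (U \<union> insert e E)"
      using span_eq span_redundant[of e T] by (simp add: T_def)
    then show ?thesis using U' insert.hyps by (intro exI[of _ U']) auto
  next
    case False
    define w where "w = r /\<^sub>R norm r"
    have w1: "norm w = 1" using False by (simp add: w_def)
    have wo: "w \<bullet> u = 0" if "u \<in> T" for u using orth[OF that] by (simp add: w_def)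
    have wT: "w \<notin> T" using wo[of w] w1 by (auto simp: dot_square_norm)
    have "orthonormal (insert w T)"
      using T(2) w1 wo unfolding orthonormal_def pairwise_insert
      by (auto simp: orthogonal_def inner_commute)
    moreover have "span (insert w T) = span (insert e T)"
    proof (rule subset_antisym; rule span_minimal; simp?; intro conjI)
      have "r \<in> span (insert e T)" unfolding r_def
        by (metis insert_iff p span_base span_diff span_mono subsetD subset_insertI)
      then show "w \<in> span (insert e T)" by (simp add: w_def span_scale)
      show "T \<subseteq> span (insert e T)" "T \<subseteq> span (insert w T)"
        by (auto intro: span_base)
      have "norm r *\<^sub>R w + p \<in> span (insert w T)"
        by (meson insertI1 p span_add span_base span_mono span_scale subsetD subset_insertI)
      then show "e \<in> span (insert w T)" using False by (simp add: w_def r_def)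
    qed
    ultimately show ?thesis
      using U' insert.hyps wT span_eq
      by (intro exI[of _ "insert w U'"]) (auto simp: T_def card_insert_if)
  qed
qed

text \<open>Both sides are the trace of \<open>A^2\<close> on the common span, the sum of all
  squared matrix entries between the two bases. This lets a sum over point masses be evaluated in a
  basis adapted to a filtration.\<close>

lemma sum_norm_orthonormal_eq:
  fixes A :: "'v::real_inner \<Rightarrow> 'v"
  assumes A: "symmetric_op A"
    and U: "orthonormal U" "finite U" and D: "orthonormal D" "finite D"
    and eq: "span U = span D" and inv: "\<And>v. v \<in> span D \<Longrightarrow> A v \<in> span D"
  shows "(\<Sum>d\<in>D. (norm (A d))\<^sup>2) = (\<Sum>u\<in>U. (norm (A u))\<^sup>2)"
proof -
  have "(\<Sum>d\<in>D. (norm (A d))\<^sup>2) = (\<Sum>d\<in>D. \<Sum>u\<in>U. (A d \<bullet> u)\<^sup>2)"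
    using inv by (intro sum.cong orthonormal_parseval U) (auto simp: eq span_base)
  also have "\<dots> = (\<Sum>u\<in>U. \<Sum>d\<in>D. (A d \<bullet> u)\<^sup>2)" by (rule sum.swap)
  also have "\<dots> = (\<Sum>u\<in>U. \<Sum>d\<in>D. (A u \<bullet> d)\<^sup>2)"
    by (intro sum.cong refl) (metis symmetric_opD(2)[OF A] inner_commute)
  also have "\<dots> = (\<Sum>u\<in>U. (norm (A u))\<^sup>2)"
    using inv by (intro sum.cong orthonormal_parseval[symmetric] D refl) (metis eq span_base)
  finally show ?thesis .
qed

lemma orthogonal_to_span_of_set:
  assumes "\<And>b. b \<in> B \<Longrightarrow> v \<bullet> b = 0" "w \<in> span B"
  shows "v \<bullet> w = (0::real)"
  using assms(2)
  by (induction rule: span_induct) (auto simp: subspace_def inner_add_right assms(1))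

lemma orthogonal_complement_invariant:
  assumes A: "symmetric_op A" and W: "\<And>w. w \<in> W \<Longrightarrow> A w \<in> W"
    and v: "\<And>w. w \<in> W \<Longrightarrow> v \<bullet> w = 0" and w: "w \<in> W"
  shows "A v \<bullet> w = 0"
  using symmetric_opD(2)[OF A] W[OF w] v by metis

text \<open>Evaluates the trace of \<open>A^(2h)\<close> in an orthonormal basis adapted to the filtration
  by the spans of the first \<open>i\<close> families.\<close>

lemma trace_filtration_bound:
  fixes A :: "'v::real_inner \<Rightarrow> 'v" and E :: "nat \<Rightarrow> 'v set"
  assumes A: "symmetric_op A" and fin: "\<And>i. i < L \<Longrightarrow> finite (E i)"
    and inv: "\<And>i v. i \<le> L \<Longrightarrow> v \<in> span (\<Union>l<i. E l) \<Longrightarrow> A v \<in> span (\<Union>l<i. E l)"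
    and contr: "\<And>i v. i < L \<Longrightarrow> v \<in> span (\<Union>l<Suc i. E l) \<Longrightarrow>
        (\<And>w. w \<in> span (\<Union>l<i. E l) \<Longrightarrow> v \<bullet> w = 0) \<Longrightarrow> norm (A v) \<le> r i * norm v"
    and r: "\<And>i. i < L \<Longrightarrow> r i \<ge> 0"
    and D: "orthonormal D" "finite D" "span D = span (\<Union>l<L. E l)"
  shows "(\<Sum>d\<in>D. (norm ((A ^^ h) d))\<^sup>2) \<le> (\<Sum>i<L. real (card (E i)) * r i ^ (2 * h))"
proof -
  have ex: "\<exists>U. finite U \<and> orthonormal U \<and> span U = span (\<Union>l<i. E l) \<and>
      (\<Sum>u\<in>U. (norm ((A ^^ h) u))\<^sup>2) \<le> (\<Sum>l<i. real (card (E l)) * r l ^ (2 * h))"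
    if "i \<le> L" for i
    using that
  proof (induction i)
    case 0
    then show ?case by (intro exI[of _ "{}"]) (auto simp: orthonormal_def)
  next
    case (Suc i)
    then obtain U where U: "finite U" "orthonormal U" "span U = span (\<Union>l<i. E l)"
      "(\<Sum>u\<in>U. (norm ((A ^^ h) u))\<^sup>2) \<le> (\<Sum>l<i. real (card (E l)) * r l ^ (2 * h))"
      by auto
    obtain U' where U': "finite U'" "card U' \<le> card (E i)" "U \<inter> U' = {}" "orthonormal (U \<union> U')"
      "span (U \<union> U') = span (U \<union> E i)"
      using gram_schmidt_extend[OF U(2,1) fin[of i]] Suc by auto
    have sp: "span (U \<union> U') = span (\<Union>l<Suc i. E l)"
    proof -
      have "span (U \<union> E i) = span ((\<Union>l<i. E l) \<union> E i)"
        using U(3) by (simp add: span_Un)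
      then show ?thesis using U'(5) by (simp add: lessThan_Suc Un_commute)
    qed
    have bound: "(norm ((A ^^ h) u))\<^sup>2 \<le> r i ^ (2 * h)" if u: "u \<in> U'" for u
    proof -
      \<comment> \<open>The part of the next span orthogonal to the previous one is invariant
        because \<open>A\<close> is symmetric and preserves both spans; so the one-step contraction
        can be iterated.\<close>
      define V where "V = {v \<in> span (\<Union>l<Suc i. E l). \<forall>w\<in>span (\<Union>l<i. E l). v \<bullet> w = 0}"
      have AV: "A v \<in> V" if "v \<in> V" for v
        using that inv[of "Suc i"] Suc.prems orthogonal_complement_invariant[OF A, of "span (\<Union>l<i. E l)"] inv[of i]
        unfolding V_def by auto
      have uV: "u \<in> V"
      proof -
        have "u \<bullet> w = 0" if "w \<in> U" for w
          using U'(3,4) u that orthonormal_inner[OF U'(4), of u w] by auto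
        then have "u \<bullet> w = 0" if "w \<in> span U" for w
          using orthogonal_to_span_of_set that by blast
        then show ?thesis using sp u U(3) by (auto simp: V_def intro: span_base)
      qed
      have "norm ((A ^^ k) u) \<le> r i ^ k" for k
      proof (induction k)
        case 0
        then show ?case using u U'(4) by (simp add: orthonormal_def)
      next
        case (Suc k)
        have "(A ^^ k) u \<in> V" using AV uV by (rule invariant_funpow)
        then have "norm (A ((A ^^ k) u)) \<le> r i * norm ((A ^^ k) u)"
          using contr[of i] \<open>Suc i \<le> L\<close> unfolding V_def by auto
        also have "\<dots> \<le> r i * r i ^ k"
          using Suc r[of i] \<open>Suc i \<le> L\<close> by (intro mult_left_mono) auto
        finally show ?case by simp
      qed
      from power_mono[OF this[of h], of 2] show ?thesis by (simp add: power_mult mult.commute)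
    qed
    have "(\<Sum>u\<in>U'. (norm ((A ^^ h) u))\<^sup>2) \<le> real (card U') * r i ^ (2 * h)"
      using sum_bounded_above[of U' "\<lambda>u. (norm ((A ^^ h) u))\<^sup>2", OF bound] by simp
    also have "\<dots> \<le> real (card (E i)) * r i ^ (2 * h)"
      using U'(2) by (intro mult_right_mono) auto
    finally show ?case using U U' sp
      by (intro exI[of _ "U \<union> U'"]) (auto simp: sum.union_disjoint)
  qed
  obtain U where U: "finite U" "orthonormal U" "span U = span (\<Union>l<L. E l)"
      "(\<Sum>u\<in>U. (norm ((A ^^ h) u))\<^sup>2) \<le> (\<Sum>l<L. real (card (E l)) * r l ^ (2 * h))"
    using ex[of L] by auto
  have "(\<Sum>d\<in>D. (norm ((A ^^ h) d))\<^sup>2) = (\<Sum>u\<in>U. (norm ((A ^^ h) u))\<^sup>2)"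
    using U D inv[of L] invariant_funpow[of "span D" A]
    by (intro sum_norm_orthonormal_eq symmetric_op_funpow A) auto
  then show ?thesis using U(4) by simp
qed

text \<open>A set instead of a norm: dependent generators give a vector no well-defined
  coefficients, so only the existence of one representation with small absolute sum is recorded,
  modulo \<open>W\<close>.\<close>

definition coeff_ball :: "'v::real_inner set \<Rightarrow> ('i \<Rightarrow> 'v) \<Rightarrow> 'i set \<Rightarrow> real \<Rightarrow> 'v set" where
  "coeff_ball W b I \<rho> = {v. \<exists>c w. w \<in> W \<and> v = (\<Sum>i\<in>I. c i *\<^sub>R b i) + w \<and> (\<Sum>i\<in>I. \<bar>c i\<bar>) \<le> \<rho>}"

lemma coeff_ball_mono: "v \<in> coeff_ball W b I \<rho> \<Longrightarrow> \<rho> \<le> \<rho>' \<Longrightarrow> v \<in> coeff_ball W b I \<rho>'"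
  unfolding coeff_ball_def by force

lemma coeff_ball_add:
  assumes "subspace W" "v \<in> coeff_ball W b I \<rho>" "v' \<in> coeff_ball W b I \<rho>'"
  shows "v + v' \<in> coeff_ball W b I (\<rho> + \<rho>')"
proof -
  obtain c w c' w' where *: "w \<in> W" "v = (\<Sum>i\<in>I. c i *\<^sub>R b i) + w" "(\<Sum>i\<in>I. \<bar>c i\<bar>) \<le> \<rho>"
    "w' \<in> W" "v' = (\<Sum>i\<in>I. c' i *\<^sub>R b i) + w'" "(\<Sum>i\<in>I. \<bar>c' i\<bar>) \<le> \<rho>'"
    using assms(2,3) unfolding coeff_ball_def by auto
  have "(\<Sum>i\<in>I. \<bar>c i + c' i\<bar>) \<le> (\<Sum>i\<in>I. \<bar>c i\<bar> + \<bar>c' i\<bar>)" by (intro sum_mono) auto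
  then have "(\<Sum>i\<in>I. \<bar>c i + c' i\<bar>) \<le> \<rho> + \<rho>'" using * by (simp add: sum.distrib)
  moreover have "v + v' = (\<Sum>i\<in>I. (c i + c' i) *\<^sub>R b i) + (w + w')"
    by (simp add: * sum.distrib scaleR_add_left)
  moreover have "w + w' \<in> W" using * assms(1) by (simp add: subspace_add)
  ultimately show ?thesis unfolding coeff_ball_def
    by (auto intro!: exI[of _ "\<lambda>i. c i + c' i"])
qed

lemma coeff_ball_scale:
  assumes "subspace W" "v \<in> coeff_ball W b I \<rho>"
  shows "a *\<^sub>R v \<in> coeff_ball W b I (\<bar>a\<bar> * \<rho>)"
proof -
  obtain c w where *: "w \<in> W" "v = (\<Sum>i\<in>I. c i *\<^sub>R b i) + w" "(\<Sum>i\<in>I. \<bar>c i\<bar>) \<le> \<rho>"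
    using assms(2) unfolding coeff_ball_def by auto
  have "(\<Sum>i\<in>I. \<bar>a * c i\<bar>) \<le> \<bar>a\<bar> * \<rho>"
    using * by (simp add: abs_mult sum_distrib_left[symmetric] mult_left_mono)
  moreover have "a *\<^sub>R v = (\<Sum>i\<in>I. (a * c i) *\<^sub>R b i) + a *\<^sub>R w"
    by (simp add: * scaleR_add_right scaleR_sum_right)
  moreover have "a *\<^sub>R w \<in> W" using * assms(1) by (simp add: subspace_scale)
  ultimately show ?thesis unfolding coeff_ball_def
    by (auto intro!: exI[of _ "\<lambda>i. a * c i"])
qed

lemma coeff_ball_lower: "w \<in> W \<Longrightarrow> w \<in> coeff_ball W b I 0"
  unfolding coeff_ball_def by (auto intro!: exI[of _ "\<lambda>i. 0"])

lemma coeff_ball_base: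
  assumes "subspace W" "finite I" "i \<in> I"
  shows "b i \<in> coeff_ball W b I 1"
proof -
  have "b i = (\<Sum>l\<in>I. (if l = i then 1 else 0) *\<^sub>R b l) + 0"
    using assms by (simp add: if_distrib[of "\<lambda>x. x *\<^sub>R _"] sum.delta cong: if_cong)
  moreover have "(\<Sum>l\<in>I. \<bar>if l = i then 1 else 0::real\<bar>) \<le> 1"
    using assms by (simp add: if_distrib[of abs] sum.delta cong: if_cong)
  ultimately show ?thesis using subspace_0[OF assms(1)] unfolding coeff_ball_def mem_Collect_eq
    by (intro exI[of _ "\<lambda>l. if l = i then 1 else 0"] exI[of _ 0]) simp
qed

lemma coeff_ball_sum:
  assumes "subspace W" "finite L" "\<And>l. l \<in> L \<Longrightarrow> v l \<in> coeff_ball W b I (\<rho> l)"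
  shows "(\<Sum>l\<in>L. v l) \<in> coeff_ball W b I (\<Sum>l\<in>L. \<rho> l)"
  using assms(2,3)
  by (induction L rule: finite_induct)
    (auto intro: coeff_ball_add[OF assms(1)] coeff_ball_lower subspace_0[OF assms(1)])

text \<open>If \<open>A\<close> acts on the generators \<open>b i\<close>, modulo the invariant subspace \<open>W\<close>, by a matrix with
  absolute row sums at most \<open>\<beta>\<close>, then so do its powers with \<open>\<beta>^k\<close>; hence \<open>A\<close> contracts the
  orthogonal complement of \<open>W\<close> by \<open>\<beta>\<close>, even if the generators are linearly dependent.\<close>

lemma level_contraction:
  fixes A :: "'v::real_inner \<Rightarrow> 'v"
  assumes A: "symmetric_op A" and I: "finite I" and W: "subspace W"
    and AW: "\<And>w. w \<in> W \<Longrightarrow> A w \<in> W"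
    and row: "\<And>i. i \<in> I \<Longrightarrow> A (b i) \<in> coeff_ball W b I \<beta>"
    and \<beta>: "\<beta> \<ge> 0"
    and v: "v \<in> span (W \<union> b ` I)" and orth: "\<And>w. w \<in> W \<Longrightarrow> v \<bullet> w = 0"
  shows "norm (A v) \<le> \<beta> * norm v"
proof -
  interpret A: linear A using symmetric_opD(1)[OF A] .
  have step: "A u \<in> coeff_ball W b I (\<beta> * \<rho>)" if u: "u \<in> coeff_ball W b I \<rho>" for u \<rho>
  proof -
    obtain c w where *: "w \<in> W" "u = (\<Sum>i\<in>I. c i *\<^sub>R b i) + w" "(\<Sum>i\<in>I. \<bar>c i\<bar>) \<le> \<rho>"
      using u unfolding coeff_ball_def by auto
    have "A u = (\<Sum>i\<in>I. c i *\<^sub>R A (b i)) + A w"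
      by (simp add: * A.add A.sum A.scale)
    moreover have "(\<Sum>i\<in>I. c i *\<^sub>R A (b i)) + A w \<in> coeff_ball W b I ((\<Sum>i\<in>I. \<bar>c i\<bar> * \<beta>) + 0)"
      by (intro coeff_ball_add coeff_ball_sum coeff_ball_scale row W I coeff_ball_lower AW *)
    moreover have "(\<Sum>i\<in>I. \<bar>c i\<bar> * \<beta>) + 0 \<le> \<beta> * \<rho>"
      using mult_right_mono[OF *(3) \<beta>] by (simp add: sum_distrib_right sum_distrib_left mult.commute)
    ultimately show ?thesis by (metis coeff_ball_mono)
  qed
  obtain \<rho> where \<rho>: "v \<in> coeff_ball W b I \<rho>"
  proof -
    have "\<exists>\<rho>. v \<in> coeff_ball W b I \<rho>" using v
    proof (induction rule: span_induct_alt)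
      case base
      then show ?case using coeff_ball_lower subspace_0[OF W] by blast
    next
      case (step a x y)
      then obtain \<rho> where "y \<in> coeff_ball W b I \<rho>" by auto
      moreover have "\<exists>\<rho>'. x \<in> coeff_ball W b I \<rho>'"
        using step(1) coeff_ball_lower coeff_ball_base[OF W I] by blast
      ultimately show ?case using coeff_ball_add[OF W] coeff_ball_scale[OF W] by blast
    qed
    then show ?thesis using that by blast
  qed
  define B where "B = (\<Sum>i\<in>I. norm (b i))"
  have pow: "(A ^^ k) v \<in> coeff_ball W b I (\<beta> ^ k * \<rho>)" for k
    by (induction k) (use \<rho> step in \<open>auto simp: mult.assoc\<close>)
  have powo: "(A ^^ k) v \<bullet> w = 0" if "w \<in> W" for k w
    using that
    by (induction k arbitrary: w)
      (auto simp: orth symmetric_opD(2)[OF A] AW)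
  have "norm ((A ^^ k) v) \<le> (B * \<rho>) * \<beta> ^ k" for k
  proof -
    define u where "u = (A ^^ k) v"
    obtain c w where *: "w \<in> W" "u = (\<Sum>i\<in>I. c i *\<^sub>R b i) + w" "(\<Sum>i\<in>I. \<bar>c i\<bar>) \<le> \<beta> ^ k * \<rho>"
      using pow[of k] unfolding coeff_ball_def u_def by auto
    \<comment> \<open>The remainder \<open>w\<close> comes with no norm bound. The iterates stay
      orthogonal to \<open>W\<close>, so pairing \<open>u\<close> with itself removes it.\<close>
    have "norm u * norm u = u \<bullet> u" by (simp add: norm_eq_sqrt_inner)
    also have "\<dots> = u \<bullet> (\<Sum>i\<in>I. c i *\<^sub>R b i) + u \<bullet> w" by (simp add: *(2)[symmetric] inner_add_right[symmetric])
    also have "\<dots> = u \<bullet> (\<Sum>i\<in>I. c i *\<^sub>R b i)" using powo[OF *(1), of k] by (simp add: u_def)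
    also have "\<dots> \<le> norm u * norm (\<Sum>i\<in>I. c i *\<^sub>R b i)" by (rule norm_cauchy_schwarz)
    finally have "norm u \<le> norm (\<Sum>i\<in>I. c i *\<^sub>R b i)"
      by (cases "u = 0") (auto simp: mult_le_cancel_left)
    also have "\<dots> \<le> (\<Sum>i\<in>I. \<bar>c i\<bar> * norm (b i))"
      using norm_sum[of "\<lambda>i. c i *\<^sub>R b i" I] by simp
    also have "\<dots> \<le> (\<Sum>i\<in>I. \<bar>c i\<bar> * B)"
      using I by (intro sum_mono mult_left_mono) (auto simp: B_def intro: member_le_sum)
    also have "\<dots> = B * (\<Sum>i\<in>I. \<bar>c i\<bar>)" by (simp add: sum_distrib_left mult.commute)
    also have "\<dots> \<le> B * (\<beta> ^ k * \<rho>)"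
      using * by (intro mult_left_mono) (auto simp: B_def intro: sum_nonneg)
    finally show ?thesis by (simp add: u_def mult_ac)
  qed
  then show ?thesis by (rule norm_le_growth_rate[OF A \<beta>])
qed

section \<open>Top eigenvectors and star sums of transpositions\<close>

text \<open>The ambient space may be infinite-dimensional, where closed bounded sets need not be
  compact. For an orthonormal \<open>U\<close> the unit sphere of its span is a closed part of this
  image of a cube, by Cauchy-Schwarz.\<close>

lemma compact_unit_combinations:
  fixes U :: "'v::real_normed_vector set"
  assumes "finite U"
  shows "compact {\<Sum>u\<in>U. c u *\<^sub>R u |c. \<forall>u\<in>U. c u \<in> {-1..1::real}}"
  using assms
proof (induction U rule: finite_induct)
  case empty
  then show ?case by simp
next
  case (insert w U)
  let ?S = "\<lambda>U. {\<Sum>u\<in>U. c u *\<^sub>R u |c. \<forall>u\<in>U. c u \<in> {-1..1::real}}"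
  have "?S (insert w U) = (\<lambda>(a, x). a *\<^sub>R w + x) ` ({-1..1} \<times> ?S U)" (is "_ = ?I")
  proof (intro subset_antisym subsetI)
    fix x assume "x \<in> ?S (insert w U)"
    then obtain c where "\<forall>u\<in>insert w U. c u \<in> {-1..1}" "x = (\<Sum>u\<in>insert w U. c u *\<^sub>R u)" by auto
    then show "x \<in> ?I"
      using insert.hyps by (intro image_eqI[of _ _ "(c w, \<Sum>u\<in>U. c u *\<^sub>R u)"]) auto
  next
    fix x assume "x \<in> ?I"
    then obtain a c where ac: "a \<in> {-1..1}" "\<forall>u\<in>U. c u \<in> {-1..1}" "x = a *\<^sub>R w + (\<Sum>u\<in>U. c u *\<^sub>R u)"
      by auto
    have "(\<Sum>u\<in>U. (c(w := a)) u *\<^sub>R u) = (\<Sum>u\<in>U. c u *\<^sub>R u)"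
      using insert.hyps by (intro sum.cong) auto
    then show "x \<in> ?S (insert w U)"
      using ac insert.hyps by (intro CollectI exI[of _ "c(w := a)"]) auto
  qed
  moreover have "compact ?I"
    by (intro compact_continuous_image compact_Times insert.IH)
      (auto intro!: continuous_intros simp: case_prod_unfold)
  ultimately show ?case by metis
qed

lemma orthonormal_basis_exists:
  fixes B :: "'v::real_inner set"
  assumes "finite B"
  obtains U where "finite U" "orthonormal U" "span U = span B"
  using gram_schmidt_extend[of "{}" B] assms by (auto simp: orthonormal_def)

text \<open>The maximiser of the Rayleigh quotient on the unit sphere of a finite span. Only this
  one extremal vector of the spectral theorem is used later.\<close>

lemma top_eigenvector:
  fixes A :: "'v::real_inner \<Rightarrow> 'v"
  assumes A: "symmetric_op A" and B: "finite B" and inv: "\<And>v. v \<in> span B \<Longrightarrow> A v \<in> span B"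
    and nz: "v0 \<in> span B" "v0 \<noteq> 0"
  obtains c v where "v \<in> span B" "v \<noteq> 0" "A v = c *\<^sub>R v"
    "\<And>w. w \<in> span B \<Longrightarrow> w \<bullet> A w \<le> c * (norm w)\<^sup>2"
proof -
  interpret A: linear A using symmetric_opD(1)[OF A] .
  obtain U where U: "finite U" "orthonormal U" "span U = span B"
    using orthonormal_basis_exists[OF B] .
  define S where "S = {\<Sum>u\<in>U. c u *\<^sub>R u |c. \<forall>u\<in>U. c u \<in> {-1..1::real}} \<inter> {v. norm v = 1}"
  have S: "S = {v \<in> span B. norm v = 1}"
  proof (intro subset_antisym subsetI)
    fix v assume "v \<in> S"
    then show "v \<in> {v \<in> span B. norm v = 1}"
      unfolding S_def U(3)[symmetric] by (auto intro!: span_sum span_scale intro: span_base)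
  next
    fix v assume v: "v \<in> {v \<in> span B. norm v = 1}"
    then have "v = (\<Sum>u\<in>U. (v \<bullet> u) *\<^sub>R u)" using orthonormal_expansion U by auto
    moreover have "v \<bullet> u \<in> {-1..1}" if "u \<in> U" for u
      using Cauchy_Schwarz_ineq2[of v u] v that U(2) by (auto simp: orthonormal_def)
    ultimately show "v \<in> S" using v unfolding S_def by (auto intro!: exI[of _ "\<lambda>u. v \<bullet> u"])
  qed
  have "compact S" unfolding S_def
    by (intro compact_Int_closed compact_unit_combinations U closed_Collect_eq continuous_intros)
  moreover have "S \<noteq> {}"
  proof -
    have "v0 /\<^sub>R norm v0 \<in> S" using nz by (auto simp: S span_scale)
    then show ?thesis by auto
  qed
  moreover have "continuous_on S (\<lambda>v. v \<bullet> A v)"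
  proof -
    have "continuous_on S (\<lambda>v. v \<bullet> (\<Sum>u\<in>U. (v \<bullet> u) *\<^sub>R A u))"
      by (intro continuous_intros)
    moreover have "A v = (\<Sum>u\<in>U. (v \<bullet> u) *\<^sub>R A u)" if "v \<in> S" for v
    proof -
      have "v = (\<Sum>u\<in>U. (v \<bullet> u) *\<^sub>R u)" using orthonormal_expansion U that by (auto simp: S)
      then have "A v = A (\<Sum>u\<in>U. (v \<bullet> u) *\<^sub>R u)" by simp
      also have "\<dots> = (\<Sum>u\<in>U. (v \<bullet> u) *\<^sub>R A u)" by (simp only: A.sum A.scale)
      finally show ?thesis .
    qed
    ultimately show ?thesis by (simp cong: continuous_on_cong)
  qed
  ultimately obtain v where v: "v \<in> S" "\<And>w. w \<in> S \<Longrightarrow> w \<bullet> A w \<le> v \<bullet> A v"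
    using continuous_attains_sup[of S "\<lambda>v. v \<bullet> A v"] by auto
  define c where "c = v \<bullet> A v"
  have vB: "v \<in> span B" "norm v = 1" using v(1) by (auto simp: S)
  have le: "w \<bullet> A w \<le> c * (norm w)\<^sup>2" if w: "w \<in> span B" for w
  proof (cases "w = 0")
    case True
    then show ?thesis by simp
  next
    case False
    have "w /\<^sub>R norm w \<in> S" using w False by (auto simp: S span_scale)
    from v(2)[OF this] have "(w \<bullet> A w) / (norm w)\<^sup>2 \<le> c"
      by (simp add: A.scale c_def power2_eq_square divide_inverse mult_ac)
    then show ?thesis using False by (simp add: field_simps)
  qed
  define r where "r = c *\<^sub>R v - A v"
  have r: "r \<in> span B" unfolding r_def by (intro span_diff span_scale vB inv)
  text \<open>\<open>v\<close> minimises the nonnegative form of \<open>c - A\<close>; perturb in the direction of its gradient.\<close>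
  have "0 \<le> 2 * t * (norm r)\<^sup>2 + t\<^sup>2 * (c * (norm r)\<^sup>2 - r \<bullet> A r)" for t
  proof -
    have vr: "v \<bullet> A r = A v \<bullet> r" using symmetric_opD(2)[OF A, of v r] by simp
    have rr: "(norm r)\<^sup>2 = c * (v \<bullet> r) - A v \<bullet> r"
      by (simp add: power2_norm_eq_inner r_def inner_diff_left)
    have "(v + t *\<^sub>R r) \<bullet> A (v + t *\<^sub>R r) \<le> c * (norm (v + t *\<^sub>R r))\<^sup>2"
      by (intro le span_add span_scale vB r)
    moreover have "(v + t *\<^sub>R r) \<bullet> A (v + t *\<^sub>R r) = c + 2 * t * (A v \<bullet> r) + t\<^sup>2 * (r \<bullet> A r)"
      by (simp add: inner_add_left inner_add_right A.add A.scale vr c_def inner_commute[of r "A v"]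
          algebra_simps power2_eq_square)
    moreover have "(norm (v + t *\<^sub>R r))\<^sup>2 = 1 + 2 * t * (v \<bullet> r) + t\<^sup>2 * (norm r)\<^sup>2"
    proof -
      have "v \<bullet> v = 1" using vB(2) by (simp add: norm_eq_1)
      then show ?thesis
        unfolding power2_norm_eq_inner
        by (simp add: inner_add_left inner_add_right inner_commute[of r v] algebra_simps power2_eq_square)
    qed
    ultimately have "c + 2 * t * (A v \<bullet> r) + t\<^sup>2 * (r \<bullet> A r)
        \<le> c * (1 + 2 * t * (v \<bullet> r) + t\<^sup>2 * (norm r)\<^sup>2)" by simp
    moreover have "2 * t * (norm r)\<^sup>2 = 2 * t * (c * (v \<bullet> r)) - 2 * t * (A v \<bullet> r)"
      by (simp only: rr right_diff_distrib)
    ultimately show ?thesis by (simp add: algebra_simps)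
  qed
  note * = this
  have "r = 0"
  proof (rule ccontr)
    assume "r \<noteq> 0"
    define a where "a = (norm r)\<^sup>2"
    define b where "b = c * (norm r)\<^sup>2 - r \<bullet> A r"
    have a: "a > 0" using \<open>r \<noteq> 0\<close> by (simp add: a_def)
    have b: "b \<ge> 0" using le[OF r] by (simp add: b_def)
    \<comment> \<open>A negative \<open>t\<close> so short that the linear term dominates; the
      \<open>+ 1\<close> keeps the denominator positive when \<open>b\<close> is 0.\<close>
    define t where "t = - (a / (b + 1))"
    have tn: "t < 0" using a b by (simp add: t_def)
    have "0 \<le> t * (2 * a + t * b)"
      using *[of t] by (simp add: a_def b_def power2_eq_square algebra_simps)
    then have "2 * a + t * b \<le> 0" using tn by (simp add: zero_le_mult_iff)
    moreover have "t * b \<ge> - a" using a b by (simp add: t_def field_simps)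
    ultimately show False using a by linarith
  qed
  then have "A v = c *\<^sub>R v" by (simp add: r_def)
  with that[of v c] vB le show thesis by (metis norm_zero zero_neq_one)
qed

text \<open>The relations of the transpositions acting by symmetric involutions are all that the
  star sums require. The plain action and its twist by the sign are both instances.\<close>

locale transposition_rep =
  fixes \<tau> :: "'p \<Rightarrow> 'p \<Rightarrow> 'v::real_inner \<Rightarrow> 'v"
  assumes tau_symmetric: "symmetric_op (\<tau> p q)"
    and tau_involution: "\<tau> p q (\<tau> p q v) = v"
    and tau_same: "\<tau> p p v = v"
    and tau_commute: "\<tau> p q = \<tau> q p"
    and tau_conj: "\<tau> a b (\<tau> c d v) = \<tau> (Transposition.transpose a b c) (Transposition.transpose a b d) (\<tau> a b v)"
begin

text \<open>The Jucys-Murphy element of \<open>p\<close> in the symmetric group on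
  \<open>A\<close>.\<close>

definition star :: "'p set \<Rightarrow> 'p \<Rightarrow> 'v \<Rightarrow> 'v" where
  "star A p v = (\<Sum>i\<in>A - {p}. \<tau> i p v)"

text \<open>Ordered pairs with the diagonal included, as in the walk, which allows
  \<open>i = j\<close>.\<close>

definition theta :: "'p set \<Rightarrow> 'v \<Rightarrow> 'v" where
  "theta A v = (\<Sum>p\<in>A. \<Sum>q\<in>A. \<tau> p q v)"

lemma tau_linear: "linear (\<tau> p q)"
  using tau_symmetric symmetric_opD(1) by blast

lemma tau_inner: "\<tau> p q v \<bullet> w = v \<bullet> \<tau> p q w"
  using tau_symmetric symmetric_opD(2) by blast

lemma norm_tau: "norm (\<tau> p q v) = norm v"
  by (simp add: norm_eq_sqrt_inner tau_inner tau_involution)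

lemma tau_form_le: "\<bar>v \<bullet> \<tau> p q v\<bar> \<le> (norm v)\<^sup>2"
  using Cauchy_Schwarz_ineq2[of v "\<tau> p q v"] by (simp add: norm_tau power2_eq_square)

lemma symmetric_op_sum:
  assumes "\<And>l. l \<in> L \<Longrightarrow> symmetric_op (f l)"
  shows "symmetric_op (\<lambda>v. \<Sum>l\<in>L. f l v)"
  unfolding symmetric_op_def
  using assms by (auto intro!: linear_compose_sum sum.cong simp: inner_sum_left inner_sum_right symmetric_op_def)

lemma star_symmetric: "symmetric_op (star A p)"
  unfolding star_def[abs_def] by (intro symmetric_op_sum tau_symmetric)

lemma theta_symmetric: "symmetric_op (theta A)"
  unfolding theta_def[abs_def] by (intro symmetric_op_sum tau_symmetric)

text \<open>The recursion \<open>J' = s J s + s\<close> between consecutive Jucys-Murphy elements,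
  where \<open>s\<close> exchanges \<open>p\<close> and \<open>q\<close>.\<close>

lemma star_split:
  assumes "finite A" "p \<in> A" "q \<in> A" "p \<noteq> q"
  shows "star A p v = \<tau> p q (star (A - {p}) q (\<tau> p q v)) + \<tau> p q v"
proof -
  have "\<tau> p q (star (A - {p}) q (\<tau> p q v)) = (\<Sum>i\<in>A - {p} - {q}. \<tau> p q (\<tau> i q (\<tau> p q v)))"
    unfolding star_def by (rule linear_sum[OF tau_linear])
  also have "\<dots> = (\<Sum>i\<in>A - {p} - {q}. \<tau> i p v)"
    by (intro sum.cong refl, subst tau_conj) (use assms in \<open>auto simp: tau_involution Transposition.transpose_def\<close>)
  finally show ?thesis
    using sum.remove[of "A - {p}" q "\<lambda>i. \<tau> i p v"] assms by (simp add: star_def tau_commute[of p q] add.commute)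
qed

text \<open>Conjugation by a transposition inside \<open>A - {p}\<close> permutes the summands of
  the star at \<open>p\<close>.\<close>

lemma star_commute:
  assumes "finite A" "p \<in> A" "q \<in> A" "p \<noteq> q"
  shows "star (A - {p}) q (star A p v) = star A p (star (A - {p}) q v)"
proof -
  have tau: "\<tau> i q (star A p w) = star A p (\<tau> i q w)" if i: "i \<in> A - {p} - {q}" for i w
  proof -
    have "\<tau> i q (star A p w) = (\<Sum>l\<in>A - {p}. \<tau> i q (\<tau> l p w))"
      unfolding star_def by (rule linear_sum[OF tau_linear])
    also have "\<dots> = (\<Sum>l\<in>A - {p}. \<tau> (Transposition.transpose i q l) p (\<tau> i q w))"
      by (intro sum.cong refl, subst tau_conj) (use i assms in \<open>auto simp: Transposition.transpose_def\<close>)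
    also have "\<dots> = (\<Sum>l\<in>A - {p}. \<tau> l p (\<tau> i q w))"
    proof (rule sum.reindex_bij_witness[of _ "Transposition.transpose i q" "Transposition.transpose i q"])
    qed (use i assms in \<open>auto simp: Transposition.transpose_def split: if_splits\<close>)
    finally show ?thesis by (simp add: star_def)
  qed
  have "star (A - {p}) q (star A p v) = (\<Sum>i\<in>A - {p} - {q}. star A p (\<tau> i q v))"
    unfolding star_def[of "A - {p}"] by (intro sum.cong refl tau)
  also have "\<dots> = star A p (star (A - {p}) q v)"
    unfolding star_def[of "A - {p}"]
    by (rule linear_sum[OF symmetric_opD(1)[OF star_symmetric], symmetric])
  finally show ?thesis .
qed

text \<open>The operator \<open>Y = c - star (A - {p}) q\<close> is positive definite on
  \<open>V\<close>. The recursion says \<open>Y (\<tau> p q w) = w\<close> for each eigenvector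
  \<open>w\<close> of the larger star with eigenvalue \<open>c\<close>. Since the stars commute,
  \<open>Y v\<close> is again such an eigenvector. Applying this to \<open>v\<close> and to
  \<open>Y v\<close> gives \<open>Y v = \<tau> p q v\<close> and \<open>Y (Y v) = v\<close>, and a
  positive operator whose square fixes \<open>v\<close> fixes \<open>v\<close>.\<close>

lemma star_eigenvector_fixed:
  assumes A: "finite A" "p \<in> A" "q \<in> A" "p \<noteq> q"
    and V: "subspace V" "\<And>i j v. i \<in> A \<Longrightarrow> j \<in> A \<Longrightarrow> v \<in> V \<Longrightarrow> \<tau> i j v \<in> V"
    and below: "\<And>w. w \<in> V \<Longrightarrow> w \<bullet> star (A - {p}) q w \<le> \<mu> * (norm w)\<^sup>2"
    and v: "v \<in> V" "star A p v = c *\<^sub>R v" and c: "c > \<mu>"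
  shows "\<tau> p q v = v"
proof -
  define Y where "Y w = c *\<^sub>R w - star (A - {p}) q w" for w
  interpret s: linear "\<tau> p q" by (rule tau_linear)
  interpret X: linear "star A p" using symmetric_opD(1)[OF star_symmetric] .
  interpret Z: linear "star (A - {p}) q" using symmetric_opD(1)[OF star_symmetric] .
  have YV: "Y w \<in> V" if "w \<in> V" for w
    unfolding Y_def star_def by (intro subspace_diff subspace_scale subspace_sum V that) (use A in auto)
  have pos: "w \<bullet> Y w > 0" if "w \<in> V" "w \<noteq> 0" for w
  proof -
    have "w \<bullet> Y w \<ge> (c - \<mu>) * (norm w)\<^sup>2"
      using below[OF that(1)] by (simp add: Y_def inner_diff_right power2_norm_eq_inner algebra_simps)
    moreover have "(c - \<mu>) * (norm w)\<^sup>2 > 0" using c that(2) by simp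
    ultimately show ?thesis by linarith
  qed
  have inj: "w = 0" if "w \<in> V" "Y w = 0" for w
    using pos[OF that(1)] that(2) by (cases "w = 0") simp_all
  have Ys: "Y (\<tau> p q w) = w" if "star A p w = c *\<^sub>R w" for w
  proof -
    have "\<tau> p q (c *\<^sub>R w) = \<tau> p q (\<tau> p q (star (A - {p}) q (\<tau> p q w)) + \<tau> p q w)"
      using star_split[OF A, of w] that by simp
    then have "c *\<^sub>R \<tau> p q w = star (A - {p}) q (\<tau> p q w) + w"
      by (simp add: s.add s.scale tau_involution)
    then show ?thesis by (simp add: Y_def)
  qed
  have eigY: "star A p (Y v) = c *\<^sub>R Y v"
    by (simp add: Y_def X.diff X.scale star_commute[OF A, symmetric] v(2) Z.scale scaleR_diff_right)
  have YY: "Y (a - b) = Y a - Y b" for a b by (simp add: Y_def Z.diff algebra_simps)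
  have sV: "\<tau> p q w \<in> V" if "w \<in> V" for w by (rule V(2)[OF A(2,3) that])
  have "\<tau> p q (Y v) - v = 0"
  proof (rule inj)
    show "\<tau> p q (Y v) - v \<in> V" by (intro subspace_diff V(1) sV YV v)
  next
    have "Y (\<tau> p q (Y v) - v) = Y (\<tau> p q (Y v)) - Y v" by (rule YY)
    then show "Y (\<tau> p q (Y v) - v) = 0" by (simp add: Ys[OF eigY])
  qed
  then have "\<tau> p q (Y v) = v" by (simp only: right_minus_eq)
  then have Yv: "Y v = \<tau> p q v" using tau_involution[of p q "Y v"] by simp
  have YYv: "Y (Y v) = v" unfolding Yv by (rule Ys[OF v(2)])
  have "Y v - v = 0"
  proof (rule ccontr)
    assume "Y v - v \<noteq> 0"
    then have "(Y v - v) \<bullet> Y (Y v - v) > 0" by (intro pos subspace_diff V(1) YV v)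
    moreover have "Y (Y v - v) = - (Y v - v)" by (simp add: YY YYv)
    ultimately show False by (simp only: inner_minus_right) (use inner_ge_zero[of "Y v - v"] in linarith)
  qed
  then show ?thesis using Yv by simp
qed

text \<open>A quantitative form of the fact that the content of a box is smaller than the length of
  the first row.\<close>

lemma star_bound:
  assumes A: "finite A" "p \<in> A" and B: "finite B"
    and inv: "\<And>i j v. i \<in> A \<Longrightarrow> j \<in> A \<Longrightarrow> v \<in> span B \<Longrightarrow> \<tau> i j v \<in> span B"
    and noinv: "\<And>C v. C \<subseteq> A \<Longrightarrow> card C = m \<Longrightarrow> v \<in> span B \<Longrightarrow>
        (\<And>i j. i \<in> C \<Longrightarrow> j \<in> C \<Longrightarrow> \<tau> i j v = v) \<Longrightarrow> v = 0"
    and v: "v \<in> span B"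
  shows "v \<bullet> star A p v \<le> (real m - 2) * (norm v)\<^sup>2"
  using A inv noinv v
proof (induction "card A" arbitrary: A p v rule: less_induct)
  case less
  show ?case
  proof (cases "card A < m")
    case True
    have "v \<bullet> star A p v \<le> (\<Sum>i\<in>A - {p}. (norm v)\<^sup>2)"
      unfolding star_def inner_sum_right
      by (intro sum_mono) (use tau_form_le[of v] in \<open>auto dest: abs_le_D1\<close>)
    also have "\<dots> = (real (card A) - 1) * (norm v)\<^sup>2"
      using less.prems card_gt_0_iff[of A] by (auto simp: card_Diff_singleton of_nat_diff)
    also have "\<dots> \<le> (real m - 2) * (norm v)\<^sup>2"
      using True by (intro mult_right_mono) auto
    finally show ?thesis .
  next
    case False
    show ?thesis
    proof (cases "v = 0")
      case True
      then show ?thesis by simp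
    next
      case v0: False
      obtain c w where w: "w \<in> span B" "w \<noteq> 0" "star A p w = c *\<^sub>R w"
        "\<And>u. u \<in> span B \<Longrightarrow> u \<bullet> star A p u \<le> c * (norm u)\<^sup>2"
      proof (rule top_eigenvector[OF star_symmetric B _ less.prems(5) v0])
        show "star A p u \<in> span B" if "u \<in> span B" for u
          unfolding star_def using less.prems that by (intro span_sum) auto
      qed blast
      have "c \<le> real m - 2"
      proof (rule ccontr)
        assume c: "\<not> ?thesis"
        \<comment> \<open>By induction the star on \<open>A - {p}\<close> is bounded by
          \<open>m - 2\<close>, which is below \<open>c\<close>. So the top eigenvector is fixed by
          all transpositions through \<open>p\<close>, and these generate the symmetric group of
          \<open>A\<close>.\<close>
        have fixp: "\<tau> p q w = w" if q: "q \<in> A" for q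
        proof (cases "q = p")
          case False
          have "u \<bullet> star (A - {p}) q u \<le> (real m - 2) * (norm u)\<^sup>2" if "u \<in> span B" for u
            using False q less.prems that card_Diff1_less[of A p]
            by (intro less.hyps) (auto simp: subset_Diff_insert)
          then show ?thesis
            using False q less.prems c w
            by (intro star_eigenvector_fixed[where V = "span B" and \<mu> = "real m - 2" and c = c]) auto
        qed (simp add: tau_same)
        have "\<tau> i j w = w" if "i \<in> A" "j \<in> A" for i j
        proof (cases "i = p \<or> j = p \<or> i = j")
          case True
          then show ?thesis using fixp that tau_commute tau_same by metis
        next
          case False
          have "\<tau> i p (\<tau> j p w) = \<tau> j i (\<tau> i p w)"
            using False by (subst tau_conj) (auto simp: Transposition.transpose_def)
          then show ?thesis using fixp that by (metis tau_commute)
        qed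
        moreover obtain C where "C \<subseteq> A" "card C = m"
          using False less.prems(1) by (meson obtain_subset_with_card_n not_less)
        ultimately have "w = 0" using less.prems(4) w(1) by blast
        then show False using w by simp
      qed
      then have "c * (norm v)\<^sup>2 \<le> (real m - 2) * (norm v)\<^sup>2" by (intro mult_right_mono) auto
      then show ?thesis using w(4)[OF less.prems(5)] by linarith
    qed
  qed
qed

text \<open>Each \<open>p\<close> contributes its star, at most \<open>m - 2\<close>, and the
  diagonal pair, which acts as 1.\<close>

lemma theta_bound:
  assumes A: "finite A" and B: "finite B"
    and inv: "\<And>i j v. i \<in> A \<Longrightarrow> j \<in> A \<Longrightarrow> v \<in> span B \<Longrightarrow> \<tau> i j v \<in> span B"
    and noinv: "\<And>C v. C \<subseteq> A \<Longrightarrow> card C = m \<Longrightarrow> v \<in> span B \<Longrightarrow>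
        (\<And>i j. i \<in> C \<Longrightarrow> j \<in> C \<Longrightarrow> \<tau> i j v = v) \<Longrightarrow> v = 0"
    and v: "v \<in> span B"
  shows "v \<bullet> theta A v \<le> real (card A) * (real m - 1) * (norm v)\<^sup>2"
proof -
  have "v \<bullet> theta A v = (\<Sum>p\<in>A. v \<bullet> (v + star A p v))"
    unfolding theta_def inner_sum_right
    by (intro sum.cong refl)
      (simp add: star_def sum.remove[OF A] tau_same tau_commute inner_add_right inner_sum_right)
  also have "\<dots> \<le> (\<Sum>p\<in>A. (real m - 1) * (norm v)\<^sup>2)"
  proof (intro sum_mono)
    fix p assume "p \<in> A"
    have "v \<bullet> star A p v \<le> (real m - 2) * (norm v)\<^sup>2"
      by (rule star_bound[OF A \<open>p \<in> A\<close> B _ _ v]) (use inv noinv in blast)+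
    then show "v \<bullet> (v + star A p v) \<le> (real m - 1) * (norm v)\<^sup>2"
      by (simp add: inner_add_right power2_norm_eq_inner algebra_simps)
  qed
  finally show ?thesis by simp
qed

lemma theta_form_le: "\<bar>v \<bullet> theta A v\<bar> \<le> (real (card A))\<^sup>2 * (norm v)\<^sup>2"
proof -
  have "\<bar>v \<bullet> theta A v\<bar> \<le> (\<Sum>p\<in>A. \<Sum>q\<in>A. \<bar>v \<bullet> \<tau> p q v\<bar>)"
    unfolding theta_def inner_sum_right
    by (intro order_trans[OF sum_abs] sum_mono sum_abs)
  also have "\<dots> \<le> (\<Sum>p\<in>A. \<Sum>q\<in>A. (norm v)\<^sup>2)"
    by (intro sum_mono tau_form_le)
  finally show ?thesis by (simp add: power2_eq_square)
qed

end

section \<open>Finitely supported functions as an inner product space\<close>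

text \<open>One vector type serves all index sets: the finite-dimensional function spaces are spans
  inside it, so the lemmas on \<open>real_inner\<close> apply although the dimension varies with
  \<open>n\<close>.\<close>

typedef 'a fsv = "{f :: 'a \<Rightarrow> real. finite {x. f x \<noteq> 0}}"
  morphisms coord Abs_fsv
  by (intro exI[of _ "\<lambda>_. 0"]) simp

setup_lifting type_definition_fsv

lemma finite_support: "finite {x. coord f x \<noteq> 0}"
  using coord[of f] by simp

instantiation fsv :: (type) real_vector
begin

lift_definition zero_fsv :: "'a fsv" is "\<lambda>_. 0" by simp
lift_definition plus_fsv :: "'a fsv \<Rightarrow> 'a fsv \<Rightarrow> 'a fsv" is "\<lambda>f g x. f x + g x"
  subgoal for f g by (rule finite_subset[of _ "{x. f x \<noteq> 0} \<union> {x. g x \<noteq> 0}"]) auto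
  done
lift_definition minus_fsv :: "'a fsv \<Rightarrow> 'a fsv \<Rightarrow> 'a fsv" is "\<lambda>f g x. f x - g x"
  subgoal for f g by (rule finite_subset[of _ "{x. f x \<noteq> 0} \<union> {x. g x \<noteq> 0}"]) auto
  done
lift_definition uminus_fsv :: "'a fsv \<Rightarrow> 'a fsv" is "\<lambda>f x. - f x" by simp
lift_definition scaleR_fsv :: "real \<Rightarrow> 'a fsv \<Rightarrow> 'a fsv" is "\<lambda>c f x. c * f x"
  by (rule finite_subset[rotated]) auto

instance
proof
  fix x y w :: "'a fsv" and a b :: real
  show "x + y + w = x + (y + w)" "x + y = y + x" "0 + x = x" "- x + x = 0" "x - y = x + - y"
    by (transfer; auto simp: algebra_simps)+
  show "a *\<^sub>R (x + y) = a *\<^sub>R x + a *\<^sub>R y" "(a + b) *\<^sub>R x = a *\<^sub>R x + b *\<^sub>R x"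
    "a *\<^sub>R b *\<^sub>R x = (a * b) *\<^sub>R x" "1 *\<^sub>R x = x"
    by (transfer; auto simp: algebra_simps)+
qed

end

instantiation fsv :: (type) real_inner
begin

definition inner_fsv :: "'a fsv \<Rightarrow> 'a fsv \<Rightarrow> real" where
  "inner_fsv f g = (\<Sum>x | coord f x \<noteq> 0. coord f x * coord g x)"
definition norm_fsv :: "'a fsv \<Rightarrow> real" where "norm_fsv f = sqrt (inner f f)"
definition dist_fsv :: "'a fsv \<Rightarrow> 'a fsv \<Rightarrow> real" where "dist_fsv f g = norm (f - g)"
definition sgn_fsv :: "'a fsv \<Rightarrow> 'a fsv" where "sgn_fsv f = inverse (norm f) *\<^sub>R f"
definition uniformity_fsv :: "('a fsv \<times> 'a fsv) filter" where
  "uniformity_fsv = (INF e\<in>{0 <..}. principal {(x, y). dist x y < e})"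
definition open_fsv :: "'a fsv set \<Rightarrow> bool" where
  "open_fsv U = (\<forall>x\<in>U. eventually (\<lambda>(x', y). x' = x \<longrightarrow> y \<in> U) uniformity)"

lemma inner_fsv_superset:
  assumes "finite S" "{x. coord f x \<noteq> 0} \<subseteq> S"
  shows "inner f g = (\<Sum>x\<in>S. coord f x * coord g x)"
  unfolding inner_fsv_def using assms by (intro sum.mono_neutral_left) auto

instance
proof
  fix x y w :: "'a fsv" and r :: real
  show "sgn x = x /\<^sub>R norm x" "dist x y = norm (x - y)" "norm x = sqrt (inner x x)"
    "uniformity = (INF e\<in>{0 <..}. principal {(x, y :: 'a fsv). dist x y < e})"
    by (simp_all add: sgn_fsv_def dist_fsv_def norm_fsv_def uniformity_fsv_def)
  show "open U = (\<forall>x\<in>U. \<forall>\<^sub>F (x', y) in uniformity. x' = x \<longrightarrow> y \<in> U)" for U :: "'a fsv set"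
    by (simp add: open_fsv_def)
  define S where "S = {l. coord x l \<noteq> 0} \<union> {l. coord y l \<noteq> 0}"
  have S: "finite S" by (simp add: S_def finite_support)
  have in_S: "inner u v = (\<Sum>l\<in>S. coord u l * coord v l)" if "{l. coord u l \<noteq> 0} \<subseteq> S" for u v
    using S that by (rule inner_fsv_superset)
  show "inner x y = inner y x"
    by (subst (1 2) in_S) (auto simp: S_def mult.commute)
  show "inner (x + y) w = inner x w + inner y w"
    by (subst (1 2 3) in_S) (auto simp: S_def plus_fsv.rep_eq sum.distrib algebra_simps)
  show "inner (r *\<^sub>R x) y = r * inner x y"
    by (subst (1 2) in_S) (auto simp: S_def scaleR_fsv.rep_eq sum_distrib_left algebra_simps)
  show "0 \<le> inner x x"
    by (simp add: inner_fsv_def sum_nonneg)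
  show "inner x x = 0 \<longleftrightarrow> x = 0"
    by (auto simp: inner_fsv_def sum_nonneg_eq_0_iff finite_support coord_inject[symmetric] zero_fsv.rep_eq fun_eq_iff)
qed

end

lemma coord_simps [simp]:
  "coord 0 x = 0" "coord (f + g) x = coord f x + coord g x" "coord (f - g) x = coord f x - coord g x"
  "coord (- f) x = - coord f x" "coord (c *\<^sub>R f) x = c * coord f x"
  by (simp_all add: zero_fsv.rep_eq plus_fsv.rep_eq minus_fsv.rep_eq uminus_fsv.rep_eq scaleR_fsv.rep_eq)

lemma coord_sum [simp]: "coord (\<Sum>i\<in>I. f i) x = (\<Sum>i\<in>I. coord (f i) x)"
  by (induction I rule: infinite_finite_induct) auto

lemma fsv_eqI: "(\<And>x. coord f x = coord g x) \<Longrightarrow> f = g"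
  by (metis coord_inject ext)

text \<open>The vector vanishes when \<open>S\<close> is infinite.\<close>

lift_definition fvec :: "'a set \<Rightarrow> ('a \<Rightarrow> real) \<Rightarrow> 'a fsv" is
  "\<lambda>S f x. if finite S \<and> x \<in> S then f x else 0"
  by (rule finite_subset[of _ "if finite _ then _ else {}"]) auto

abbreviation delta :: "'a \<Rightarrow> 'a fsv" where "delta x \<equiv> fvec {x} (\<lambda>_. 1)"

lemma coord_fvec: "finite S \<Longrightarrow> coord (fvec S f) x = (if x \<in> S then f x else 0)"
  by transfer simp

lemma coord_delta: "coord (delta x) y = (if y = x then 1 else 0)"
  by (simp add: coord_fvec)

lemma inner_fvec: "finite S \<Longrightarrow> v \<bullet> fvec S f = (\<Sum>x\<in>S. coord v x * f x)"
  by (subst inner_commute, subst inner_fsv_superset[of S])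
    (auto simp: coord_fvec mult.commute split: if_splits)

lemma inner_delta: "v \<bullet> delta x = coord v x"
  by (simp add: inner_fvec)

lemma inj_delta: "inj delta"
proof (rule injI)
  fix x y :: 'a assume "delta x = delta y"
  then have "coord (delta x) x = coord (delta y) x" by simp
  then show "x = y" by (simp add: coord_delta split: if_splits)
qed

lemma orthonormal_delta: "orthonormal (delta ` S)"
  unfolding orthonormal_def pairwise_def orthogonal_def
  by (auto simp: inner_delta coord_delta norm_eq_sqrt_inner)

lemma span_delta:
  assumes "finite S"
  shows "span (delta ` S) = {v. \<forall>x. x \<notin> S \<longrightarrow> coord v x = 0}"
proof (intro subset_antisym span_minimal subsetI)
  show "subspace {v. \<forall>x. x \<notin> S \<longrightarrow> coord v x = 0}" by (auto simp: subspace_def)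
next
  fix v assume v: "v \<in> {v. \<forall>x. x \<notin> S \<longrightarrow> coord v x = 0}"
  then have "v = (\<Sum>x\<in>S. coord v x *\<^sub>R delta x)"
    using assms by (intro fsv_eqI) (auto simp: coord_delta if_distrib sum.delta cong: if_cong)
  also have "\<dots> \<in> span (delta ` S)" by (intro span_sum span_scale span_base) auto
  finally show "v \<in> span (delta ` S)" .
qed (auto simp: coord_delta)

text \<open>A point \<open>s\<close> assigns sites to labels, so composing on the left permutes
  sites. The value 0 for a map that is not bijective keeps the support finite.\<close>

lift_definition perm_op :: "('p \<Rightarrow> 'p) \<Rightarrow> ('k \<Rightarrow> 'p) fsv \<Rightarrow> ('k \<Rightarrow> 'p) fsv" is
  "\<lambda>\<pi> f s. if bij \<pi> then f (\<pi> \<circ> s) else 0"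
proof -
  fix \<pi> :: "'p \<Rightarrow> 'p" and f :: "('k \<Rightarrow> 'p) \<Rightarrow> real"
  assume f: "finite {s. f s \<noteq> 0}"
  show "finite {s. (if bij \<pi> then f (\<pi> \<circ> s) else 0) \<noteq> 0}"
  proof (cases "bij \<pi>")
    case True
    have "inj ((\<circ>) \<pi> :: ('k \<Rightarrow> 'p) \<Rightarrow> _)"
      using True by (auto intro!: injI simp: fun_eq_iff bij_def inj_def)
    then have "finite (((\<circ>) \<pi>) -` {s. f s \<noteq> 0})" using f by (intro finite_vimageI)
    then show ?thesis using True by (simp add: vimage_def)
  qed simp
qed

lemma coord_perm_op: "bij \<pi> \<Longrightarrow> coord (perm_op \<pi> v) s = coord v (\<pi> \<circ> s)"
  by transfer simp

lemma perm_op_linear: "bij \<pi> \<Longrightarrow> linear (perm_op \<pi>)"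
  by (intro linearI fsv_eqI) (simp_all add: coord_perm_op)

abbreviation swap_op :: "'p \<Rightarrow> 'p \<Rightarrow> ('k \<Rightarrow> 'p) fsv \<Rightarrow> ('k \<Rightarrow> 'p) fsv" where
  "swap_op p q \<equiv> perm_op (Transposition.transpose p q)"

lemma coord_swap_op: "coord (swap_op p q v) s = coord v (Transposition.transpose p q \<circ> s)"
  by (simp add: coord_perm_op)

lemma swap_op_involution: "swap_op p q (swap_op p q v) = v"
  by (intro fsv_eqI) (simp add: coord_swap_op comp_assoc[symmetric])

lemma swap_op_symmetric: "symmetric_op (swap_op p q :: ('k \<Rightarrow> 'p) fsv \<Rightarrow> _)"
  unfolding symmetric_op_def
proof (intro conjI allI perm_op_linear)
  fix v w :: "('k \<Rightarrow> 'p) fsv"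
  let ?t = "Transposition.transpose p q"
  define S where "S = {s. coord v s \<noteq> 0} \<union> (\<circ>) ?t ` {s. coord v s \<noteq> 0}"
  have S: "finite S" by (simp add: S_def finite_support)
  have tS: "?t \<circ> s \<in> S" if "s \<in> S" for s
    using that by (auto simp: S_def comp_assoc[symmetric])
  have "swap_op p q v \<bullet> w = (\<Sum>s\<in>S. coord v (?t \<circ> s) * coord w s)"
  proof (subst inner_fsv_superset[OF S])
    show "{s. coord (swap_op p q v) s \<noteq> 0} \<subseteq> S"
    proof
      fix s assume "s \<in> {s. coord (swap_op p q v) s \<noteq> 0}"
      then have "?t \<circ> s \<in> S" by (simp add: coord_swap_op S_def)
      then have "?t \<circ> (?t \<circ> s) \<in> S" by (rule tS)
      then show "s \<in> S" by (simp add: comp_assoc[symmetric])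
    qed
  qed (simp add: coord_swap_op)
  also have "\<dots> = (\<Sum>s\<in>S. coord v s * coord w (?t \<circ> s))"
    by (rule sum.reindex_bij_witness[of _ "\<lambda>s. ?t \<circ> s" "\<lambda>s. ?t \<circ> s"])
      (auto simp: tS comp_assoc[symmetric])
  also have "\<dots> = v \<bullet> swap_op p q w"
    by (subst inner_fsv_superset[OF S]) (auto simp: S_def coord_swap_op)
  finally show "swap_op p q v \<bullet> w = v \<bullet> swap_op p q w" .
qed simp

lemma transpose_conj:
  "Transposition.transpose c d \<circ> Transposition.transpose a b =
   Transposition.transpose a b \<circ>
     Transposition.transpose (Transposition.transpose a b c) (Transposition.transpose a b d)"
  by (auto simp: fun_eq_iff Transposition.transpose_def)

lemma swap_op_conj:
  "swap_op a b (swap_op c d v) =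
   swap_op (Transposition.transpose a b c) (Transposition.transpose a b d) (swap_op a b v)"
  by (intro fsv_eqI)
    (simp add: coord_swap_op comp_assoc[symmetric] transpose_conj[of c d a b])

lemma swap_op_same: "swap_op p p v = v"
  by (intro fsv_eqI) (simp add: coord_perm_op)

interpretation swap: transposition_rep swap_op
  by unfold_locales
    (rule swap_op_symmetric swap_op_involution swap_op_same arg_cong[OF transpose_commute] swap_op_conj)+

text \<open>The action tensored with the sign. For \<open>p = q\<close> the group element is the
  identity, which is even; hence the case distinction.\<close>

definition signed_swap_op :: "'p \<Rightarrow> 'p \<Rightarrow> ('k \<Rightarrow> 'p) fsv \<Rightarrow> ('k \<Rightarrow> 'p) fsv" where
  "signed_swap_op p q v = (if p = q then v else - swap_op p q v)"

lemma swap_op_minus: "swap_op p q (- v) = - swap_op p q v"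
  by (rule linear_neg[OF swap.tau_linear])

lemma signed_swap_op_symmetric: "symmetric_op (signed_swap_op p q)"
  using symmetric_op_scaled_add[OF swap_op_symmetric, of 0 "-1"]
    symmetric_op_scaled_add[OF swap_op_symmetric, of 1 0]
  by (cases "p = q") (simp_all add: signed_swap_op_def[abs_def])

lemma signed_swap_op_commute: "signed_swap_op p q = signed_swap_op q p"
  by (auto simp: signed_swap_op_def fun_eq_iff transpose_commute)

lemma signed_swap_op_conj:
  "signed_swap_op a b (signed_swap_op c d v) =
   signed_swap_op (Transposition.transpose a b c) (Transposition.transpose a b d) (signed_swap_op a b v)"
proof -
  have "Transposition.transpose a b c = Transposition.transpose a b d \<longleftrightarrow> c = d"
    by (metis Transposition.transpose_involutory)
  then show ?thesis
    by (auto simp: signed_swap_op_def swap_op_minus swap_op_conj[of a b c d])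
qed

interpretation signed_swap: transposition_rep signed_swap_op
  by unfold_locales
    (rule signed_swap_op_symmetric signed_swap_op_commute signed_swap_op_conj
      | simp add: signed_swap_op_def swap_op_minus swap_op_involution)+

text \<open>Off the diagonal the two actions cancel. Each of the \<open>card A\<close> diagonal
  pairs acts as the identity in both, which produces the shift by \<open>2 * card A\<close>.\<close>

lemma signed_theta:
  assumes "finite A"
  shows "signed_swap.theta A v = (2 * real (card A)) *\<^sub>R v - swap.theta A v"
proof -
  have "signed_swap.theta A v + swap.theta A v = (\<Sum>p\<in>A. \<Sum>q\<in>A. if p = q then 2 *\<^sub>R v else 0)"
    unfolding signed_swap.theta_def swap.theta_def sum.distrib[symmetric]
    by (intro sum.cong refl) (auto simp: signed_swap_op_def swap.tau_same scaleR_2 simp del: Transposition.transpose_same)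
  also have "\<dots> = (2 * real (card A)) *\<^sub>R v"
    using assms by (simp add: sum_constant_scaleR mult.commute)
  finally show ?thesis by (simp add: algebra_simps)
qed

lemma coord_theta:
  "coord (swap.theta A v) s = (\<Sum>p\<in>A. \<Sum>q\<in>A. coord v (Transposition.transpose p q \<circ> s))"
  by (simp add: swap.theta_def coord_swap_op)

section \<open>Cylinder functions on spaces of injections\<close>

lemma linear_maps_span:
  assumes "linear T" "\<And>g. g \<in> G \<Longrightarrow> T g \<in> span G" "v \<in> span G"
  shows "T v \<in> span G"
proof -
  have "T ` span G = span (T ` G)" by (rule linear_span_image[OF assms(1), symmetric])
  also have "\<dots> \<subseteq> span G" using assms(2) by (intro span_minimal) auto
  finally show ?thesis using assms(3) by auto
qed

text \<open>The star and theta bounds work on spans of finite sets, so the complement of one level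
  in the next must be presented in this form.\<close>

lemma orthogonal_complement_spanned:
  fixes G1 G2 :: "'v::real_inner set"
  assumes "finite G1" "finite G2"
  obtains B where "finite B" "span B = {v \<in> span (G1 \<union> G2). \<forall>w\<in>span G1. v \<bullet> w = 0}"
proof -
  obtain U where U: "finite U" "orthonormal U" "span U = span G1"
    using orthonormal_basis_exists[OF assms(1)] .
  obtain U' where U': "finite U'" "U \<inter> U' = {}" "orthonormal (U \<union> U')"
    "span (U \<union> U') = span (U \<union> G2)"
    using gram_schmidt_extend[OF U(2,1) assms(2)] by auto
  have sp: "span (U \<union> U') = span (G1 \<union> G2)"
    using U(3) U'(4) by (simp add: span_Un)
  have UU: "u \<bullet> w = 0" if "u \<in> U'" "w \<in> U" for u w
    using orthonormal_inner[OF U'(3), of u w] U'(2) that by auto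
  have "span U' = {v \<in> span (G1 \<union> G2). \<forall>w\<in>span G1. v \<bullet> w = 0}" (is "_ = ?V")
  proof (intro subset_antisym subsetI)
    fix v assume v: "v \<in> span U'"
    have "v \<bullet> w = 0" if w: "w \<in> span U" for w
    proof -
      have "w \<bullet> u = 0" if "u \<in> U'" for u
        using orthogonal_to_span_of_set[OF UU[OF that] w] by (simp add: inner_commute)
      then have "w \<bullet> v = 0" using v by (rule orthogonal_to_span_of_set)
      then show ?thesis by (simp add: inner_commute)
    qed
    moreover have "v \<in> span (U \<union> U')" using v span_mono[of U' "U \<union> U'"] by auto
    ultimately show "v \<in> ?V" using sp U(3) by auto
  next
    fix v assume v: "v \<in> ?V"
    then have "v \<in> span (U \<union> U')" using sp by auto
    then have "v = (\<Sum>u\<in>U \<union> U'. (v \<bullet> u) *\<^sub>R u)"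
      by (rule orthonormal_expansion[OF U'(3) finite_UnI[OF U(1) U'(1)]])
    also have "\<dots> = (\<Sum>u\<in>U'. (v \<bullet> u) *\<^sub>R u)"
    proof (intro sum.mono_neutral_right)
      have "v \<bullet> u = 0" if "u \<in> U" for u using v U(3) span_base[OF that] by auto
      then show "\<forall>i\<in>U \<union> U' - U'. (v \<bullet> i) *\<^sub>R i = 0" by auto
    qed (use U U' in auto)
    also have "\<dots> \<in> span U'" by (intro span_sum span_scale span_base)
    finally show "v \<in> span U'" .
  qed
  with that U'(1) show thesis by blast
qed

lemma bij_betw_extend_permutes:
  assumes B: "finite B" "C \<subseteq> B" "C' \<subseteq> B" and f: "bij_betw f C C'"
  obtains \<pi> where "\<pi> permutes B" "\<And>x. x \<in> C \<Longrightarrow> \<pi> x = f x"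
proof -
  have fin: "finite C" "finite C'" using B finite_subset by auto
  have "card (B - C) = card (B - C')"
    using bij_betw_same_card[OF f] B fin by (simp add: card_Diff_subset)
  then obtain g where g: "bij_betw g (B - C) (B - C')"
    using finite_same_card_bij[of "B - C" "B - C'"] B by auto
  define \<pi> where "\<pi> x = (if x \<in> C then f x else if x \<in> B then g x else x)" for x
  have "bij_betw \<pi> C C'" using f by (simp add: \<pi>_def cong: bij_betw_cong)
  moreover have "bij_betw \<pi> (B - C) (B - C')"
    using g bij_betw_cong[of "B - C" \<pi> g] by (simp add: \<pi>_def)
  ultimately have "bij_betw \<pi> (C \<union> (B - C)) (C' \<union> (B - C'))"
    by (intro bij_betw_combine) auto
  then have "bij_betw \<pi> B B" using B by (simp add: Un_absorb1)
  then have "\<pi> permutes B" by (rule bij_imp_permutes) (use B in \<open>auto simp: \<pi>_def\<close>)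
  with that[of \<pi>] show thesis by (simp add: \<pi>_def)
qed

text \<open>Points are total functions that equal \<open>z\<close> off \<open>K\<close>. Since
  \<open>z\<close> avoids \<open>A\<close> there, permutations of \<open>A\<close> leave those
  values alone and composition stays in the space. Taking \<open>K = A\<close> and the identity for
  \<open>z\<close> gives the symmetric group.\<close>

locale injection_space =
  fixes z :: "'k \<Rightarrow> 'p" and K :: "'k set" and A :: "'p set"
  assumes finite_K: "finite K" and finite_A: "finite A"
    and base_outside: "\<And>k. k \<notin> K \<Longrightarrow> z k \<notin> A"
begin

definition injections :: "('k \<Rightarrow> 'p) set" where
  "injections = {s. inj_on s K \<and> s ` K \<subseteq> A \<and> (\<forall>k. k \<notin> K \<longrightarrow> s k = z k)}"

lemma finite_injections: "finite injections"
proof (rule finite_subset)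
  show "injections \<subseteq> (\<lambda>h k. if k \<in> K then h k else z k) ` (K \<rightarrow>\<^sub>E A)"
  proof
    fix s assume "s \<in> injections"
    then show "s \<in> (\<lambda>h k. if k \<in> K then h k else z k) ` (K \<rightarrow>\<^sub>E A)"
      by (intro image_eqI[of _ _ "restrict s K"]) (auto simp: injections_def)
  qed
qed (simp add: finite_PiE finite_K finite_A)

lemma injections_comp:
  assumes "\<pi> permutes A" "s \<in> injections"
  shows "\<pi> \<circ> s \<in> injections"
proof -
  have "inj_on (\<pi> \<circ> s) K"
    using assms inj_on_subset[OF permutes_inj[OF assms(1)] subset_UNIV]
    by (intro comp_inj_on) (auto simp: injections_def)
  moreover have "\<pi> (z k) = z k" if "k \<notin> K" for k
    using permutes_not_in[OF assms(1)] base_outside[OF that] by auto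
  ultimately show ?thesis using assms permutes_in_image[OF assms(1)]
    by (auto simp: injections_def image_subset_iff)
qed

lemma swap_injections:
  assumes "p \<in> A" "q \<in> A"
  shows "Transposition.transpose p q \<circ> s \<in> injections \<longleftrightarrow> s \<in> injections"
proof
  have perm: "Transposition.transpose p q permutes A" using assms by (simp add: permutes_swap_id)
  show "s \<in> injections \<Longrightarrow> Transposition.transpose p q \<circ> s \<in> injections"
    by (rule injections_comp[OF perm])
  assume "Transposition.transpose p q \<circ> s \<in> injections"
  then have "Transposition.transpose p q \<circ> (Transposition.transpose p q \<circ> s) \<in> injections"
    by (rule injections_comp[OF perm])
  then show "s \<in> injections" by (simp add: comp_assoc[symmetric])
qed

text \<open>With \<open>C = A\<close> this is transitivity of the whole group. For smaller
  \<open>C\<close> it identifies the orbits of the symmetric group of \<open>C\<close>: they are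
  determined by the coordinates that lie outside \<open>C\<close>.\<close>

lemma injections_transitive:
  assumes s: "s \<in> injections" "s' \<in> injections" and C: "C \<subseteq> A"
    and agree: "\<And>k. k \<in> K \<Longrightarrow> s k \<in> A - C \<or> s' k \<in> A - C \<Longrightarrow> s k = s' k"
  obtains \<pi> where "\<pi> permutes C" "\<pi> \<circ> s = s'"
proof -
  define D where "D = {k \<in> K. s k \<in> C}"
  have D: "k \<in> D" "s' k \<in> C" if "k \<in> K" "s k \<in> C \<or> s' k \<in> C" for k
  proof -
    have "s k \<in> A" "s' k \<in> A" using s that(1) by (auto simp: injections_def)
    then have "s k \<in> C \<and> s' k \<in> C" using that agree[of k] by (metis DiffI DiffD2)
    then show "k \<in> D" "s' k \<in> C" using that(1) by (auto simp: D_def)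
  qed
  have sD: "inj_on s D" "inj_on s' D" using s by (auto simp: D_def injections_def inj_on_def)
  have "bij_betw (s' \<circ> inv_into D s) (s ` D) (s' ` D)"
    using sD by (intro bij_betw_trans[OF bij_betw_inv_into]) (auto simp: bij_betw_def)
  moreover have "s ` D \<subseteq> C" "s' ` D \<subseteq> C" using D by (auto simp: D_def)
  ultimately obtain \<pi> where \<pi>: "\<pi> permutes C" "\<And>x. x \<in> s ` D \<Longrightarrow> \<pi> x = (s' \<circ> inv_into D s) x"
    using bij_betw_extend_permutes[OF finite_subset[OF C finite_A], of "s ` D" "s' ` D"] by metis
  have "\<pi> (s k) = s' k" for k
  proof (cases "k \<in> D")
    case True
    then show ?thesis using \<pi>(2)[of "s k"] sD by simp
  next
    case False
    have "s k \<notin> C \<and> s k = s' k"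
    proof (cases "k \<in> K")
      case True
      then have "s k \<in> A - C" using False s D by (auto simp: injections_def)
      then show ?thesis using agree[OF True] by auto
    next
      case False
      then show ?thesis using s base_outside[of k] C by (auto simp: injections_def)
    qed
    then show ?thesis using permutes_not_in[OF \<pi>(1)] by auto
  qed
  with that[of \<pi>] \<pi>(1) show thesis by (auto simp: fun_eq_iff)
qed

section \<open>Cylinder functions and the degree filtration\<close>

definition cylinder :: "('k \<times> 'p) set \<Rightarrow> ('k \<Rightarrow> 'p) fsv" where
  "cylinder \<kappa> = fvec injections (\<lambda>s. of_bool (\<forall>x\<in>\<kappa>. s (fst x) = snd x))"

lemma coord_cylinder:
  "coord (cylinder \<kappa>) s = of_bool (s \<in> injections \<and> (\<forall>x\<in>\<kappa>. s (fst x) = snd x))"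
  by (simp add: cylinder_def coord_fvec finite_injections)

definition level :: "nat \<Rightarrow> ('k \<times> 'p) set set" where
  "level j = {\<kappa>. \<kappa> \<subseteq> K \<times> A \<and> card \<kappa> = j}"

definition lower :: "nat \<Rightarrow> ('k \<Rightarrow> 'p) fsv set" where
  "lower j = span (\<Union>i<j. cylinder ` level i)"

lemma finite_level: "finite (level j)"
  by (rule finite_subset[of _ "Pow (K \<times> A)"]) (auto simp: level_def finite_K finite_A)

lemma finite_of_level: "\<kappa> \<in> level j \<Longrightarrow> finite \<kappa>"
  using finite_subset[of \<kappa> "K \<times> A"] by (auto simp: level_def finite_K finite_A)

lemma card_level: "card (level j) = (card K * card A) choose j"
  using n_subsets[of "K \<times> A" j] by (simp add: level_def finite_K finite_A card_cartesian_product)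

lemma subspace_lower: "subspace (lower j)"
  by (simp add: lower_def)

lemma cylinder_in_lower: "\<kappa> \<in> level i \<Longrightarrow> i < j \<Longrightarrow> cylinder \<kappa> \<in> lower j"
  unfolding lower_def by (rule span_base) auto

lemma swap_cylinder:
  assumes "p \<in> A" "q \<in> A"
  shows "swap_op p q (cylinder \<kappa>) = cylinder (map_prod id (Transposition.transpose p q) ` \<kappa>)"
proof (rule fsv_eqI)
  fix s :: "'k \<Rightarrow> 'p"
  have "(Transposition.transpose p q (s k) = l) \<longleftrightarrow> s k = Transposition.transpose p q l" for k l
    by (metis Transposition.transpose_involutory)
  then show "coord (swap_op p q (cylinder \<kappa>)) s =
      coord (cylinder (map_prod id (Transposition.transpose p q) ` \<kappa>)) s"
    by (simp add: coord_swap_op coord_cylinder swap_injections[OF assms])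
qed

lemma swap_level:
  assumes "p \<in> A" "q \<in> A" "\<kappa> \<in> level j"
  shows "map_prod id (Transposition.transpose p q) ` \<kappa> \<in> level j"
proof -
  have "inj_on (map_prod id (Transposition.transpose p q)) \<kappa>"
    by (rule inj_on_subset[of _ UNIV]) (auto intro: prod.inj_map)
  then have "card (map_prod id (Transposition.transpose p q) ` \<kappa>) = card \<kappa>" by (rule card_image)
  moreover have "Transposition.transpose p q l \<in> A" if "l \<in> A" for l
    using assms that by (simp add: Transposition.transpose_def)
  ultimately show ?thesis using assms(3) by (auto simp: level_def)
qed

lemma swap_lower:
  assumes "p \<in> A" "q \<in> A" "v \<in> lower j"
  shows "swap_op p q v \<in> lower j"
  unfolding lower_def
proof (rule linear_maps_span[OF swap.tau_linear])
  fix g assume "g \<in> (\<Union>i<j. cylinder ` level i)"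
  then obtain i \<kappa> where i: "i < j" "\<kappa> \<in> level i" "g = cylinder \<kappa>" by auto
  have "swap_op p q g \<in> (\<Union>i<j. cylinder ` level i)"
    unfolding i(3) swap_cylinder[OF assms(1,2)] using i(1) swap_level[OF assms(1,2) i(2)] by blast
  then show "swap_op p q g \<in> span (\<Union>i<j. cylinder ` level i)" by (rule span_base)
qed (use assms(3) in \<open>simp add: lower_def\<close>)

lemma theta_lower: "v \<in> lower j \<Longrightarrow> swap.theta A v \<in> lower j"
  unfolding swap.theta_def by (intro subspace_sum subspace_lower swap_lower)

lemma cylinder_eq_0:
  assumes "\<kappa> \<subseteq> K \<times> A" "\<not> (inj_on fst \<kappa> \<and> inj_on snd \<kappa>)"
  shows "cylinder \<kappa> = 0"
proof (rule fsv_eqI)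
  fix s
  have "inj_on fst \<kappa> \<and> inj_on snd \<kappa>"
    if s: "s \<in> injections" "\<forall>x\<in>\<kappa>. s (fst x) = snd x"
  proof (intro conjI inj_onI)
    fix x y assume xy: "x \<in> \<kappa>" "y \<in> \<kappa>"
    have K: "fst x \<in> K" "fst y \<in> K" using xy assms(1) by auto
    have eq: "s (fst x) = snd x" "s (fst y) = snd y" using s xy by auto
    show "fst x = fst y \<Longrightarrow> x = y" using eq by (simp add: prod_eq_iff)
    have "inj_on s K" using s by (simp add: injections_def)
    then show "snd x = snd y \<Longrightarrow> x = y" using eq K by (simp add: prod_eq_iff inj_on_def)
  qed
  then show "coord (cylinder \<kappa>) s = coord 0 s"
    using assms(2) by (auto simp: coord_cylinder)
qed

text \<open>Summing over all positions removes the constraint on one coordinate; by injectivity the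
  positions occupied by the other coordinates contribute nothing.\<close>

lemma sum_swap_free:
  assumes \<kappa>: "\<kappa> \<subseteq> K \<times> A" "inj_on fst \<kappa>" "inj_on snd \<kappa>" and x: "x \<in> \<kappa>"
  shows "(\<Sum>q\<in>A - snd ` \<kappa>. swap_op (snd x) q (cylinder \<kappa>)) = cylinder (\<kappa> - {x}) - cylinder \<kappa>"
proof (rule fsv_eqI)
  fix s
  let ?I = "snd ` \<kappa>"
  obtain k p where kp: "x = (k, p)" by (cases x)
  have pA: "p \<in> A" "k \<in> K" using x \<kappa> kp by auto
  show "coord (\<Sum>q\<in>A - ?I. swap_op (snd x) q (cylinder \<kappa>)) s = coord (cylinder (\<kappa> - {x}) - cylinder \<kappa>) s"
  proof (cases "s \<in> injections")
    case False
    have "coord (swap_op p q (cylinder \<kappa>)) s = 0" if "q \<in> A - ?I" for q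
      using that pA False by (auto simp: coord_swap_op coord_cylinder swap_injections)
    then show ?thesis using False kp by (simp add: coord_cylinder)
  next
    case True
    define oth where "oth \<longleftrightarrow> (\<forall>y\<in>\<kappa> - {x}. s (fst y) = snd y)"
    have eq: "coord (swap_op p q (cylinder \<kappa>)) s = of_bool (oth \<and> s k = q)" if q: "q \<in> A - ?I" for q
    proof -
      have "Transposition.transpose p q (s (fst y)) = snd y \<longleftrightarrow> s (fst y) = snd y"
        if y: "y \<in> \<kappa> - {x}" for y
      proof -
        have "snd y \<noteq> p" using y x kp \<kappa>(3) by (auto simp: inj_on_def)
        moreover have "snd y \<noteq> q" using y q by auto
        ultimately show ?thesis by (auto simp: Transposition.transpose_def)
      qed
      moreover have "Transposition.transpose p q (s k) = p \<longleftrightarrow> s k = q"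
        by (auto simp: Transposition.transpose_def)
      ultimately have "(\<forall>y\<in>\<kappa>. Transposition.transpose p q (s (fst y)) = snd y) \<longleftrightarrow> oth \<and> s k = q"
        unfolding oth_def using x kp by (metis Diff_iff fst_conv insertE insert_Diff singletonD snd_conv)
      then show ?thesis using True pA q by (simp add: coord_swap_op coord_cylinder swap_injections)
    qed
    have "coord (\<Sum>q\<in>A - ?I. swap_op (snd x) q (cylinder \<kappa>)) s = (\<Sum>q\<in>A - ?I. if s k = q then of_bool oth else 0)"
      unfolding coord_sum by (intro sum.cong refl) (simp add: kp eq)
    also have "\<dots> = of_bool (oth \<and> s k \<in> A - ?I)"
      using finite_A by simp
    also have "\<dots> = of_bool oth - of_bool (oth \<and> s k = p)"
    proof (cases oth)
      case oth: True
      have skA: "s k \<in> A" using True pA by (auto simp: injections_def)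
      have "s k = p" if skI: "s k \<in> ?I"
      proof -
        obtain y where y: "y \<in> \<kappa>" "s k = snd y" using skI by (rule imageE) auto
        show ?thesis
        proof (cases "y = x")
          case False
          then have "s (fst y) = s k" using oth y by (auto simp: oth_def)
          moreover have "fst y \<in> K" using y \<kappa> by auto
          ultimately have "fst y = k" using True pA by (auto simp: injections_def inj_on_def)
          then have "y = x" using y x \<kappa>(2) kp by (auto simp: inj_on_def)
          then show ?thesis using False by simp
        qed (use y kp in simp)
      qed
      moreover have "p \<in> ?I" using x kp by force
      ultimately show ?thesis using skA oth by auto
    qed simp
    also have "\<dots> = coord (cylinder (\<kappa> - {x}) - cylinder \<kappa>) s"
    proof -
      have "(\<forall>y\<in>\<kappa>. s (fst y) = snd y) \<longleftrightarrow> oth \<and> s k = p"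
        unfolding oth_def using x kp by (metis Diff_iff fst_conv insertE insert_Diff singletonD snd_conv)
      then show ?thesis using True by (simp add: coord_cylinder oth_def)
    qed
    finally show ?thesis .
  qed
qed

text \<open>Pairs of sites are sorted by how many of them \<kappa> pins. Two free sites fix the
  cylinder. One free and one pinned site give lower cylinders and, for each of the two orders,
  \<open>- j\<close> copies of the cylinder itself. Two pinned sites only rearrange the constraints
  within level \<open>j\<close>.\<close>

lemma theta_cylinder:
  assumes \<kappa>: "\<kappa> \<in> level j" "inj_on fst \<kappa>" "inj_on snd \<kappa>" and j: "j \<le> card A"
  shows "swap.theta A (cylinder \<kappa>) =
    ((real (card A) - real j)\<^sup>2 - 2 * real j) *\<^sub>R cylinder \<kappa>
    + (\<Sum>p\<in>snd ` \<kappa>. \<Sum>q\<in>snd ` \<kappa>. swap_op p q (cylinder \<kappa>))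
    + 2 *\<^sub>R (\<Sum>x\<in>\<kappa>. cylinder (\<kappa> - {x}))"
proof -
  let ?I = "snd ` \<kappa>" and ?e = "cylinder \<kappa>"
  have sub: "\<kappa> \<subseteq> K \<times> A" and cj: "card \<kappa> = j" using \<kappa> by (auto simp: level_def)
  have IA: "?I \<subseteq> A" using sub by auto
  have cI: "card ?I = j" using card_image[OF \<kappa>(3)] cj by simp
  have finI: "finite ?I" using IA finite_A finite_subset by auto
  have cAI: "real (card (A - ?I)) = real (card A) - real j"
    using card_Diff_subset[OF finI IA] cI j by simp
  have split: "(\<Sum>q\<in>A. h q) = (\<Sum>q\<in>?I. h q) + (\<Sum>q\<in>A - ?I. h q)" for h :: "'p \<Rightarrow> ('k \<Rightarrow> 'p) fsv"
    using sum.subset_diff[OF IA finite_A, of h] by (simp add: add.commute)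
  have free: "swap_op p q ?e = ?e" if "p \<in> A - ?I" "q \<in> A - ?I" for p q
  proof -
    have "map_prod id (Transposition.transpose p q) y = y" if "y \<in> \<kappa>" for y
      using that \<open>p \<in> A - ?I\<close> \<open>q \<in> A - ?I\<close>
      by (cases y) (auto simp: Transposition.transpose_def, (metis Diff_iff image_eqI snd_conv)+)
    then have "map_prod id (Transposition.transpose p q) ` \<kappa> = \<kappa>" by force
    then show ?thesis using that swap_cylinder by auto
  qed
  have mixed: "(\<Sum>p\<in>?I. \<Sum>q\<in>A - ?I. swap_op p q ?e) = (\<Sum>x\<in>\<kappa>. cylinder (\<kappa> - {x})) - real j *\<^sub>R ?e"
  proof -
    have "(\<Sum>p\<in>?I. \<Sum>q\<in>A - ?I. swap_op p q ?e) = (\<Sum>x\<in>\<kappa>. cylinder (\<kappa> - {x}) - ?e)"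
      by (subst sum.reindex[OF \<kappa>(3)]) (simp add: sum_swap_free[OF sub \<kappa>(2,3)])
    then show ?thesis by (simp add: sum_subtractf cj sum_constant_scaleR)
  qed
  have mixed': "(\<Sum>p\<in>A - ?I. \<Sum>q\<in>?I. swap_op p q ?e) = (\<Sum>p\<in>?I. \<Sum>q\<in>A - ?I. swap_op p q ?e)"
    by (subst sum.swap) (simp add: Transposition.transpose_commute)
  have "(\<Sum>p\<in>A - ?I. \<Sum>q\<in>A - ?I. swap_op p q ?e) = (real (card A) - real j)\<^sup>2 *\<^sub>R ?e"
    using free by (simp add: sum_constant_scaleR cAI power2_eq_square)
  then have "swap.theta A ?e = (\<Sum>p\<in>?I. \<Sum>q\<in>?I. swap_op p q ?e)
      + 2 *\<^sub>R ((\<Sum>x\<in>\<kappa>. cylinder (\<kappa> - {x})) - real j *\<^sub>R ?e)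
      + (real (card A) - real j)\<^sup>2 *\<^sub>R ?e"
    unfolding swap.theta_def split sum.distrib mixed' mixed
    by (simp add: scaleR_2)
  then show ?thesis by (simp add: algebra_simps)
qed

definition walk_op :: "real \<Rightarrow> real \<Rightarrow> ('k \<Rightarrow> 'p) fsv \<Rightarrow> ('k \<Rightarrow> 'p) fsv" where
  "walk_op a b v = a *\<^sub>R v + b *\<^sub>R swap.theta A v"

lemma walk_op_symmetric: "symmetric_op (walk_op a b)"
  unfolding walk_op_def[abs_def] by (intro symmetric_op_scaled_add swap.theta_symmetric)

lemma walk_op_lower: "v \<in> lower j \<Longrightarrow> walk_op a b v \<in> lower j"
  unfolding walk_op_def by (intro subspace_add subspace_scale subspace_lower theta_lower)

text \<open>The radius is the absolute row sum: the diagonal coefficient and one unit of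
  \<open>b\<close> for each of the \<open>j^2\<close> ordered pairs of pinned sites. For
  \<open>a = 1 - F^2 / N\<close> and \<open>b = 1 / N\<close>, as long as the first term is
  nonnegative, it collapses to \<open>1 - 2 j (F - j + 1) / N\<close>.\<close>

lemma walk_op_cylinder:
  assumes \<kappa>: "\<kappa> \<in> level j" and j: "j \<le> card A"
  shows "walk_op a b (cylinder \<kappa>) \<in> coeff_ball (lower j) cylinder (level j)
    (\<bar>a + b * ((real (card A) - real j)\<^sup>2 - 2 * real j)\<bar> + \<bar>b\<bar> * (real j)\<^sup>2)"
proof (cases "inj_on fst \<kappa> \<and> inj_on snd \<kappa>")
  case False
  have "walk_op a b (cylinder \<kappa>) = 0"
    using cylinder_eq_0 \<kappa> False by (simp add: level_def walk_op_def linear_0[OF symmetric_opD(1)[OF swap.theta_symmetric]])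
  moreover have "0 \<in> coeff_ball (lower j) cylinder (level j) r" if "r \<ge> 0" for r
    by (rule coeff_ball_mono[OF coeff_ball_lower[OF subspace_0[OF subspace_lower]] that])
  ultimately show ?thesis by simp
next
  case True
  let ?B = "coeff_ball (lower j) cylinder (level j)"
  let ?c = "a + b * ((real (card A) - real j)\<^sup>2 - 2 * real j)" and ?I = "snd ` \<kappa>"
  have IA: "?I \<subseteq> A" and cI: "card ?I = j"
    using \<kappa> card_image[of snd \<kappa>] True by (auto simp: level_def)
  have fin: "finite \<kappa>" using \<kappa> by (rule finite_of_level)
  have eq: "walk_op a b (cylinder \<kappa>) = (?c *\<^sub>R cylinder \<kappa>
      + b *\<^sub>R (\<Sum>p\<in>?I. \<Sum>q\<in>?I. swap_op p q (cylinder \<kappa>)))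
      + (2 * b) *\<^sub>R (\<Sum>x\<in>\<kappa>. cylinder (\<kappa> - {x}))"
    using True by (simp add: walk_op_def theta_cylinder[OF \<kappa> _ _ j] algebra_simps)
  have "?c *\<^sub>R cylinder \<kappa> \<in> ?B (\<bar>?c\<bar> * 1)"
    by (intro coeff_ball_scale coeff_ball_base subspace_lower finite_level \<kappa>)
  moreover have "b *\<^sub>R (\<Sum>p\<in>?I. \<Sum>q\<in>?I. swap_op p q (cylinder \<kappa>)) \<in> ?B (\<bar>b\<bar> * (\<Sum>p\<in>?I. \<Sum>q\<in>?I. 1))"
  proof (intro coeff_ball_scale coeff_ball_sum subspace_lower finite_imageI fin)
    fix p q assume "p \<in> ?I" "q \<in> ?I"
    then have "p \<in> A" "q \<in> A" using IA by auto
    then show "swap_op p q (cylinder \<kappa>) \<in> ?B 1"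
      using swap_level[OF _ _ \<kappa>]
      by (simp add: swap_cylinder coeff_ball_base[OF subspace_lower finite_level])
  qed
  moreover have "(2 * b) *\<^sub>R (\<Sum>x\<in>\<kappa>. cylinder (\<kappa> - {x})) \<in> ?B 0"
  proof (intro coeff_ball_lower subspace_scale subspace_sum subspace_lower)
    fix x assume x: "x \<in> \<kappa>"
    have "\<kappa> - {x} \<in> level (j - 1)" using \<kappa> x fin by (auto simp: level_def)
    moreover have "j > 0" using \<kappa> x fin card_gt_0_iff[of \<kappa>] by (auto simp: level_def)
    then have "j - 1 < j" by simp
    ultimately show "cylinder (\<kappa> - {x}) \<in> lower j" by (rule cylinder_in_lower)
  qed
  ultimately have "walk_op a b (cylinder \<kappa>) \<in> ?B (\<bar>?c\<bar> * 1 + \<bar>b\<bar> * (\<Sum>p\<in>?I. \<Sum>q\<in>?I. 1) + 0)"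
    unfolding eq by (intro coeff_ball_add subspace_lower)
  then show ?thesis using cI by (simp add: power2_eq_square)
qed

lemma lower_Suc: "lower (Suc j) = span (lower j \<union> cylinder ` level j)"
  by (simp add: lower_def lessThan_Suc Un_commute span_Un span_span)

lemma walk_op_level_contraction:
  assumes j: "j \<le> card A" and v: "v \<in> lower (Suc j)" "\<And>w. w \<in> lower j \<Longrightarrow> v \<bullet> w = 0"
  shows "norm (walk_op a b v) \<le>
    (\<bar>a + b * ((real (card A) - real j)\<^sup>2 - 2 * real j)\<bar> + \<bar>b\<bar> * (real j)\<^sup>2) * norm v"
  by (rule level_contraction[OF walk_op_symmetric finite_level subspace_lower walk_op_lower walk_op_cylinder])
    (use j v in \<open>auto simp: lower_Suc\<close>)

text \<open>Among the points where \<open>v\<close> does not vanish choose \<open>s\<close> with as many coordinates outside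
  \<open>C\<close> as possible; on the cylinder of these coordinates \<open>v\<close> is constant where it is nonzero.\<close>

lemma fixed_orthogonal_eq_0:
  assumes supp: "\<And>s. s \<notin> injections \<Longrightarrow> coord v s = 0"
    and C: "C \<subseteq> A" "card (A - C) < j"
    and orth: "\<And>w. w \<in> lower j \<Longrightarrow> v \<bullet> w = 0"
    and fixed: "\<And>p q. p \<in> C \<Longrightarrow> q \<in> C \<Longrightarrow> swap_op p q v = v"
  shows "v = 0"
proof (rule ccontr)
  assume "v \<noteq> 0"
  have inv: "coord v (\<pi> \<circ> s) = coord v s" if "\<pi> permutes C" for \<pi> s
  proof -
    have finC: "finite C" using C finite_A finite_subset by auto
    show ?thesis using that finC
    proof (induction arbitrary: s rule: permutes_induct[consumes 2, case_names id swap])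
      case id
      then show ?case by simp
    next
      case (swap a b \<pi>)
      have "coord v (Transposition.transpose a b \<circ> (\<pi> \<circ> s)) = coord (swap_op a b v) (\<pi> \<circ> s)"
        by (simp add: coord_swap_op)
      also have "\<dots> = coord v s" unfolding fixed[OF swap(1,2)] by (rule swap.IH)
      finally show ?case by (simp only: comp_assoc)
    qed
  qed
  define \<kappa> where "\<kappa> s = {(k, s k) |k. k \<in> K \<and> s k \<in> A - C}" for s :: "'k \<Rightarrow> 'p"
  have \<kappa>_sub: "\<kappa> s \<subseteq> K \<times> A" for s by (auto simp: \<kappa>_def)
  have fin\<kappa>: "finite (\<kappa> s)" for s
    using finite_subset[OF \<kappa>_sub] finite_K finite_A by auto
  have card\<kappa>: "card (\<kappa> s) < j" if "s \<in> injections" for s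
  proof -
    have "inj_on snd (\<kappa> s)" using that by (auto simp: \<kappa>_def injections_def inj_on_def)
    then have "card (\<kappa> s) = card (snd ` \<kappa> s)" by (simp add: card_image)
    also have "\<dots> \<le> card (A - C)" using finite_A by (intro card_mono) (auto simp: \<kappa>_def)
    finally show ?thesis using C by simp
  qed
  define N where "N = {s \<in> injections. coord v s \<noteq> 0}"
  have "N \<noteq> {}"
  proof
    assume "N = {}"
    then have "coord v s = 0" for s using supp unfolding N_def by blast
    then have "v = 0" by (intro fsv_eqI) simp
    then show False using \<open>v \<noteq> 0\<close> by simp
  qed
  moreover have finN: "finite N" using finite_injections by (simp add: N_def)
  ultimately have "Max ((\<lambda>s. card (\<kappa> s)) ` N) \<in> (\<lambda>s. card (\<kappa> s)) ` N" by (intro Max_in) auto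
  then obtain s where s: "s \<in> N" "card (\<kappa> s) = Max ((\<lambda>s. card (\<kappa> s)) ` N)" by (rule imageE) simp
  have smax: "card (\<kappa> s') \<le> card (\<kappa> s)" if "s' \<in> N" for s'
    unfolding s(2) using finN that by (intro Max_ge) auto
  have sX: "s \<in> injections" "coord v s \<noteq> 0" using s by (auto simp: N_def)
  \<comment> \<open>A point of this cylinder satisfies
    \<open>\<kappa> s \<subseteq> \<kappa> s'\<close>. Strict inclusion forces \<open>v\<close> to
    vanish at \<open>s'\<close> by maximality; equality puts \<open>s'\<close> into the orbit of
    \<open>s\<close> under the symmetric group of \<open>C\<close>.\<close>
  have val: "coord v s' * of_bool (\<forall>x\<in>\<kappa> s. s' (fst x) = snd x) = coord v s * of_bool (\<kappa> s' = \<kappa> s)"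
    if s': "s' \<in> injections" for s'
  proof -
    have iff: "(\<forall>x\<in>\<kappa> s. s' (fst x) = snd x) \<longleftrightarrow> \<kappa> s \<subseteq> \<kappa> s'"
      by (auto simp: \<kappa>_def)
    show ?thesis
    proof (cases "\<kappa> s' = \<kappa> s")
      case True
      have agree: "s k = s' k" if "k \<in> K" "s k \<in> A - C \<or> s' k \<in> A - C" for k
        using that(2)
      proof
        assume "s k \<in> A - C"
        then have "(k, s k) \<in> \<kappa> s'" using that(1) unfolding True by (simp add: \<kappa>_def)
        then show ?thesis by (simp add: \<kappa>_def)
      next
        assume "s' k \<in> A - C"
        then have "(k, s' k) \<in> \<kappa> s" using that(1) unfolding True[symmetric] by (simp add: \<kappa>_def)
        then show ?thesis by (simp add: \<kappa>_def)
      qed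
      have "coord v s' = coord v s"
        by (rule injections_transitive[OF sX(1) s' C(1)], erule (1) agree)
          (use inv in auto)
      then show ?thesis using iff True by simp
    next
      case False
      have "coord v s' = 0" if "\<kappa> s \<subseteq> \<kappa> s'"
      proof (rule ccontr)
        assume "coord v s' \<noteq> 0"
        then have "s' \<in> N" using s' by (simp add: N_def)
        then have "card (\<kappa> s') \<le> card (\<kappa> s)" by (rule smax)
        moreover have "card (\<kappa> s) < card (\<kappa> s')"
          using False that by (intro psubset_card_mono[OF fin\<kappa>]) auto
        ultimately show False by simp
      qed
      then show ?thesis using iff False by auto
    qed
  qed
  have "v \<bullet> cylinder (\<kappa> s) = (\<Sum>s'\<in>injections. coord v s * of_bool (\<kappa> s' = \<kappa> s))"
    unfolding cylinder_def inner_fvec[OF finite_injections] by (intro sum.cong refl val)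
  also have "\<dots> = coord v s * real (card {s' \<in> injections. \<kappa> s' = \<kappa> s})"
    by (simp add: sum_distrib_left[symmetric] sum.If_cases[OF finite_injections] of_bool_def Int_def)
  also have "\<dots> \<noteq> 0"
    using sX finite_injections by (auto simp: card_gt_0_iff)
  finally have "v \<bullet> cylinder (\<kappa> s) \<noteq> 0" .
  moreover have "cylinder (\<kappa> s) \<in> lower j"
    using \<kappa>_sub by (intro cylinder_in_lower[OF _ card\<kappa>[OF sX(1)]]) (simp add: level_def)
  ultimately show False using orth[of "cylinder (\<kappa> s)"] by simp
qed

text \<open>The choice \<open>m = card A + 1 - j\<close> leaves \<open>j - 1\<close> sites outside
  an \<open>m\<close>-subset. A vector invariant under its symmetric group then depends on fewer
  than \<open>j\<close> coordinates, so it cannot be orthogonal to \<open>lower j\<close> unless it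
  is 0.\<close>

lemma theta_form_bound:
  assumes B: "finite B" and supp: "\<And>v s. v \<in> span B \<Longrightarrow> s \<notin> injections \<Longrightarrow> coord v s = 0"
    and inv: "\<And>p q v. p \<in> A \<Longrightarrow> q \<in> A \<Longrightarrow> v \<in> span B \<Longrightarrow> swap_op p q v \<in> span B"
    and orth: "\<And>v w. v \<in> span B \<Longrightarrow> w \<in> lower j \<Longrightarrow> v \<bullet> w = 0"
    and j: "0 < j" "j \<le> card A" and v: "v \<in> span B"
  shows "v \<bullet> swap.theta A v \<le> real (card A) * (real (card A) - real j) * (norm v)\<^sup>2"
proof -
  have "v \<bullet> swap.theta A v \<le> real (card A) * (real (card A + 1 - j) - 1) * (norm v)\<^sup>2"
  proof (rule swap.theta_bound[OF finite_A B inv _ v])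
    fix C w assume C: "C \<subseteq> A" "card C = card A + 1 - j" and w: "w \<in> span B"
      "\<And>i l. i \<in> C \<Longrightarrow> l \<in> C \<Longrightarrow> swap_op i l w = w"
    have "card (A - C) < j"
      using C j card_Diff_subset[OF finite_subset[OF C(1) finite_A] C(1)] by linarith
    then show "w = 0" using C w supp[OF w(1)] orth[OF w(1)]
      by (intro fixed_orthogonal_eq_0[of w C j]) auto
  qed auto
  then show ?thesis using j by (simp add: of_nat_diff)
qed

lemma swap_support:
  assumes "\<And>s. s \<notin> injections \<Longrightarrow> coord v s = 0" "p \<in> A" "q \<in> A" "s \<notin> injections"
  shows "coord (swap_op p q v) s = 0"
  using assms by (simp add: coord_swap_op swap_injections)

lemma lower_top:
  assumes "injections \<noteq> {}"
  shows "lower (Suc (card K)) = span (delta ` injections)"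
proof (intro subset_antisym)
  show "lower (Suc (card K)) \<subseteq> span (delta ` injections)"
    unfolding lower_def
    by (rule span_minimal[OF _ subspace_span]) (auto simp: span_delta finite_injections coord_cylinder)
  have "delta s \<in> lower (Suc (card K))" if s: "s \<in> injections" for s
  proof -
    let ?\<kappa> = "(\<lambda>k. (k, s k)) ` K"
    have "delta s = cylinder ?\<kappa>"
    proof (rule fsv_eqI)
      fix u
      have "u = s \<longleftrightarrow> u \<in> injections \<and> (\<forall>k\<in>K. u k = s k)"
      proof (intro iffI ext)
        show "u \<in> injections \<and> (\<forall>k\<in>K. u k = s k) \<Longrightarrow> u k = s k" for k
          using s by (cases "k \<in> K") (auto simp: injections_def)
      qed (use s in auto)
      then show "coord (delta s) u = coord (cylinder ?\<kappa>) u"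
        by (simp add: coord_delta coord_cylinder)
    qed
    moreover have "?\<kappa> \<in> level (card K)"
      using s by (auto simp: level_def injections_def card_image inj_on_def)
    ultimately show ?thesis using cylinder_in_lower[of ?\<kappa> "card K"] by simp
  qed
  then show "span (delta ` injections) \<subseteq> lower (Suc (card K))"
    by (intro span_minimal subspace_lower) auto
qed

text \<open>Vertex transitivity: \<open>theta\<close> is invariant under conjugation, so it commutes
  with every permutation of \<open>A\<close>, and these act transitively on the points.\<close>

lemma walk_op_diagonal:
  assumes "s \<in> injections" "s' \<in> injections"
  shows "coord ((walk_op a b ^^ n) (delta s')) s' = coord ((walk_op a b ^^ n) (delta s)) s"
proof -
  obtain \<pi> where \<pi>: "\<pi> permutes A" "\<pi> \<circ> s = s'"
    using injections_transitive[OF assms, of A] by auto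
  have bij: "bij \<pi>" using \<pi>(1) by (rule permutes_bij)
  interpret lin: linear "perm_op \<pi> :: ('k \<Rightarrow> 'p) fsv \<Rightarrow> _" by (rule perm_op_linear[OF bij])
  have comm: "perm_op \<pi> (swap.theta A v) = swap.theta A (perm_op \<pi> v)" for v :: "('k \<Rightarrow> 'p) fsv"
  proof (rule fsv_eqI)
    fix u
    have tr: "Transposition.transpose (\<pi> p) (\<pi> q) \<circ> \<pi> = \<pi> \<circ> Transposition.transpose p q" for p q
      using bij by (auto simp: fun_eq_iff Transposition.transpose_def bij_def inj_def)
    have "coord (perm_op \<pi> (swap.theta A v)) u = (\<Sum>p\<in>A. \<Sum>q\<in>A. coord v (Transposition.transpose p q \<circ> (\<pi> \<circ> u)))"
      by (simp add: coord_perm_op[OF bij] coord_theta)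
    also have "\<dots> = (\<Sum>p\<in>A. \<Sum>q\<in>A. coord v (Transposition.transpose (\<pi> p) (\<pi> q) \<circ> (\<pi> \<circ> u)))"
      by (subst sum.permute[OF \<pi>(1)], intro sum.cong refl, simp only: o_apply,
          subst sum.permute[OF \<pi>(1)], simp)
    also have "\<dots> = coord (swap.theta A (perm_op \<pi> v)) u"
      by (simp only: comp_assoc[symmetric] tr) (simp add: coord_theta coord_perm_op[OF bij] comp_assoc)
    finally show "coord (perm_op \<pi> (swap.theta A v)) u = coord (swap.theta A (perm_op \<pi> v)) u" .
  qed
  have "perm_op \<pi> ((walk_op a b ^^ n) v) = (walk_op a b ^^ n) (perm_op \<pi> v)" for v
    by (induction n) (simp_all add: walk_op_def lin.add lin.scale comm)
  moreover have "perm_op \<pi> (delta s') = delta s"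
  proof (rule fsv_eqI)
    fix u
    have "\<pi> \<circ> u = \<pi> \<circ> s \<longleftrightarrow> u = s"
      using bij by (auto simp: fun_eq_iff bij_def inj_def)
    then show "coord (perm_op \<pi> (delta s')) u = coord (delta s) u"
      by (simp add: coord_perm_op[OF bij] coord_delta \<pi>(2)[symmetric])
  qed
  moreover have "coord ((walk_op a b ^^ n) (delta s')) s' = coord (perm_op \<pi> ((walk_op a b ^^ n) (delta s'))) s"
    by (simp add: coord_perm_op[OF bij] \<pi>(2))
  ultimately show ?thesis by simp
qed

text \<open>The diagonal is constant, so the left side is the trace. Even exponents make it a sum of
  squared norms, the form that the filtration bound takes.\<close>

lemma card_times_diagonal:
  assumes "s \<in> injections"
  shows "real (card injections) * coord ((walk_op a b ^^ (2 * h)) (delta s)) s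
    = (\<Sum>d\<in>delta ` injections. (norm ((walk_op a b ^^ h) d))\<^sup>2)"
proof -
  have "(\<Sum>d\<in>delta ` injections. (norm ((walk_op a b ^^ h) d))\<^sup>2)
      = (\<Sum>u\<in>injections. (norm ((walk_op a b ^^ h) (delta u)))\<^sup>2)"
    by (rule sum.reindex[OF inj_on_subset[OF inj_delta subset_UNIV], unfolded o_def])
  also have "\<dots> = (\<Sum>u\<in>injections. coord ((walk_op a b ^^ (2 * h)) (delta s)) s)"
  proof (intro sum.cong refl)
    fix u assume u: "u \<in> injections"
    have "(norm ((walk_op a b ^^ h) (delta u)))\<^sup>2 = (walk_op a b ^^ h) ((walk_op a b ^^ h) (delta u)) \<bullet> delta u"
      using symmetric_opD(2)[OF symmetric_op_funpow[OF walk_op_symmetric, of h a b]]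
      by (simp add: power2_norm_eq_inner)
    also have "\<dots> = coord ((walk_op a b ^^ (2 * h)) (delta u)) u"
      by (simp add: inner_delta funpow_add mult_2)
    also have "\<dots> = coord ((walk_op a b ^^ (2 * h)) (delta s)) s"
      by (rule walk_op_diagonal[OF assms u])
    finally show "(norm ((walk_op a b ^^ h) (delta u)))\<^sup>2 = \<dots>" .
  qed
  finally show ?thesis by simp
qed

end

section \<open>Return probabilities on spaces of injections\<close>

context injection_space
begin

text \<open>The drop \<open>j * (F - j + 1)\<close> is sharp for two-row shapes and decides the constant for small
  \<open>j\<close>; from \<open>j = F / 2\<close> on, the drop \<open>j * F / 2\<close> coming from the first row is used instead.\<close>

definition level_rate :: "real \<Rightarrow> nat \<Rightarrow> real" where
  "level_rate b j = (if 2 * j \<le> card A then 1 - 2 * b * real j * (real (card A) - real j + 1)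
     else 1 - b * real j * real (card A))"

lemma finite_cylinders: "finite (\<Union>l<i. cylinder ` level l)"
  by (simp add: finite_level)

lemma lower_support: "v \<in> lower j \<Longrightarrow> s \<notin> injections \<Longrightarrow> coord v s = 0"
proof -
  have "lower j \<subseteq> span (delta ` injections)"
    unfolding lower_def
    by (rule span_minimal[OF _ subspace_span]) (auto simp: span_delta finite_injections coord_cylinder)
  then show "v \<in> lower j \<Longrightarrow> s \<notin> injections \<Longrightarrow> coord v s = 0"
    by (auto simp: span_delta finite_injections)
qed

text \<open>The factor \<alpha> will later carry the mixing of the large values; it is pulled out by
  \<open>\<alpha> - y \<le> \<alpha> (1 - y)\<close>. The condition
  \<open>2 b F^2 \<le> \<alpha>\<close> makes the diagonal coefficient and the quadratic form
  nonnegative, which settles the lower end of the spectrum.\<close>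

lemma walk_op_level_rate:
  assumes b: "b \<ge> 0" and \<alpha>: "\<alpha> \<le> 1" "2 * b * (real (card A))\<^sup>2 \<le> \<alpha>"
    and j: "j \<le> card A" and v: "v \<in> lower (Suc j)" "\<And>w. w \<in> lower j \<Longrightarrow> v \<bullet> w = 0"
  shows "norm (walk_op (\<alpha> - b * (real (card A))\<^sup>2) b v) \<le> \<alpha> * level_rate b j * norm v"
    and "0 \<le> \<alpha> * level_rate b j"
proof -
  define F where "F = real (card A)"
  define J where "J = real j"
  have J: "0 \<le> J" "J \<le> F" using j by (auto simp: J_def F_def)
  have \<alpha>F: "2 * (b * F\<^sup>2) \<le> \<alpha>" using \<alpha> by (simp add: F_def)
  have shrink: "\<alpha> - y \<le> \<alpha> * (1 - y)" if "y \<ge> 0" for y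
    using mult_right_mono[OF \<alpha>(1) that] by (simp add: right_diff_distrib)
  show "norm (walk_op (\<alpha> - b * (real (card A))\<^sup>2) b v) \<le> \<alpha> * level_rate b j * norm v"
    "0 \<le> \<alpha> * level_rate b j"
  proof (atomize (full), cases "2 * j \<le> card A")
    case True
    then have J2: "2 * J \<le> F" by (simp add: J_def F_def)
    have "2 * J \<le> F\<^sup>2"
    proof (cases "j = 0")
      case False
      then have "1 \<le> F" using J2 by (simp add: J_def)
      then have "F * 1 \<le> F * F" by (intro mult_left_mono) auto
      then show ?thesis using J2 by (simp add: power2_eq_square)
    qed (simp add: J_def)
    then have "b * (2 * J) \<le> b * F\<^sup>2" using b by (rule mult_left_mono)
    moreover have "b * (F - J)\<^sup>2 \<ge> 0" using b by simp
    ultimately have nn: "\<alpha> - b * F\<^sup>2 + b * ((F - J)\<^sup>2 - 2 * J) \<ge> 0"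
      using \<alpha>F by (simp add: algebra_simps)
    have eq: "\<alpha> - b * F\<^sup>2 + b * ((F - J)\<^sup>2 - 2 * J) + b * J\<^sup>2 = \<alpha> - 2 * b * J * (F - J + 1)"
      by (simp add: power2_eq_square algebra_simps)
    have "2 * b * J * (F - J + 1) \<ge> 0" using b J by simp
    then have le: "\<alpha> - 2 * b * J * (F - J + 1) \<le> \<alpha> * (1 - 2 * b * J * (F - J + 1))"
      using shrink[of "2 * b * J * (F - J + 1)"] by simp
    have rate: "level_rate b j = 1 - 2 * b * J * (F - J + 1)"
      using True by (simp add: level_rate_def J_def F_def)
    have r0: "0 \<le> \<alpha> - 2 * b * J * (F - J + 1)"
      using nn eq b by (smt (verit) mult_nonneg_nonneg zero_le_power2)
    have "norm (walk_op (\<alpha> - b * F\<^sup>2) b v) \<le> (\<alpha> - 2 * b * J * (F - J + 1)) * norm v"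
      using walk_op_level_contraction[OF j v, of "\<alpha> - b * F\<^sup>2" b] nn b eq
      by (simp add: F_def[symmetric] J_def[symmetric])
    also have "\<dots> \<le> \<alpha> * level_rate b j * norm v"
      using le by (intro mult_right_mono) (auto simp: rate)
    finally show "norm (walk_op (\<alpha> - b * (real (card A))\<^sup>2) b v) \<le> \<alpha> * level_rate b j * norm v
        \<and> 0 \<le> \<alpha> * level_rate b j"
      using r0 le by (simp add: F_def rate)
  next
    case False
    then have j0: "0 < j" by simp
    obtain B where B: "finite B" "span B = {v \<in> span ((\<Union>l<j. cylinder ` level l) \<union> cylinder ` level j).
        \<forall>w\<in>span (\<Union>l<j. cylinder ` level l). v \<bullet> w = 0}"
      using orthogonal_complement_spanned[OF finite_cylinders finite_imageI[OF finite_level]] by blast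
    have "span ((\<Union>l<j. cylinder ` level l) \<union> cylinder ` level j) = lower (Suc j)"
      by (simp add: lower_def lessThan_Suc Un_commute)
    then have spB: "span B = {v \<in> lower (Suc j). \<forall>w\<in>lower j. v \<bullet> w = 0}"
      using B(2) by (simp add: lower_def)
    have swapB: "swap_op p q u \<in> span B" if "p \<in> A" "q \<in> A" "u \<in> span B" for p q u
    proof -
      have "swap_op p q u \<bullet> w = 0" if w: "w \<in> lower j" for w
        using swap.tau_inner[of p q u w] swap_lower[OF \<open>p \<in> A\<close> \<open>q \<in> A\<close> w] \<open>u \<in> span B\<close>
        by (simp add: spB)
      then show ?thesis using that swap_lower[of p q u "Suc j"] by (simp add: spB)
    qed
    have form: "\<bar>u \<bullet> walk_op (\<alpha> - b * F\<^sup>2) b u\<bar> \<le> (\<alpha> - b * J * F) * (norm u)\<^sup>2" if u: "u \<in> span B" for u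
    proof -
      have "u \<bullet> swap.theta A u \<le> F * (F - J) * (norm u)\<^sup>2"
        unfolding F_def J_def
      proof (rule theta_form_bound[OF B(1) _ swapB _ j0 j u])
        show "coord w s = 0" if "w \<in> span B" "s \<notin> injections" for w s
          using lower_support[of w "Suc j" s] that by (simp add: spB)
        show "w \<bullet> y = 0" if "w \<in> span B" "y \<in> lower j" for w y
          using that by (simp add: spB)
      qed
      then have "b * (u \<bullet> swap.theta A u) \<le> b * (F * (F - J) * (norm u)\<^sup>2)"
        using b by (rule mult_left_mono)
      \<comment> \<open>From below the crude bound \<open>- F^2\<close> on the form is enough,
        because the identity part exceeds it by the assumption on \<alpha>.\<close>
      moreover have "b * (u \<bullet> swap.theta A u) \<ge> b * (- (F\<^sup>2 * (norm u)\<^sup>2))"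
        using swap.theta_form_le[of u A] b by (intro mult_left_mono) (auto simp: F_def)
      moreover have "u \<bullet> walk_op (\<alpha> - b * F\<^sup>2) b u = (\<alpha> - b * F\<^sup>2) * (norm u)\<^sup>2 + b * (u \<bullet> swap.theta A u)"
        by (simp add: walk_op_def inner_add_right power2_norm_eq_inner)
      moreover have "2 * (b * F\<^sup>2) * (norm u)\<^sup>2 \<le> \<alpha> * (norm u)\<^sup>2"
        using \<alpha>F by (intro mult_right_mono) auto
      moreover have "b * J * F * (norm u)\<^sup>2 \<le> b * F * F * (norm u)\<^sup>2"
        using b J by (intro mult_right_mono mult_left_mono) auto
      ultimately show ?thesis
        by (intro abs_leI) (simp_all add: algebra_simps power2_eq_square)
    qed
    have inv: "walk_op (\<alpha> - b * F\<^sup>2) b u \<in> span B" if "u \<in> span B" for u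
      unfolding walk_op_def swap.theta_def using that swapB
      by (intro span_add span_scale span_sum) auto
    have "norm (walk_op (\<alpha> - b * F\<^sup>2) b v) \<le> (\<alpha> - b * J * F) * norm v"
      by (rule norm_le_of_quadratic_form[OF walk_op_symmetric subspace_span inv form])
        (use v in \<open>auto simp: spB\<close>)
    also have "\<dots> \<le> \<alpha> * level_rate b j * norm v"
    proof (intro mult_right_mono)
      have "b * J * F \<ge> 0" using b J by simp
      then show "\<alpha> - b * J * F \<le> \<alpha> * level_rate b j"
        using False shrink[of "b * J * F"] by (simp add: level_rate_def J_def F_def)
    qed simp
    finally have 1: "norm (walk_op (\<alpha> - b * (real (card A))\<^sup>2) b v) \<le> \<alpha> * level_rate b j * norm v"
      by (simp add: F_def)
    have "b * J * F \<le> b * F * F" using b J by (intro mult_right_mono mult_left_mono) auto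
    moreover have "b * F * F \<le> 1 / 2" using \<alpha>F \<alpha> by (simp add: power2_eq_square mult.assoc)
    moreover have "0 \<le> b * F\<^sup>2" using b by simp
    ultimately have "0 \<le> \<alpha> * level_rate b j"
      using False \<alpha>F by (intro mult_nonneg_nonneg) (simp_all add: level_rate_def J_def F_def)
    with 1 show "norm (walk_op (\<alpha> - b * (real (card A))\<^sup>2) b v) \<le> \<alpha> * level_rate b j * norm v
        \<and> 0 \<le> \<alpha> * level_rate b j" by simp
  qed
qed

theorem return_bound:
  assumes s: "s \<in> injections" and b: "b \<ge> 0" and \<alpha>: "\<alpha> \<le> 1" "2 * b * (real (card A))\<^sup>2 \<le> \<alpha>"
  shows "real (card injections) * coord ((walk_op (\<alpha> - b * (real (card A))\<^sup>2) b ^^ (2 * h)) (delta s)) s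
    \<le> \<alpha> ^ (2 * h) * (\<Sum>j\<le>card K. real ((card K * card A) choose j) * level_rate b j ^ (2 * h))"
proof -
  have KA: "card K \<le> card A"
    using s card_inj_on_le[of s K A] finite_A by (auto simp: injections_def)
  let ?W = "walk_op (\<alpha> - b * (real (card A))\<^sup>2) b"
  have "real (card injections) * coord ((?W ^^ (2 * h)) (delta s)) s
      = (\<Sum>d\<in>delta ` injections. (norm ((?W ^^ h) d))\<^sup>2)"
    by (rule card_times_diagonal[OF s])
  also have "\<dots> \<le> (\<Sum>i<Suc (card K). real (card (cylinder ` level i)) * (\<alpha> * level_rate b i) ^ (2 * h))"
  proof (rule trace_filtration_bound[OF walk_op_symmetric])
    show "finite (cylinder ` level i)" for i using finite_level by auto
    show "?W v \<in> span (\<Union>l<i. cylinder ` level l)" if "v \<in> span (\<Union>l<i. cylinder ` level l)" for i v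
      using walk_op_lower that by (simp add: lower_def)
    show "norm (?W v) \<le> \<alpha> * level_rate b i * norm v"
      if "i < Suc (card K)" "v \<in> span (\<Union>l<Suc i. cylinder ` level l)"
        "\<And>w. w \<in> span (\<Union>l<i. cylinder ` level l) \<Longrightarrow> v \<bullet> w = 0" for i v
      using walk_op_level_rate(1)[OF b \<alpha>, of i v] that KA by (simp add: lower_def)
    show "0 \<le> \<alpha> * level_rate b i" if "i < Suc (card K)" for i
      using walk_op_level_rate(2)[OF b \<alpha>, of i 0] that KA subspace_0[OF subspace_lower] by auto
    show "orthonormal (delta ` injections)" by (rule orthonormal_delta)
    show "finite (delta ` injections)" using finite_injections by simp
    show "span (delta ` injections) = span (\<Union>l<Suc (card K). cylinder ` level l)"
      using lower_top s by (auto simp: lower_def)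
  qed
  also have "\<dots> \<le> (\<Sum>i<Suc (card K). real ((card K * card A) choose i) * (\<alpha> * level_rate b i) ^ (2 * h))"
  proof (intro sum_mono mult_right_mono)
    show "real (card (cylinder ` level i)) \<le> real ((card K * card A) choose i)" for i
      using card_image_le[OF finite_level, of cylinder i] by (simp add: card_level)
    show "0 \<le> (\<alpha> * level_rate b i) ^ (2 * h)" for i by (simp add: power_mult)
  qed
  also have "\<dots> = \<alpha> ^ (2 * h) * (\<Sum>j\<le>card K. real ((card K * card A) choose j) * level_rate b j ^ (2 * h))"
    by (simp add: lessThan_Suc_atMost sum_distrib_left power_mult_distrib algebra_simps)
  finally show ?thesis .
qed

end

section \<open>The full symmetric group and the sign twist\<close>

lift_definition sgn_op :: "('a \<Rightarrow> 'a) fsv \<Rightarrow> ('a \<Rightarrow> 'a) fsv" is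
  "\<lambda>f s. of_int (sign s) * f s"
  by (rule finite_subset[rotated]) auto

lemma coord_sgn_op: "coord (sgn_op v) s = of_int (sign s) * coord v s"
  by transfer simp

lemma sgn_op_linear: "linear sgn_op"
  by (intro linearI fsv_eqI) (simp_all add: coord_sgn_op algebra_simps)

lemma sign_times_self: "sign s * sign s = 1"
  by (simp add: sign_def)

lemma sgn_op_involution: "sgn_op (sgn_op v) = v"
  by (intro fsv_eqI)
    (simp add: coord_sgn_op mult.assoc[symmetric] of_int_mult[symmetric] sign_times_self del: of_int_mult)

lemma sgn_op_inner: "sgn_op v \<bullet> w = v \<bullet> sgn_op w"
proof -
  have "{s. coord (sgn_op v) s \<noteq> 0} \<subseteq> {s. coord v s \<noteq> 0}" by (auto simp: coord_sgn_op)
  from inner_fsv_superset[OF finite_support this]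
  show ?thesis by (simp add: inner_fsv_def coord_sgn_op algebra_simps)
qed

lemma norm_sgn_op: "norm (sgn_op v) = norm v"
  by (simp add: norm_eq_sqrt_inner sgn_op_inner sgn_op_involution)

lemma coeff_ball_linear_image:
  assumes "linear T" "v \<in> coeff_ball W b I \<rho>"
  shows "T v \<in> coeff_ball (T ` W) (\<lambda>i. T (b i)) I \<rho>"
proof -
  interpret T: linear T by fact
  obtain c w where *: "w \<in> W" "v = (\<Sum>i\<in>I. c i *\<^sub>R b i) + w" "(\<Sum>i\<in>I. \<bar>c i\<bar>) \<le> \<rho>"
    using assms(2) unfolding coeff_ball_def by auto
  then have "T v = (\<Sum>i\<in>I. c i *\<^sub>R T (b i)) + T w" by (simp add: T.add T.sum T.scale)
  then show ?thesis using * unfolding coeff_ball_def by blast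
qed

lemma coeff_ball_mono_space:
  "v \<in> coeff_ball W b I \<rho> \<Longrightarrow> W \<subseteq> W' \<Longrightarrow> v \<in> coeff_ball W' b I \<rho>"
  unfolding coeff_ball_def by blast

locale permutation_space =
  fixes A :: "'p set"
  assumes fin: "finite A"
begin

sublocale injection_space "\<lambda>k. k" A A
  by unfold_locales (simp_all add: fin)

lemma injections_eq: "injections = {s. s permutes A}"
proof (intro subset_antisym subsetI CollectI)
  fix s assume s: "s \<in> injections"
  then have "bij_betw s A A"
    using endo_inj_surj[OF fin, of s] by (auto simp: injections_def bij_betw_def)
  then show "s permutes A" using s by (intro bij_imp_permutes) (auto simp: injections_def)
next
  fix s assume "s \<in> {s. s permutes A}"
  then show "s \<in> injections"
    by (auto simp: injections_def permutes_inj_on permutes_in_image permutes_not_in)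
qed

lemma card_injections: "card injections = fact (card A)"
  by (simp add: injections_eq card_permutations[OF _ fin])

text \<open>The sign is multiplicative on permutations, hence the hypothesis on the support of
  \<open>v\<close>.\<close>

lemma sgn_op_swap:
  assumes "\<And>s. s \<notin> injections \<Longrightarrow> coord v s = 0" "p \<in> A" "q \<in> A" "p \<noteq> q"
  shows "swap_op p q (sgn_op v) = - sgn_op (swap_op p q v)"
proof (rule fsv_eqI)
  fix s
  show "coord (swap_op p q (sgn_op v)) s = coord (- sgn_op (swap_op p q v)) s"
  proof (cases "s \<in> injections")
    case True
    then have "permutation s"
      using fin permutation_permutes by (auto simp: injections_eq)
    then have "sign (Transposition.transpose p q \<circ> s) = - sign s"
      using assms(4) by (simp add: sign_compose permutation_swap_id sign_swap_id)
    then show ?thesis by (simp add: coord_swap_op coord_sgn_op)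
  next
    case False
    then have "Transposition.transpose p q \<circ> s \<notin> injections" using assms swap_injections by blast
    then show ?thesis using assms(1) by (simp add: coord_swap_op coord_sgn_op)
  qed
qed

text \<open>Multiplication by the sign reflects the spectrum of \<open>theta\<close> about
  \<open>card A\<close>. Upper bounds on \<open>theta\<close> for twisted vectors thus become lower
  bounds for the original ones.\<close>

lemma theta_sgn_op:
  assumes v: "\<And>s. s \<notin> injections \<Longrightarrow> coord v s = 0"
  shows "swap.theta A (sgn_op v) = sgn_op ((2 * real (card A)) *\<^sub>R v - swap.theta A v)"
proof -
  interpret S: linear "sgn_op :: ('p \<Rightarrow> 'p) fsv \<Rightarrow> _" by (rule sgn_op_linear)
  have "signed_swap_op p q (sgn_op v) = sgn_op (swap_op p q v)" if "p \<in> A" "q \<in> A" for p q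
    using sgn_op_swap[OF v that] swap.tau_same[of q v] by (simp add: signed_swap_op_def del: Transposition.transpose_same)
  then have "signed_swap.theta A (sgn_op v) = sgn_op (swap.theta A v)"
    by (simp add: signed_swap.theta_def swap.theta_def S.sum)
  then show ?thesis using signed_theta[OF fin, of "sgn_op v"] by (simp add: S.diff S.scale algebra_simps)
qed

lemma walk_op_sgn_op:
  assumes v: "\<And>s. s \<notin> injections \<Longrightarrow> coord v s = 0"
  shows "walk_op a b (sgn_op v) = sgn_op (walk_op (a + 2 * b * real (card A)) (- b) v)"
proof -
  interpret S: linear "sgn_op :: ('p \<Rightarrow> 'p) fsv \<Rightarrow> _" by (rule sgn_op_linear)
  show ?thesis
    by (simp add: walk_op_def theta_sgn_op[OF v] S.add S.diff S.scale algebra_simps)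
qed

section \<open>Random transpositions: plain and sign-twisted levels\<close>

definition rand_op :: "('p \<Rightarrow> 'p) fsv \<Rightarrow> ('p \<Rightarrow> 'p) fsv" where
  "rand_op = walk_op 0 (1 / (real (card A))\<^sup>2)"

text \<open>The walk is not lazy here: the products with the sign take care of the eigenvalues near \<open>-1\<close>.\<close>

definition family :: "nat \<Rightarrow> nat \<Rightarrow> ('p \<Rightarrow> 'p) fsv set" where
  "family J i = (if i \<le> J then cylinder ` level i
     else if i \<le> 2 * J + 1 then (\<lambda>\<kappa>. sgn_op (cylinder \<kappa>)) ` level (i - Suc J)
     else delta ` injections)"

lemma family_low: "i \<le> Suc J \<Longrightarrow> (\<Union>l<i. family J l) = (\<Union>l<i. cylinder ` level l)"
  by (intro SUP_cong) (auto simp: family_def)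

lemma family_mid:
  assumes "j \<le> Suc J"
  shows "(\<Union>l<Suc J + j. family J l) = (\<Union>l<Suc J. cylinder ` level l) \<union> sgn_op ` (\<Union>l<j. cylinder ` level l)"
    (is "?L = ?R")
proof -
  have "{..<Suc J + j} = {..<Suc J} \<union> (\<lambda>l. Suc J + l) ` {..<j}"
  proof (intro subset_antisym subsetI)
    fix x assume "x \<in> {..<Suc J + j}"
    then show "x \<in> {..<Suc J} \<union> (\<lambda>l. Suc J + l) ` {..<j}"
      by (cases "x < Suc J") (auto intro!: image_eqI[of _ _ "x - Suc J"])
  qed auto
  then have "?L = (\<Union>l<Suc J. family J l) \<union> (\<Union>l<j. family J (Suc J + l))" by auto
  moreover have "family J (Suc J + l) = sgn_op ` cylinder ` level l" if "l < j" for l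
    using that assms by (auto simp: family_def image_image)
  ultimately show ?thesis by (simp add: family_low image_UN)
qed

lemma family_top: "injections \<noteq> {} \<Longrightarrow> span (\<Union>l<2 * J + 3. family J l) = span (delta ` injections)"
proof (intro subset_antisym span_minimal subspace_span)
  have "family J (2 * J + 2) = delta ` injections" by (simp add: family_def)
  then show "delta ` injections \<subseteq> span (\<Union>l<2 * J + 3. family J l)"
    by (intro subsetI span_base UN_I[of "2 * J + 2"]) auto
  show "(\<Union>l<2 * J + 3. family J l) \<subseteq> span (delta ` injections)"
    by (auto simp: family_def span_delta finite_injections coord_cylinder coord_sgn_op coord_delta split: if_splits)
qed

lemma lower_support_sgn: "v \<in> lower j \<Longrightarrow> walk_op a b (sgn_op v) \<in> sgn_op ` lower j"
  using walk_op_sgn_op[of v a b] lower_support[of v j] walk_op_lower[of v j] by auto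

lemma walk_op_support:
  assumes "\<And>s. s \<notin> injections \<Longrightarrow> coord v s = 0" "s \<notin> injections"
  shows "coord (walk_op a b v) s = 0"
  using assms by (simp add: walk_op_def swap.theta_def swap_support[OF assms(1)])

lemma walk_op_family:
  assumes v: "v \<in> span (\<Union>l<i. family J l)" and i: "i \<le> 2 * J + 3" and ne: "injections \<noteq> {}"
  shows "walk_op a b v \<in> span (\<Union>l<i. family J l)"
proof -
  consider "i \<le> Suc J" | j where "i = Suc J + j" "j \<le> Suc J" | "i = 2 * J + 3"
    using i that(2)[of "i - Suc J"] by linarith
  then show ?thesis
  proof cases
    case 1
    then show ?thesis using v walk_op_lower by (simp add: family_low lower_def)
  next
    case 2
    have sp: "span (\<Union>l<i. family J l) = {x + y |x y. x \<in> lower (Suc J) \<and> y \<in> sgn_op ` lower j}"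
      unfolding 2(1) family_mid[OF 2(2)] span_Un lower_def
      by (simp add: linear_span_image[OF sgn_op_linear])
    then obtain x y where xy: "v = x + y" "x \<in> lower (Suc J)" "y \<in> sgn_op ` lower j"
      using v by auto
    interpret W: linear "walk_op a b" using symmetric_opD(1)[OF walk_op_symmetric] .
    have "walk_op a b v = walk_op a b x + walk_op a b y" by (simp add: xy(1) W.add)
    moreover have "walk_op a b x \<in> lower (Suc J)" by (rule walk_op_lower[OF xy(2)])
    moreover have "walk_op a b y \<in> sgn_op ` lower j" using xy(3) lower_support_sgn by auto
    ultimately show ?thesis unfolding sp by blast
  next
    case 3
    have "coord v s = 0" if "s \<notin> injections" for s
      using v that unfolding 3 family_top[OF ne] by (simp add: span_delta finite_injections)
    then show ?thesis
      unfolding 3 family_top[OF ne] by (auto simp: span_delta finite_injections walk_op_support)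
  qed
qed

text \<open>Index \<open>Suc J\<close> is the sign character, with eigenvalue
  \<open>- (1 - 2 / m)\<close>; the weaker rate \<open>1 - 1 / m\<close> is that of level 1, with
  which it will be merged. The last branch is the rate orthogonal to all plain and twisted levels up
  to \<open>J\<close>.\<close>

definition family_rate :: "nat \<Rightarrow> nat \<Rightarrow> real" where
  "family_rate J i = (if i = 0 then 1 else if i \<le> J then 1 - real i / real (card A)
     else if i = Suc J then 1 - 1 / real (card A)
     else if i \<le> 2 * J + 1 then 1 - real (i - Suc J) / real (card A)
     else 1 - real J / real (card A))"

lemma rand_op_low:
  assumes M: "12 \<le> card A" and j: "2 * j \<le> card A"
    and v: "v \<in> lower (Suc j)" "\<And>w. w \<in> lower j \<Longrightarrow> v \<bullet> w = 0"
  shows "norm (rand_op v) \<le> (1 - real j / real (card A)) * norm v"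
proof -
  define m where "m = real (card A)"
  define x where "x = real j"
  have mx: "12 \<le> m" "0 \<le> x" "2 * x \<le> m" using M j by (auto simp: m_def x_def)
  have "m / 2 * (m / 2) \<le> (m - x) * (m - x)" using mx by (intro mult_mono) auto
  then have sq: "m * m / 4 \<le> (m - x) * (m - x)" by simp
  have "12 * m \<le> m * m" using mx by (intro mult_right_mono) auto
  then have nn: "(m - x)\<^sup>2 - 2 * x \<ge> 0" using sq mx unfolding power2_eq_square by linarith
  have mp: "m\<^sup>2 > 0" using mx by simp
  have "norm (rand_op v) \<le> (\<bar>0 + 1 / m\<^sup>2 * ((m - x)\<^sup>2 - 2 * x)\<bar> + \<bar>1 / m\<^sup>2\<bar> * x\<^sup>2) * norm v"
    unfolding rand_op_def m_def x_def using j v by (intro walk_op_level_contraction) auto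
  also have "\<bar>0 + 1 / m\<^sup>2 * ((m - x)\<^sup>2 - 2 * x)\<bar> + \<bar>1 / m\<^sup>2\<bar> * x\<^sup>2 = ((m - x)\<^sup>2 - 2 * x + x\<^sup>2) / m\<^sup>2"
    using nn by (simp add: abs_div add_divide_distrib)
  also have "\<dots> \<le> 1 - x / m"
  proof -
    have "x * (2 * x) \<le> x * m" using mx by (intro mult_left_mono) auto
    moreover have "(1 - x / m) * m\<^sup>2 = m * m - x * m"
      using mx by (simp add: power2_eq_square left_diff_distrib)
    ultimately have "(m - x)\<^sup>2 - 2 * x + x\<^sup>2 \<le> (1 - x / m) * m\<^sup>2"
      using mx by (simp add: power2_eq_square algebra_simps)
    then show ?thesis using mp by (simp add: divide_le_eq)
  qed
  finally show ?thesis by (simp add: mult_right_mono m_def x_def)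
qed

text \<open>Twisted cylinders obey the row estimate with \<open>theta\<close> replaced by
  \<open>2 m - theta\<close>, modulo a space that also contains all plain levels up to
  \<open>J\<close>. The drop obtained is \<open>(j + 1) / m\<close>, so \<open>max 1 j\<close> is
  available even at \<open>j = 0\<close>.\<close>

lemma rand_op_sgn_low:
  assumes M: "12 \<le> card A" and j: "2 * j \<le> card A" and J: "j \<le> J"
    and v: "v \<in> span (\<Union>l<Suc (Suc J + j). family J l)"
    and orth: "\<And>w. w \<in> span (\<Union>l<Suc J + j. family J l) \<Longrightarrow> v \<bullet> w = 0"
    and ne: "injections \<noteq> {}"
  shows "norm (rand_op v) \<le> (1 - real (max 1 j) / real (card A)) * norm v"
proof -
  define m where "m = real (card A)"
  define x where "x = real j"
  have mx: "12 \<le> m" "0 \<le> x" "2 * x \<le> m" using M j by (auto simp: m_def x_def)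
  have "m / 2 * (m / 2) \<le> (m - x) * (m - x)" using mx by (intro mult_mono) auto
  then have sq: "m * m / 4 \<le> (m - x) * (m - x)" by simp
  have "12 * m \<le> m * m" using mx by (intro mult_right_mono) auto
  then have nn: "(m - x)\<^sup>2 - 2 * x - 2 * m \<ge> 0" using sq mx unfolding power2_eq_square by linarith
  have mp: "m\<^sup>2 > 0" using mx by simp
  let ?W = "span (\<Union>l<Suc J + j. family J l)"
  let ?r = "\<bar>2 / m - (1 / m\<^sup>2) * ((m - x)\<^sup>2 - 2 * x)\<bar> + 1 / m\<^sup>2 * x\<^sup>2"
  have subW: "sgn_op ` lower j \<subseteq> ?W"
  proof -
    have "sgn_op ` lower j = span (sgn_op ` (\<Union>l<j. cylinder ` level l))"
      by (simp add: lower_def linear_span_image[OF sgn_op_linear])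
    also have "\<dots> \<subseteq> ?W"
      unfolding family_mid[OF le_SucI[OF J]] by (rule span_mono[OF Un_upper2])
    finally show ?thesis .
  qed
  have "norm (rand_op v) \<le> ?r * norm v"
    unfolding rand_op_def
  proof (rule level_contraction[OF walk_op_symmetric finite_level subspace_span])
    show "walk_op 0 (1 / (real (card A))\<^sup>2) w \<in> ?W" if "w \<in> ?W" for w
      using walk_op_family[OF that _ ne] J by simp
    show "walk_op 0 (1 / (real (card A))\<^sup>2) (sgn_op (cylinder \<kappa>))
        \<in> coeff_ball ?W (\<lambda>\<kappa>. sgn_op (cylinder \<kappa>)) (level j) ?r" if \<kappa>: "\<kappa> \<in> level j" for \<kappa>
    proof -
      have "walk_op 0 (1 / (real (card A))\<^sup>2) (sgn_op (cylinder \<kappa>))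
          = sgn_op (walk_op (2 / m) (- (1 / m\<^sup>2)) (cylinder \<kappa>))"
        using mx by (subst walk_op_sgn_op) (auto simp: coord_cylinder m_def power2_eq_square)
      moreover have "walk_op (2 / m) (- (1 / m\<^sup>2)) (cylinder \<kappa>) \<in> coeff_ball (lower j) cylinder (level j) ?r"
        using walk_op_cylinder[OF \<kappa>, of "2 / m" "- (1 / m\<^sup>2)"] j by (simp add: m_def x_def)
      ultimately show ?thesis
        using coeff_ball_mono_space[OF coeff_ball_linear_image[OF sgn_op_linear] subW] by simp
    qed
    show "v \<in> span (?W \<union> (\<lambda>\<kappa>. sgn_op (cylinder \<kappa>)) ` level j)"
    proof -
      have "family J (Suc J + j) = (\<lambda>\<kappa>. sgn_op (cylinder \<kappa>)) ` level j" using J by (auto simp: family_def)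
      then have "(\<Union>l<Suc (Suc J + j). family J l)
          = (\<Union>l<Suc J + j. family J l) \<union> (\<lambda>\<kappa>. sgn_op (cylinder \<kappa>)) ` level j"
        by (simp only: lessThan_Suc UN_insert Un_commute)
      then show ?thesis using v by (simp add: span_Un span_span)
    qed
  qed (use orth mx in auto)
  also have "?r = ((m - x)\<^sup>2 - 2 * x - 2 * m + x\<^sup>2) / m\<^sup>2"
  proof -
    have "2 / m - (1 / m\<^sup>2) * ((m - x)\<^sup>2 - 2 * x) = - (((m - x)\<^sup>2 - 2 * x - 2 * m) / m\<^sup>2)"
      using mx by (simp add: field_simps power2_eq_square)
    then have "\<bar>2 / m - (1 / m\<^sup>2) * ((m - x)\<^sup>2 - 2 * x)\<bar> = ((m - x)\<^sup>2 - 2 * x - 2 * m) / m\<^sup>2"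
      using nn mp by simp
    then show ?thesis by (simp add: add_divide_distrib)
  qed
  also have "\<dots> \<le> 1 - real (max 1 j) / m"
  proof -
    have "x * (2 * x) \<le> x * m" using mx by (intro mult_left_mono) auto
    then have "(m - x)\<^sup>2 - 2 * x - 2 * m + x\<^sup>2 \<le> m * m - (x + 1) * m"
      using mx by (simp add: power2_eq_square algebra_simps)
    also have "m * m - (x + 1) * m = (1 - (x + 1) / m) * m\<^sup>2"
      using mx by (simp add: power2_eq_square left_diff_distrib)
    finally have "(m - x)\<^sup>2 - 2 * x - 2 * m + x\<^sup>2 \<le> (1 - (x + 1) / m) * m\<^sup>2" .
    then have "((m - x)\<^sup>2 - 2 * x - 2 * m + x\<^sup>2) / m\<^sup>2 \<le> 1 - (x + 1) / m"
      using mp by (simp add: divide_le_eq)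
    moreover have "real (max 1 j) / m \<le> (x + 1) / m"
      using mx by (intro divide_right_mono) (auto simp: x_def)
    ultimately show ?thesis by linarith
  qed
  finally show ?thesis by (simp add: mult_right_mono m_def)
qed

text \<open>Orthogonality to the plain levels bounds \<open>theta\<close> from above. Orthogonality
  to the twisted levels bounds \<open>2 m - theta\<close> from above, hence \<open>theta\<close>
  from below. Both bounds are \<open>m (m - J - 1)\<close>.\<close>

lemma rand_op_rest:
  assumes M: "12 \<le> card A" and J: "J < card A"
    and v: "v \<in> span (delta ` injections)"
    and orth: "\<And>w. w \<in> span (\<Union>l<2 * J + 2. family J l) \<Longrightarrow> v \<bullet> w = 0"
    and ne: "injections \<noteq> {}"
  shows "norm (rand_op v) \<le> (1 - real J / real (card A)) * norm v"
proof -
  define m where "m = real (card A)"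
  define r where "r = m * (m - real (Suc J))"
  have m: "12 \<le> m" using M by (simp add: m_def)
  have Jm: "real (Suc J) \<le> m" using J by (simp add: m_def)
  have W: "span (\<Union>l<2 * J + 2. family J l)
      = {x + y |x y. x \<in> lower (Suc J) \<and> y \<in> sgn_op ` lower (Suc J)}"
  proof -
    have "2 * J + 2 = Suc J + Suc J" by simp
    then show ?thesis
      using family_mid[of "Suc J" J]
      by (simp only: span_Un lower_def linear_span_image[OF sgn_op_linear] le_refl)
  qed
  let ?G = "\<Union>l<2 * J + 2. family J l"
  have finG: "finite ?G" by (auto simp: family_def finite_level finite_injections)
  obtain B where B: "finite B" "span B = {v \<in> span (?G \<union> delta ` injections). \<forall>w\<in>span ?G. v \<bullet> w = 0}"
    using orthogonal_complement_spanned[OF finG, of "delta ` injections"] finite_injections by blast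
  have "span (?G \<union> delta ` injections) = span (delta ` injections)"
  proof (intro subset_antisym span_minimal subspace_span)
    have "?G \<subseteq> span (\<Union>l<2 * J + 3. family J l)" by (intro subsetI span_base) (force intro: less_le_trans)
    then show "?G \<union> delta ` injections \<subseteq> span (delta ` injections)"
      unfolding family_top[OF ne] by (auto intro: span_base)
    show "delta ` injections \<subseteq> span (?G \<union> delta ` injections)" by (auto intro: span_base)
  qed
  then have spB: "span B = {v \<in> span (delta ` injections). \<forall>w\<in>span ?G. v \<bullet> w = 0}" using B by simp
  have supp: "coord u s = 0" if "u \<in> span B" "s \<notin> injections" for u s
    using that by (auto simp: spB span_delta finite_injections)
  have orth1: "u \<bullet> w = 0" if "u \<in> span B" "w \<in> lower (Suc J)" for u w
  proof -
    have "w + 0 \<in> span ?G"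
      unfolding W using that(2) linear_0[OF sgn_op_linear] subspace_0[OF subspace_lower, of "Suc J"]
      by (intro CollectI exI[of _ w] exI[of _ 0]) (auto intro!: image_eqI[of _ _ 0])
    then show ?thesis using that(1) by (simp add: spB)
  qed
  have orth2: "u \<bullet> sgn_op w = 0" if "u \<in> span B" "w \<in> lower (Suc J)" for u w
  proof -
    have "0 + sgn_op w \<in> span ?G"
      unfolding W using that(2) subspace_0[OF subspace_lower] by blast
    then show ?thesis using that(1) by (simp add: spB)
  qed
  have swapB: "swap_op p q u \<in> span B" if "p \<in> A" "q \<in> A" "u \<in> span B" for p q u
  proof -
    have "swap_op p q u \<bullet> w = 0" if wG: "w \<in> span ?G" for w
    proof -
      obtain x y where xy: "w = x + sgn_op y" "x \<in> lower (Suc J)" "y \<in> lower (Suc J)"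
        using wG unfolding W by auto
      have ly: "swap_op p q (sgn_op y) = (if p = q then sgn_op y else - sgn_op (swap_op p q y))"
      proof (cases "p = q")
        case True
        then show ?thesis using swap.tau_same[of q "sgn_op y"] by (simp del: Transposition.transpose_same)
      next
        case False
        then show ?thesis
          using sgn_op_swap[of y p q] lower_support[OF xy(3)] \<open>p \<in> A\<close> \<open>q \<in> A\<close> by simp
      qed
      have "swap_op p q u \<bullet> w = u \<bullet> swap_op p q x + u \<bullet> swap_op p q (sgn_op y)"
        by (simp add: xy(1) swap.tau_inner linear_add[OF swap.tau_linear] inner_add_right)
      moreover have "u \<bullet> swap_op p q x = 0" "u \<bullet> sgn_op y = 0" "u \<bullet> sgn_op (swap_op p q y) = 0"
        using orth1 orth2 xy swap_lower \<open>p \<in> A\<close> \<open>q \<in> A\<close> \<open>u \<in> span B\<close> by auto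
      ultimately show ?thesis by (simp add: ly)
    qed
    moreover have "swap_op p q u \<in> span (delta ` injections)"
      using supp[OF \<open>u \<in> span B\<close>] swap_support[of u p q] that by (simp add: span_delta finite_injections)
    ultimately show ?thesis by (simp add: spB)
  qed
  have up: "u \<bullet> swap.theta A u \<le> r * (norm u)\<^sup>2" if u: "u \<in> span B" for u
    unfolding r_def m_def
    by (rule theta_form_bound[OF B(1) supp swapB orth1 _ _ u]) (use J in auto)
  have dn: "- (u \<bullet> swap.theta A u) \<le> r * (norm u)\<^sup>2" if u: "u \<in> span B" for u
  proof -
    have sB: "span (sgn_op ` B) = sgn_op ` span B" by (rule linear_span_image[OF sgn_op_linear])
    have "sgn_op u \<bullet> swap.theta A (sgn_op u) \<le> m * (m - real (Suc J)) * (norm (sgn_op u))\<^sup>2"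
      unfolding m_def
    proof (rule theta_form_bound)
      show "finite (sgn_op ` B)" using B by simp
      show "coord w s = 0" if "w \<in> span (sgn_op ` B)" "s \<notin> injections" for w s
        using that supp unfolding sB by (auto simp: coord_sgn_op)
      show "swap_op p q w \<in> span (sgn_op ` B)" if pqw: "p \<in> A" "q \<in> A" "w \<in> span (sgn_op ` B)" for p q w
      proof (cases "p = q")
        case True
        then show ?thesis using pqw swap.tau_same[of q w] by (simp del: Transposition.transpose_same)
      next
        case False
        obtain y where y: "y \<in> span B" "w = sgn_op y" using pqw(3) unfolding sB by auto
        have "swap_op p q w = sgn_op (- swap_op p q y)"
          using sgn_op_swap[of y p q] supp[OF y(1)] False pqw y(2) by (simp add: linear_neg[OF sgn_op_linear])
        then show ?thesis using swapB[OF pqw(1,2) y(1)] unfolding sB by (auto intro: span_neg)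
      qed
      show "w \<bullet> y = 0" if "w \<in> span (sgn_op ` B)" "y \<in> lower (Suc J)" for w y
        using that orth2 unfolding sB by (auto simp: sgn_op_inner)
      show "sgn_op u \<in> span (sgn_op ` B)" using u unfolding sB by auto
    qed (use J in auto)
    moreover have "sgn_op u \<bullet> swap.theta A (sgn_op u) = 2 * m * (norm u)\<^sup>2 - u \<bullet> swap.theta A u"
      by (subst theta_sgn_op) (use supp[OF u] in \<open>auto simp: sgn_op_inner sgn_op_involution inner_diff_right power2_norm_eq_inner m_def\<close>)
    moreover have "0 \<le> 2 * m * (norm u)\<^sup>2" using m by simp
    ultimately show ?thesis unfolding r_def norm_sgn_op by linarith
  qed
  have "norm (rand_op v) \<le> (1 / m\<^sup>2 * r) * norm v"
    unfolding rand_op_def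
  proof (rule norm_le_of_quadratic_form[OF walk_op_symmetric subspace_span])
    show "walk_op 0 (1 / (real (card A))\<^sup>2) u \<in> span B" if "u \<in> span B" for u
      unfolding walk_op_def swap.theta_def using that swapB by (intro span_add span_scale span_sum) auto
    show "\<bar>u \<bullet> walk_op 0 (1 / (real (card A))\<^sup>2) u\<bar> \<le> 1 / m\<^sup>2 * r * (norm u)\<^sup>2" if "u \<in> span B" for u
    proof -
      have "\<bar>u \<bullet> swap.theta A u\<bar> \<le> r * (norm u)\<^sup>2" using up[OF that] dn[OF that] by (intro abs_leI)
      then have "\<bar>u \<bullet> swap.theta A u\<bar> / m\<^sup>2 \<le> r * (norm u)\<^sup>2 / m\<^sup>2" by (intro divide_right_mono) auto
      then show ?thesis by (simp add: walk_op_def m_def abs_mult)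
    qed
    show "v \<in> span B" using v orth by (simp add: spB)
  qed
  also have "1 / m\<^sup>2 * r = 1 - real (Suc J) / m"
    using m by (simp add: r_def power2_eq_square field_simps)
  also have "\<dots> * norm v \<le> (1 - real J / m) * norm v"
    using m by (intro mult_right_mono) (auto intro!: divide_right_mono)
  finally show ?thesis by (simp add: m_def)
qed

end

lemma sum_lessThan_add:
  fixes f :: "nat \<Rightarrow> real"
  shows "(\<Sum>i<a + b. f i) = (\<Sum>i<a. f i) + (\<Sum>i<b. f (a + i))"
  by (induction b) auto

context permutation_space
begin

text \<open>Three copies of the level sum: plain levels, twisted levels, and one to absorb the sign
  character. The last term charges the full dimension \<open>m!\<close> for everything else.\<close>

definition mixing_sum :: "nat \<Rightarrow> real" where
  "mixing_sum k = 3 * (\<Sum>j=1..card A div 2. real ((card A * card A) choose j) * (1 - real j / real (card A)) ^ k)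
     + fact (card A) * (1 - real (card A div 2) / real (card A)) ^ k"

lemma family_contraction:
  assumes M: "12 \<le> card A" and J: "J = card A div 2" and ne: "injections \<noteq> {}" and i: "i < 2 * J + 3"
    and v: "v \<in> span (\<Union>l<Suc i. family J l)"
    and orth: "\<And>w. w \<in> span (\<Union>l<i. family J l) \<Longrightarrow> v \<bullet> w = 0"
  shows "norm (rand_op v) \<le> family_rate J i * norm v"
proof -
  consider "i \<le> J" | j where "i = Suc J + j" "j \<le> J" | "i = 2 * J + 2"
    using i that(2)[of "i - Suc J"] by linarith
  then show ?thesis
  proof cases
    case 1
    have "norm (rand_op v) \<le> (1 - real i / real (card A)) * norm v"
    proof (rule rand_op_low[OF M])
      show "v \<in> lower (Suc i)" using v 1 family_low[of "Suc i" J] by (simp add: lower_def)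
      show "v \<bullet> w = 0" if "w \<in> lower i" for w
        using orth that 1 family_low[of i J] by (simp add: lower_def)
    qed (use 1 J in auto)
    then show ?thesis using 1 by (cases "i = 0") (simp_all add: family_rate_def)
  next
    case 2
    have "norm (rand_op v) \<le> (1 - real (max 1 j) / real (card A)) * norm v"
      by (rule rand_op_sgn_low[OF M _ 2(2)]) (use v orth 2 J ne in auto)
    also have "1 - real (max 1 j) / real (card A) = family_rate J i"
      using 2 by (cases "j = 0") (auto simp: family_rate_def)
    finally show ?thesis .
  next
    case 3
    have "norm (rand_op v) \<le> (1 - real J / real (card A)) * norm v"
    proof (rule rand_op_rest[OF M])
      have "Suc (2 * J + 2) = 2 * J + 3" by simp
      then show "v \<in> span (delta ` injections)"
        using v unfolding 3 using family_top[OF ne, of J] by metis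
    qed (use 3 J M orth ne in auto)
    then show ?thesis using 3 by (simp add: family_rate_def)
  qed
qed

lemma rand_op_trace:
  assumes M: "12 \<le> card A" and s: "s \<in> injections"
  shows "fact (card A) * coord ((rand_op ^^ (2 * h)) (delta s)) s \<le> 1 + mixing_sum (2 * h)"
proof -
  define J where "J = card A div 2"
  define m where "m = real (card A)"
  define C where "C j = real ((card A * card A) choose j)" for j
  have Jm: "2 * J \<le> card A" "1 \<le> J" using M by (auto simp: J_def)
  have mp: "m > 0" using M by (simp add: m_def)
  have Jm': "real J \<le> m" using Jm by (simp add: m_def)
  have ne: "injections \<noteq> {}" using s by auto
  have "fact (card A) * coord ((rand_op ^^ (2 * h)) (delta s)) s
      = (\<Sum>d\<in>delta ` injections. (norm ((rand_op ^^ h) d))\<^sup>2)"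
    unfolding rand_op_def using card_times_diagonal[OF s] by (simp add: card_injections)
  also have "\<dots> \<le> (\<Sum>i<2 * J + 3. real (card (family J i)) * family_rate J i ^ (2 * h))"
  proof (rule trace_filtration_bound)
    show "symmetric_op rand_op" unfolding rand_op_def by (rule walk_op_symmetric)
    show "finite (family J i)" for i by (auto simp: family_def finite_level finite_injections)
    show "rand_op v \<in> span (\<Union>l<i. family J l)"
      if "i \<le> 2 * J + 3" "v \<in> span (\<Union>l<i. family J l)" for i v
      unfolding rand_op_def by (rule walk_op_family[OF that(2,1) ne])
    show "0 \<le> family_rate J i" for i
      using Jm M by (auto simp: family_rate_def divide_simps)
    show "orthonormal (delta ` injections)" by (rule orthonormal_delta)
    show "finite (delta ` injections)" using finite_injections by simp
    show "span (delta ` injections) = span (\<Union>l<2 * J + 3. family J l)"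
      by (rule family_top[OF ne, symmetric])
  qed (rule family_contraction[OF M J_def ne])
  also have "2 * J + 3 = Suc J + (Suc J + 1)" by simp
  also have "(\<Sum>i<Suc J + (Suc J + 1). real (card (family J i)) * family_rate J i ^ (2 * h))
      = (\<Sum>i<Suc J. real (card (family J i)) * family_rate J i ^ (2 * h))
      + (\<Sum>j<Suc J. real (card (family J (Suc J + j))) * family_rate J (Suc J + j) ^ (2 * h))
      + real (card (family J (2 * J + 2))) * family_rate J (2 * J + 2) ^ (2 * h)"
    unfolding sum_lessThan_add by (simp add: mult_2)
  also have "\<dots> \<le> (1 + (\<Sum>j=1..J. C j * (1 - real j / m) ^ (2 * h)))
      + (\<Sum>j=1..J. C j * (1 - real j / m) ^ (2 * h)) * 2 + fact (card A) * (1 - real J / m) ^ (2 * h)"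
  proof (intro add_mono)
    have low: "real (card (family J i)) * family_rate J i ^ (2 * h)
        \<le> (if i = 0 then 1 else C i * (1 - real i / m) ^ (2 * h))" if i: "i \<le> J" for i
    proof -
      have "real (card (family J i)) \<le> C i"
        using card_image_le[OF finite_level, of cylinder i] i by (simp add: family_def C_def card_level)
      then have "real (card (family J i)) * family_rate J i ^ (2 * h) \<le> C i * family_rate J i ^ (2 * h)"
        by (intro mult_right_mono) (auto simp: power_mult)
      also have "\<dots> \<le> (if i = 0 then 1 else C i * (1 - real i / m) ^ (2 * h))"
        using i by (auto simp: family_rate_def C_def m_def)
      finally show ?thesis .
    qed
    have "(\<Sum>i<Suc J. real (card (family J i)) * family_rate J i ^ (2 * h))
        \<le> (\<Sum>i<Suc J. if i = 0 then 1 else C i * (1 - real i / m) ^ (2 * h))"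
      by (intro sum_mono low) auto
    also have "\<dots> = 1 + (\<Sum>j=1..J. C j * (1 - real j / m) ^ (2 * h))"
      unfolding sum.lessThan_Suc_shift by (simp add: sum.atLeast1_atMost_eq)
    finally show "(\<Sum>i<Suc J. real (card (family J i)) * family_rate J i ^ (2 * h)) \<le> \<dots>" .
  next
    have mid: "real (card (family J (Suc J + j))) * family_rate J (Suc J + j) ^ (2 * h)
        \<le> (if j = 0 then (1 - 1 / m) ^ (2 * h) else C j * (1 - real j / m) ^ (2 * h))" if j: "j \<le> J" for j
    proof -
      have "family J (Suc J + j) = (\<lambda>\<kappa>. sgn_op (cylinder \<kappa>)) ` level j" using j by (auto simp: family_def)
      then have "real (card (family J (Suc J + j))) \<le> C j"
        using card_image_le[OF finite_level, of "\<lambda>\<kappa>. sgn_op (cylinder \<kappa>)" j] by (simp add: C_def card_level)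
      then have "real (card (family J (Suc J + j))) * family_rate J (Suc J + j) ^ (2 * h)
          \<le> C j * family_rate J (Suc J + j) ^ (2 * h)"
        by (intro mult_right_mono) (auto simp: power_mult)
      also have "\<dots> \<le> (if j = 0 then (1 - 1 / m) ^ (2 * h) else C j * (1 - real j / m) ^ (2 * h))"
        using j by (auto simp: family_rate_def C_def m_def)
      finally show ?thesis .
    qed
    have "1 * 1 \<le> card A * card A" using M by (intro mult_mono) auto
    then have "1 \<le> real (card A * card A)" by linarith
    then have C1: "1 \<le> C 1" unfolding C_def by (simp only: choose_one)
    have "(\<Sum>j<Suc J. real (card (family J (Suc J + j))) * family_rate J (Suc J + j) ^ (2 * h))
        \<le> (\<Sum>j<Suc J. if j = 0 then (1 - 1 / m) ^ (2 * h) else C j * (1 - real j / m) ^ (2 * h))"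
      by (intro sum_mono mid) auto
    also have "\<dots> = (1 - 1 / m) ^ (2 * h) + (\<Sum>j=1..J. C j * (1 - real j / m) ^ (2 * h))"
      unfolding sum.lessThan_Suc_shift by (simp add: sum.atLeast1_atMost_eq)
    \<comment> \<open>The sign character spans one dimension and decays at the rate of level 1, so
      the level-1 term dominates it.\<close>
    also have "(1 - 1 / m) ^ (2 * h) \<le> C 1 * (1 - real 1 / m) ^ (2 * h)"
      using mult_right_mono[OF C1, of "(1 - 1 / m) ^ (2 * h)"] by (simp add: power_mult)
    also have "\<dots> \<le> (\<Sum>j=1..J. C j * (1 - real j / m) ^ (2 * h))"
      using Jm by (intro member_le_sum) (auto simp: C_def power_mult)
    finally show "(\<Sum>j<Suc J. real (card (family J (Suc J + j))) * family_rate J (Suc J + j) ^ (2 * h))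
        \<le> (\<Sum>j=1..J. C j * (1 - real j / m) ^ (2 * h)) * 2" by simp
  next
    have "card (family J (2 * J + 2)) \<le> fact (card A)"
      using card_image_le[OF finite_injections, of delta] by (simp add: family_def card_injections)
    then have "real (card (family J (2 * J + 2))) \<le> fact (card A)"
      by (metis of_nat_fact of_nat_le_iff)
    then show "real (card (family J (2 * J + 2))) * family_rate J (2 * J + 2) ^ (2 * h)
        \<le> fact (card A) * (1 - real J / m) ^ (2 * h)"
      by (intro mult_mono) (auto simp: family_rate_def m_def power_mult)
  qed
  also have "\<dots> = 1 + mixing_sum (2 * h)"
    by (simp add: mixing_sum_def J_def m_def C_def)
  finally show ?thesis .
qed

definition centred :: "('p \<Rightarrow> 'p) \<Rightarrow> ('p \<Rightarrow> 'p) fsv" where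
  "centred s = delta s - fvec injections (\<lambda>_. 1 / fact (card A))"

lemma rand_op_uniform:
  assumes "A \<noteq> {}"
  shows "rand_op (fvec injections (\<lambda>_. c)) = fvec injections (\<lambda>_. c)"
proof (rule fsv_eqI)
  fix s
  have "coord (swap.theta A (fvec injections (\<lambda>_. c))) s
      = (\<Sum>p\<in>A. \<Sum>q\<in>A. coord (fvec injections (\<lambda>_. c)) s)"
    unfolding coord_theta
    by (intro sum.cong refl) (simp add: coord_fvec finite_injections swap_injections)
  then show "coord (rand_op (fvec injections (\<lambda>_. c))) s = coord (fvec injections (\<lambda>_. c)) s"
    using assms fin by (simp add: rand_op_def walk_op_def power2_eq_square)
qed

lemma norm_rand_op_le: "norm (rand_op v) \<le> norm v"
proof -
  have "norm (swap.theta A v) \<le> (\<Sum>p\<in>A. \<Sum>q\<in>A. norm v)"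
    unfolding swap.theta_def
    by (intro order_trans[OF norm_sum] sum_mono) (simp add: swap.norm_tau)
  then have "norm (swap.theta A v) \<le> (real (card A))\<^sup>2 * norm v" by (simp add: power2_eq_square)
  then show ?thesis
    by (cases "card A = 0") (simp_all add: rand_op_def walk_op_def divide_le_eq mult.commute)
qed

text \<open>A deviation from uniformity is the inner product of two centred point masses, each moved
  for about half of the time; Cauchy-Schwarz reduces it to the diagonal, hence to the trace. The
  pointwise form is needed because the later comparison of the two parts of the walk works with
  absolute values at single states.\<close>

theorem rand_op_pointwise:
  assumes M: "12 \<le> card A" and s: "s \<in> injections" and u: "u \<in> injections"
  shows "fact (card A) * \<bar>coord ((rand_op ^^ k) (delta s)) u - 1 / fact (card A)\<bar> \<le> 2 * mixing_sum k"
proof -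
  have ne: "A \<noteq> {}" using M by auto
  let ?pi = "fvec injections (\<lambda>_. 1 / fact (card A)) :: ('p \<Rightarrow> 'p) fsv"
  have sym: "symmetric_op rand_op" unfolding rand_op_def by (rule walk_op_symmetric)
  have sympow: "symmetric_op (rand_op ^^ l)" for l by (rule symmetric_op_funpow[OF sym])
  have pi: "(rand_op ^^ l) ?pi = ?pi" for l
    by (induction l) (simp_all add: rand_op_uniform[OF ne])
  have cen: "(rand_op ^^ l) (centred w) = (rand_op ^^ l) (delta w) - ?pi" for l w
    using linear_diff[OF symmetric_opD(1)[OF sympow]] by (simp add: centred_def pi)
  have prod: "(rand_op ^^ (l + l')) (centred w) \<bullet> delta w' = (rand_op ^^ l) (centred w) \<bullet> (rand_op ^^ l') (centred w')"
    if w: "w \<in> injections" "w' \<in> injections" for l l' w w'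
  proof -
    have "centred w \<bullet> ?pi = 0"
    proof -
      have "(\<Sum>x\<in>injections. (if x = w then 1 else 0 :: real)) = 1"
        using w finite_injections by simp
      then show ?thesis
        by (simp add: centred_def inner_diff_left inner_fvec finite_injections coord_fvec
            sum_divide_distrib[symmetric] card_injections)
    qed
    then have "(rand_op ^^ (l + l')) (centred w) \<bullet> ?pi = 0"
      by (simp add: symmetric_opD(2)[OF sympow] pi)
    then have "(rand_op ^^ (l + l')) (centred w) \<bullet> delta w' = (rand_op ^^ (l + l')) (centred w) \<bullet> centred w'"
      by (simp add: centred_def inner_diff_right)
    also have "\<dots> = (rand_op ^^ l) (centred w) \<bullet> (rand_op ^^ l') (centred w')"
      by (simp add: add.commute[of l l'] funpow_add symmetric_opD(2)[OF sympow, of l'])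
    finally show ?thesis .
  qed
  define h where "h = k div 2"
  have nrm: "(norm ((rand_op ^^ h) (centred w)))\<^sup>2 \<le> mixing_sum (2 * h) / fact (card A)"
    if w: "w \<in> injections" for w
  proof -
    have "(norm ((rand_op ^^ h) (centred w)))\<^sup>2 = coord ((rand_op ^^ (2 * h)) (centred w)) w"
      using prod[OF w w, of h h] by (simp add: power2_norm_eq_inner inner_delta mult_2)
    also have "\<dots> = coord ((rand_op ^^ (2 * h)) (delta w)) w - 1 / fact (card A)"
      using w by (simp add: cen coord_fvec finite_injections)
    also have "\<dots> = (fact (card A) * coord ((rand_op ^^ (2 * h)) (delta w)) w - 1) / fact (card A)"
      by (simp add: field_simps)
    also have "\<dots> \<le> mixing_sum (2 * h) / fact (card A)"
      using rand_op_trace[OF M w, of h] by (intro divide_right_mono) auto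
    finally show ?thesis .
  qed
  have kh: "k = (k - h) + h" "h \<le> k - h" by (auto simp: h_def)
  have decr: "norm ((rand_op ^^ (h + l)) v) \<le> norm ((rand_op ^^ h) v)" for l v
  proof (induction l)
    case (Suc l)
    have "norm ((rand_op ^^ (h + Suc l)) v) = norm (rand_op ((rand_op ^^ (h + l)) v))" by simp
    then show ?case using Suc norm_rand_op_le order_trans by metis
  qed simp
  define c where "c = sqrt (mixing_sum (2 * h) / fact (card A))"
  have nc: "norm ((rand_op ^^ h) (centred w)) \<le> c" if "w \<in> injections" for w
    using nrm[OF that] by (simp add: c_def real_le_rsqrt)
  have c0: "c \<ge> 0" using nc[OF s] norm_ge_zero order_trans by blast
  have "\<bar>coord ((rand_op ^^ k) (delta s)) u - 1 / fact (card A)\<bar> = \<bar>(rand_op ^^ k) (centred s) \<bullet> delta u\<bar>"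
    using u by (simp add: cen inner_delta coord_fvec finite_injections del: inner_diff_left)
  also have "\<dots> = \<bar>(rand_op ^^ (k - h)) (centred s) \<bullet> (rand_op ^^ h) (centred u)\<bar>"
    using prod[OF s u, of "k - h" h] kh(1) by simp
  also have "\<dots> \<le> norm ((rand_op ^^ (k - h)) (centred s)) * norm ((rand_op ^^ h) (centred u))"
    by (rule Cauchy_Schwarz_ineq2)
  also have "\<dots> \<le> c * c"
    using decr[of "k - h - h" "centred s"] nc[OF s] nc[OF u] kh c0
    by (intro mult_mono) auto
  also have "c * c = mixing_sum (2 * h) / fact (card A)"
  proof -
    have "0 \<le> mixing_sum (2 * h) / fact (card A)" using nrm[OF s] zero_le_power2 order_trans by blast
    then show ?thesis unfolding c_def by (rule real_sqrt_mult_self[THEN trans, OF abs_of_nonneg])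
  qed
  finally have "fact (card A) * \<bar>coord ((rand_op ^^ k) (delta s)) u - 1 / fact (card A)\<bar> \<le> mixing_sum (2 * h)"
    by (simp add: field_simps)
  also have "\<dots> \<le> 2 * mixing_sum k"
  proof -
    \<comment> \<open>The exponent \<open>2 * h\<close> is \<open>k\<close> or \<open>k - 1\<close>.
      One missing power of a rate that is at least \<open>1 / 2\<close> costs a factor of at most
      2.\<close>
    have step: "x ^ (2 * h) \<le> 2 * x ^ k" if x: "1 / 2 \<le> x" "x \<le> 1" for x :: real
    proof (cases "even k")
      case True
      then have "2 * h = k" by (simp add: h_def)
      then show ?thesis using x by simp
    next
      case False
      then have "k = Suc (2 * h)" by (simp add: h_def)
      moreover have "1 / 2 * x ^ (2 * h) \<le> x * x ^ (2 * h)"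
        using x by (intro mult_right_mono) auto
      ultimately show ?thesis by simp
    qed
    have rate: "1 / 2 \<le> 1 - real j / real (card A)" "1 - real j / real (card A) \<le> 1" if "j \<le> card A div 2" for j
    proof -
      have "2 * real j \<le> real (card A)" using that by linarith
      then show "1 / 2 \<le> 1 - real j / real (card A)" using M by (simp add: field_simps)
    qed simp
    have "(\<Sum>j=1..card A div 2. real ((card A * card A) choose j) * (1 - real j / real (card A)) ^ (2 * h))
        \<le> (\<Sum>j=1..card A div 2. real ((card A * card A) choose j) * (2 * (1 - real j / real (card A)) ^ k))"
      by (intro sum_mono mult_left_mono step rate) auto
    also have "\<dots> = 2 * (\<Sum>j=1..card A div 2. real ((card A * card A) choose j) * (1 - real j / real (card A)) ^ k)"
      by (simp add: sum_distrib_left mult_ac)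
    finally have "(\<Sum>j=1..card A div 2. real ((card A * card A) choose j) * (1 - real j / real (card A)) ^ (2 * h)) \<le> \<dots>" .
    moreover have "fact (card A) * (1 - real (card A div 2) / real (card A)) ^ (2 * h)
        \<le> fact (card A) * (2 * (1 - real (card A div 2) / real (card A)) ^ k)"
      by (intro mult_left_mono step rate) auto
    moreover have "3 * a + c \<le> 2 * (3 * a' + f * q)" if "a \<le> 2 * a'" "c \<le> f * (2 * q)"
      for a a' c f q :: real
      using that by (simp add: algebra_simps)
    ultimately show ?thesis unfolding mixing_sum_def by blast
  qed
  finally show ?thesis .
qed

end

section \<open>The walk on the restricted permutations\<close>

locale two_step_walk =
  fixes f g :: "nat \<Rightarrow> nat" and n :: nat
  assumes g_ge1: "1 \<le> g n" and g_le_f: "g n \<le> f n" and f_less: "f n < n"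
begin

abbreviation "M \<equiv> two_step_matrix f g n"
abbreviation "S \<equiv> restricted_perms n M"
abbreviation "low_pos \<equiv> {1..f n}"
abbreviation "large_val \<equiv> {g n + 1..n}"

definition large_pos :: "(nat \<Rightarrow> nat) \<Rightarrow> nat set" where
  "large_pos x = {i \<in> {1..n}. g n < x i}"

text \<open>Pairs of low positions that both hold large values are left to \<open>large_pos\<close>,
  so that the two kinds of admissible pairs are disjoint.\<close>

definition small_pairs :: "(nat \<Rightarrow> nat) \<Rightarrow> (nat \<times> nat) set" where
  "small_pairs x = {(i, j). i \<in> low_pos \<and> j \<in> low_pos \<and> (x i \<le> g n \<or> x j \<le> g n)}"

definition pairs :: nat where
  "pairs = (n - g n)\<^sup>2 + ((f n)\<^sup>2 - (f n - g n)\<^sup>2)"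

lemma S_iff: "x \<in> S \<longleftrightarrow> x permutes {1..n} \<and> (\<forall>i\<in>{1..n}. f n < i \<longrightarrow> g n < x i)"
proof -
  have "M i (x i) = 1 \<longleftrightarrow> (f n < i \<longrightarrow> g n < x i)" if "x permutes {1..n}" "i \<in> {1..n}" for i
  proof -
    have "1 \<le> x i" using permutes_in_image[OF that(1), of i] that(2) by simp
    then show ?thesis
      by (auto simp: two_step_matrix_def one_sided_matrix_def two_step_vector_def)
  qed
  then show ?thesis unfolding restricted_perms_def by blast
qed

lemma S_permutes: "x \<in> S \<Longrightarrow> x permutes {1..n}"
  by (simp add: S_iff)

lemma S_large: "x \<in> S \<Longrightarrow> i \<in> {1..n} \<Longrightarrow> f n < i \<Longrightarrow> g n < x i"
  by (simp add: S_iff)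

lemma id_in_S: "id \<in> S"
  using g_le_f by (auto simp: S_iff permutes_id)

lemma finite_S: "finite S"
  by (rule finite_subset[OF _ finite_permutations[of "{1..n}"]]) (use S_permutes in blast, simp)

lemma card_S_pos: "0 < card S"
  using id_in_S finite_S by (auto simp: card_gt_0_iff)

lemma exchange_in_S:
  assumes x: "x \<in> S" and ij: "i \<in> {1..n}" "j \<in> {1..n}"
  shows "exchange x i j \<in> S \<longleftrightarrow> (i \<in> large_pos x \<and> j \<in> large_pos x) \<or> (i \<in> low_pos \<and> j \<in> low_pos)"
proof -
  have perm: "exchange x i j permutes {1..n}"
    unfolding exchange_def using S_permutes[OF x] ij
    by (intro permutes_compose) (auto intro: permutes_swap_id)
  have "exchange x i j \<in> S \<longleftrightarrow> (f n < i \<longrightarrow> g n < x j) \<and> (f n < j \<longrightarrow> g n < x i)"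
    unfolding S_iff using perm ij S_large[OF x]
    by (auto simp: exchange_def Transposition.transpose_def split: if_splits)
  then show ?thesis
    using ij S_large[OF x ij(1)] S_large[OF x ij(2)] by (auto simp: large_pos_def)
qed

lemma admissible_pairs_eq:
  assumes "x \<in> S"
  shows "admissible_pairs n M x = large_pos x \<times> large_pos x \<union> small_pairs x"
    and "large_pos x \<times> large_pos x \<inter> small_pairs x = {}"
proof -
  have sub: "low_pos \<subseteq> {1..n}" "large_pos x \<subseteq> {1..n}" using f_less by (auto simp: large_pos_def)
  have small: "x i \<le> g n \<longleftrightarrow> i \<notin> large_pos x" if "i \<in> low_pos" for i
    using that sub by (auto simp: large_pos_def)
  show "admissible_pairs n M x = large_pos x \<times> large_pos x \<union> small_pairs x"
  proof (intro set_eqI, clarify)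
    fix i j
    show "(i, j) \<in> admissible_pairs n M x \<longleftrightarrow> (i, j) \<in> large_pos x \<times> large_pos x \<union> small_pairs x"
    proof (cases "i \<in> {1..n} \<and> j \<in> {1..n}")
      case True
      then show ?thesis
        using exchange_in_S[OF assms, of i j] small[of i] small[of j]
        unfolding admissible_pairs_def small_pairs_def by auto
    next
      case False
      then show ?thesis using sub unfolding admissible_pairs_def small_pairs_def by auto
    qed
  qed
  show "large_pos x \<times> large_pos x \<inter> small_pairs x = {}"
    by (auto simp: small_pairs_def large_pos_def)
qed

lemma bij_large:
  assumes "x \<in> S"
  shows "bij_betw x (large_pos x) large_val"
proof -
  have b: "bij_betw x {1..n} {1..n}" using permutes_imp_bij[OF S_permutes[OF assms]] .
  have "x ` large_pos x = large_val"
  proof (intro subset_antisym subsetI)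
    fix v assume "v \<in> x ` large_pos x"
    then show "v \<in> large_val" using b by (auto simp: large_pos_def bij_betw_def)
  next
    fix v assume v: "v \<in> large_val"
    then have "v \<in> x ` {1..n}" using b by (auto simp: bij_betw_def)
    then show "v \<in> x ` large_pos x" using v by (auto simp: large_pos_def)
  qed
  moreover have "inj_on x (large_pos x)"
    using b by (auto simp: bij_betw_def large_pos_def intro: inj_on_subset)
  ultimately show ?thesis by (simp add: bij_betw_def)
qed

lemma card_large_pos: "x \<in> S \<Longrightarrow> card (large_pos x) = n - g n"
  using bij_betw_same_card[OF bij_large] by simp

lemma card_low_large:
  assumes "x \<in> S"
  shows "card (low_pos \<inter> large_pos x) = f n - g n"
proof -
  have sub: "{1..n} - large_pos x \<subseteq> low_pos"
    using S_large[OF assms] by (force simp: large_pos_def)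
  have lp: "large_pos x \<subseteq> {1..n}" by (auto simp: large_pos_def)
  have "card ({1..n} - large_pos x) = g n"
    using card_Diff_subset[OF finite_subset[OF lp] lp] card_large_pos[OF assms] g_le_f f_less by simp
  moreover have "low_pos \<inter> large_pos x = low_pos - ({1..n} - large_pos x)"
    using f_less by auto
  ultimately show ?thesis
    using card_Diff_subset[of "{1..n} - large_pos x" low_pos] sub by simp
qed

lemma low_pairs_split:
  assumes "x \<in> S"
  shows "low_pos \<times> low_pos = small_pairs x \<union> (low_pos \<inter> large_pos x) \<times> (low_pos \<inter> large_pos x)"
    and "small_pairs x \<inter> (low_pos \<inter> large_pos x) \<times> (low_pos \<inter> large_pos x) = {}"
  using f_less by (auto simp: small_pairs_def large_pos_def)

lemma finite_small_pairs: "finite (small_pairs x)"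
  by (rule finite_subset[of _ "low_pos \<times> low_pos"]) (auto simp: small_pairs_def)

lemma finite_large_pos: "finite (large_pos x)"
  by (simp add: large_pos_def)

lemma card_small_pairs:
  assumes "x \<in> S"
  shows "card (small_pairs x) = (f n)\<^sup>2 - (f n - g n)\<^sup>2"
proof -
  let ?L = "(low_pos \<inter> large_pos x) \<times> (low_pos \<inter> large_pos x)"
  have "card (low_pos \<times> low_pos) = card (small_pairs x) + card ?L"
    unfolding low_pairs_split(1)[OF assms]
    by (rule card_Un_disjoint[OF finite_small_pairs _ low_pairs_split(2)[OF assms]]) simp
  then show ?thesis
    unfolding card_cartesian_product card_low_large[OF assms] by (simp add: power2_eq_square)
qed

lemma card_admissible_pairs:
  assumes "x \<in> S"
  shows "card (admissible_pairs n M x) = pairs"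
  unfolding admissible_pairs_eq(1)[OF assms] pairs_def
  by (subst card_Un_disjoint[OF _ finite_small_pairs admissible_pairs_eq(2)[OF assms]])
    (simp_all add: finite_large_pos card_cartesian_product card_large_pos[OF assms]
      card_small_pairs[OF assms] power2_eq_square)

lemma exchange_eq_iff:
  assumes "inj x" "i < j" "i' < (j' :: nat)"
  shows "exchange x i j = exchange x i' j' \<longleftrightarrow> i = i' \<and> j = j'"
proof
  assume "exchange x i j = exchange x i' j'"
  then have *: "Transposition.transpose i j l = Transposition.transpose i' j' l" for l
    using assms(1) by (auto simp: exchange_def fun_eq_iff inj_def)
  show "i = i' \<and> j = j'"
    using *[of i] *[of j] assms(2,3) by (auto simp: Transposition.transpose_def split: if_splits)
qed auto

text \<open>Distinct positions are admissible in both orders or in neither, and different unordered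
  pairs lead to different permutations; the \<open>n\<close> diagonal pairs complete the
  count.\<close>

lemma card_neighbours:
  assumes x: "x \<in> S"
  shows "n + 2 * card (neighbours n M x) = pairs"
proof -
  have inj: "inj x" using S_permutes[OF x] by (rule permutes_inj)
  let ?A = "admissible_pairs n M x"
  define U where "U = {(i, j) \<in> ?A. i < j}"
  define L where "L = {(i, j) \<in> ?A. j < i}"
  define D where "D = (\<lambda>i. (i, i)) ` {1..n}"
  have finA: "finite ?A"
    by (rule finite_subset[of _ "{1..n} \<times> {1..n}"]) (auto simp: admissible_pairs_def)
  have fin: "finite U" "finite L" "finite D"
    using finA by (auto simp: U_def L_def D_def intro: finite_subset[of _ ?A])
  have ex_self: "exchange x i i = x" for i by (simp add: exchange_def)
  have ex_comm: "exchange x i j = exchange x j i" for i j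
    by (simp add: exchange_def Transposition.transpose_commute)
  have A: "?A = D \<union> (U \<union> L)"
    using x by (auto simp: U_def L_def D_def admissible_pairs_def ex_self)
  have disj: "D \<inter> (U \<union> L) = {}" "U \<inter> L = {}" by (auto simp: D_def U_def L_def)
  have "L = prod.swap ` U"
    by (force simp: L_def U_def admissible_pairs_def ex_comm)
  then have "card L = card U" by (simp add: card_image)
  moreover have "card D = n" by (simp add: D_def card_image inj_on_def)
  moreover have "card ?A = card D + (card U + card L)"
    unfolding A using fin disj by (simp add: card_Un_disjoint)
  moreover have "card (neighbours n M x) = card U"
  proof -
    have "bij_betw (\<lambda>(i, j). exchange x i j) U (neighbours n M x)"
      unfolding bij_betw_def
    proof (intro conjI inj_onI subset_antisym subsetI)
      fix a b assume "a \<in> U" "b \<in> U" "(\<lambda>(i, j). exchange x i j) a = (\<lambda>(i, j). exchange x i j) b"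
      then show "a = b" by (auto simp: U_def exchange_eq_iff[OF inj])
    next
      fix y assume "y \<in> (\<lambda>(i, j). exchange x i j) ` U"
      then obtain i j where ij: "(i, j) \<in> ?A" "i < j" "y = exchange x i j" by (auto simp: U_def)
      have "y i = x j" using ij by (simp add: exchange_def)
      then have "y \<noteq> x" using ij(2) injD[OF inj, of i j] by auto
      moreover have "i \<in> {1..n}" "j \<in> {1..n}" "y \<in> S" using ij by (auto simp: admissible_pairs_def)
      ultimately show "y \<in> neighbours n M x" using ij(3) unfolding neighbours_def by blast
    next
      fix y assume "y \<in> neighbours n M x"
      then obtain i j where y: "y \<in> S" "y \<noteq> x" "i \<in> {1..n}" "j \<in> {1..n}" "y = exchange x i j"
        by (auto simp: neighbours_def)
      have "i \<noteq> j" using y ex_self by auto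
      then have "(min i j, max i j) \<in> U" "y = exchange x (min i j) (max i j)"
        using y ex_comm[of i j] by (auto simp: U_def admissible_pairs_def min_def max_def)
      then show "y \<in> (\<lambda>(i, j). exchange x i j) ` U" by force
    qed
    then show ?thesis by (simp add: bij_betw_same_card)
  qed
  ultimately show ?thesis using card_admissible_pairs[OF x] by simp
qed

text \<open>The identity lies in \<open>S\<close>, so the description in \<open>graph_degree\<close>
  has exactly one witness.\<close>

lemma graph_degree_eq:
  assumes "x \<in> S"
  shows "card (neighbours n M x) = graph_degree n M"
proof -
  define d where "d = card (neighbours n M id)"
  have all: "card (neighbours n M y) = d" if "y \<in> S" for y
    using card_neighbours[OF that] card_neighbours[OF id_in_S] by (simp add: d_def)
  have "graph_degree n M = d"
    unfolding graph_degree_def by (rule the_equality) (use all id_in_S in auto)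
  then show ?thesis using all[OF assms] by simp
qed

lemma pair_count_eq: "pair_count f g n = pairs"
  using graph_degree_eq[OF id_in_S] card_neighbours[OF id_in_S] by (simp add: pair_count_def)

lemma pairs_int:
  "int pairs = int n ^ 2 - 2 * int n * int (g n) + 2 * int (f n) * int (g n)"
proof -
  have "(f n - g n)\<^sup>2 \<le> (f n)\<^sup>2" by (intro power_mono) auto
  then have "int pairs = (int n - int (g n))\<^sup>2 + ((int (f n))\<^sup>2 - (int (f n) - int (g n))\<^sup>2)"
    using g_le_f f_less unfolding pairs_def of_nat_add by (simp only: of_nat_diff of_nat_power)
  then show ?thesis by (simp add: power2_eq_square algebra_simps)
qed

lemma pairs_real: "real pairs = (real n - real (g n))\<^sup>2 + ((real (f n))\<^sup>2 - (real (f n) - real (g n))\<^sup>2)"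
proof -
  have "(f n - g n)\<^sup>2 \<le> (f n)\<^sup>2" by (intro power_mono) auto
  then show ?thesis
    using g_le_f f_less unfolding pairs_def of_nat_add by (simp only: of_nat_diff of_nat_power)
qed

lemma pairs_pos: "0 < pairs"
proof -
  have "0 < n - g n" using g_le_f f_less by simp
  then have "0 < (n - g n)\<^sup>2" by simp
  then show ?thesis unfolding pairs_def by linarith
qed

end

section \<open>Transition operator, return probabilities and places of the small values\<close>

context two_step_walk
begin

text \<open>Averages functions instead of moving measures; by reversibility the mass function of the
  walk evolves under the same operator.\<close>

definition step :: "((nat \<Rightarrow> nat) \<Rightarrow> real) \<Rightarrow> (nat \<Rightarrow> nat) \<Rightarrow> real" where
  "step \<phi> x = (\<Sum>(i, j)\<in>admissible_pairs n M x. \<phi> (exchange x i j)) / real pairs"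

definition point :: "(nat \<Rightarrow> nat) \<Rightarrow> (nat \<Rightarrow> nat) \<Rightarrow> real" where
  "point x y = of_bool (y = x)"

lemma finite_admissible: "finite (admissible_pairs n M x)"
  by (rule finite_subset[of _ "{1..n} \<times> {1..n}"]) (auto simp: admissible_pairs_def)

lemma admissible_in_S: "(i, j) \<in> admissible_pairs n M x \<Longrightarrow> exchange x i j \<in> S"
  by (simp add: admissible_pairs_def)

lemma exchange_exchange: "exchange (exchange x i j) i j = x"
  by (simp add: exchange_def comp_assoc)

lemma step_cong: "(\<And>y. y \<in> S \<Longrightarrow> \<phi> y = \<psi> y) \<Longrightarrow> step \<phi> x = step \<psi> x"
  unfolding step_def by (intro arg_cong2[of _ _ _ _ "(/)"] sum.cong refl) (auto simp: admissible_in_S)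

lemma step_const: "x \<in> S \<Longrightarrow> step (\<lambda>_. c) x = c"
  using pairs_pos by (simp add: step_def card_admissible_pairs)

text \<open>Sending \<open>(y, i, j)\<close> to \<open>(exchange y i j, i, j)\<close> is an
  involution of the admissible triples, and the normalisation \<open>pairs\<close> is the same at
  every state.\<close>

lemma step_symmetric: "(\<Sum>y\<in>S. \<phi> y * step \<psi> y) = (\<Sum>y\<in>S. step \<phi> y * \<psi> y)"
proof -
  let ?N = "SIGMA y:S. admissible_pairs n M y"
  have "(\<Sum>y\<in>S. \<Sum>(i, j)\<in>admissible_pairs n M y. \<phi> y * \<psi> (exchange y i j))
      = (\<Sum>(y, i, j)\<in>?N. \<phi> y * \<psi> (exchange y i j))"
    by (subst sum.Sigma) (auto simp: finite_S finite_admissible case_prod_unfold)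
  also have "\<dots> = (\<Sum>(y, i, j)\<in>?N. \<phi> (exchange y i j) * \<psi> y)"
    by (rule sum.reindex_bij_witness[of _ "\<lambda>(y, i, j). (exchange y i j, i, j)" "\<lambda>(y, i, j). (exchange y i j, i, j)"])
      (auto simp: exchange_exchange admissible_pairs_def)
  also have "\<dots> = (\<Sum>y\<in>S. \<Sum>(i, j)\<in>admissible_pairs n M y. \<phi> (exchange y i j) * \<psi> y)"
    by (subst sum.Sigma) (auto simp: finite_S finite_admissible case_prod_unfold)
  finally show ?thesis
    by (simp add: step_def sum_distrib_left sum_distrib_right sum_divide_distrib[symmetric] case_prod_unfold)
qed

lemma steps_symmetric: "(\<Sum>y\<in>S. \<phi> y * (step ^^ t) \<psi> y) = (\<Sum>y\<in>S. (step ^^ t) \<phi> y * \<psi> y)"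
proof (induction t arbitrary: \<phi>)
  case (Suc t)
  have "(\<Sum>y\<in>S. \<phi> y * (step ^^ Suc t) \<psi> y) = (\<Sum>y\<in>S. step \<phi> y * (step ^^ t) \<psi> y)"
    by (simp add: step_symmetric)
  also have "\<dots> = (\<Sum>y\<in>S. (step ^^ Suc t) \<phi> y * \<psi> y)"
    by (simp add: Suc funpow_swap1)
  finally show ?case .
qed simp

lemma pmf_walk_step:
  assumes z: "z \<in> S"
  shows "pmf (walk_step n M z) y = step (\<lambda>w. of_bool (w = y)) z" and "set_pmf (walk_step n M z) \<subseteq> S"
proof -
  let ?A = "admissible_pairs n M z"
  have ne: "?A \<noteq> {}" using card_admissible_pairs[OF z] pairs_pos by auto
  have "pmf (walk_step n M z) y = measure (pmf_of_set ?A) ((\<lambda>(i, j). exchange z i j) -` {y})"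
    by (simp add: walk_step_def pmf_map)
  also have "\<dots> = real (card (?A \<inter> (\<lambda>(i, j). exchange z i j) -` {y})) / real pairs"
    by (simp add: measure_pmf_of_set[OF ne finite_admissible] card_admissible_pairs[OF z])
  also have "real (card (?A \<inter> (\<lambda>(i, j). exchange z i j) -` {y})) = (\<Sum>(i, j)\<in>?A. of_bool (exchange z i j = y))"
    by (simp add: case_prod_unfold sum.If_cases[OF finite_admissible] of_bool_def vimage_def)
  finally show "pmf (walk_step n M z) y = step (\<lambda>w. of_bool (w = y)) z" by (simp add: step_def)
  show "set_pmf (walk_step n M z) \<subseteq> S"
    by (auto simp: walk_step_def set_pmf_of_set[OF ne finite_admissible] admissible_in_S)
qed

lemma walk_dist_step:
  assumes x: "x \<in> S"
  shows "set_pmf (walk_dist n M t x) \<subseteq> S \<and> (\<forall>y\<in>S. pmf (walk_dist n M t x) y = (step ^^ t) (point x) y)"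
proof (induction t)
  case 0
  then show ?case using x by (auto simp: walk_dist_def point_def pmf_return of_bool_def)
next
  case (Suc t)
  have eq: "walk_dist n M (Suc t) x = bind_pmf (walk_dist n M t x) (walk_step n M)"
    by (simp add: walk_dist_def)
  have "pmf (walk_dist n M (Suc t) x) y = (step ^^ Suc t) (point x) y" if y: "y \<in> S" for y
  proof -
    have "pmf (walk_dist n M (Suc t) x) y
        = (\<Sum>z\<in>S. pmf (walk_step n M z) y * pmf (walk_dist n M t x) z)"
      unfolding eq pmf_bind using Suc by (intro integral_measure_pmf_real finite_S) auto
    also have "\<dots> = (\<Sum>z\<in>S. (step ^^ t) (point x) z * step (\<lambda>w. of_bool (w = y)) z)"
      using Suc by (intro sum.cong refl) (simp add: pmf_walk_step)
    also have "\<dots> = (\<Sum>z\<in>S. step ((step ^^ t) (point x)) z * of_bool (z = y))"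
      by (rule step_symmetric)
    also have "\<dots> = (step ^^ Suc t) (point x) y"
      using y finite_S by (simp add: of_bool_def if_distrib[of "\<lambda>u. _ * u"] sum.delta cong: if_cong)
    finally show ?thesis .
  qed
  moreover have "set_pmf (walk_dist n M (Suc t) x) \<subseteq> S"
    using Suc pmf_walk_step(2) unfolding eq set_bind_pmf by blast
  ultimately show ?case by blast
qed

lemma chi2_eq_sum:
  assumes x: "x \<in> S"
  shows "(walk_chi2 n M t x)\<^sup>2 = real (card S) * (\<Sum>y\<in>S. ((step ^^ t) (point x) y)\<^sup>2) - 1"
proof -
  let ?r = "\<lambda>y. (step ^^ t) (point x) y"
  have ne: "S \<noteq> {}" using x by auto
  have c: "real (card S) > 0" using card_S_pos by simp
  have one: "(\<Sum>y\<in>S. ?r y) = 1"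
  proof -
    have "(\<Sum>y\<in>S. ?r y) = (\<Sum>y\<in>S. pmf (walk_dist n M t x) y)"
      using walk_dist_step[OF x, of t] by (intro sum.cong refl) auto
    also have "\<dots> = 1" using walk_dist_step[OF x, of t] by (intro sum_pmf_eq_1 finite_S) blast
    finally show ?thesis .
  qed
  have "(walk_chi2 n M t x)\<^sup>2 = (\<Sum>y\<in>S. (?r y / (1 / real (card S)) - 1)\<^sup>2 * (1 / real (card S)))"
    unfolding walk_chi2_def chi2_dist_def
    using walk_dist_step[OF x, of t] finite_S ne
    by (subst real_sqrt_pow2) (auto intro!: sum_nonneg sum.cong)
  also have "\<dots> = (\<Sum>y\<in>S. real (card S) * (?r y)\<^sup>2 - 2 * ?r y + 1 / real (card S))"
    using c by (intro sum.cong refl) (simp add: power2_eq_square field_simps)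
  also have "\<dots> = real (card S) * (\<Sum>y\<in>S. (?r y)\<^sup>2) - 1"
    using c one by (simp add: sum.distrib sum_subtractf sum_distrib_left[symmetric])
  finally show ?thesis .
qed

lemma sum_squares_eq_return:
  assumes "x \<in> S"
  shows "(\<Sum>y\<in>S. ((step ^^ t) (point x) y)\<^sup>2) = (step ^^ (2 * t)) (point x) x"
proof -
  have "(\<Sum>y\<in>S. ((step ^^ t) (point x) y)\<^sup>2) = (\<Sum>y\<in>S. point x y * (step ^^ t) ((step ^^ t) (point x)) y)"
    by (simp add: steps_symmetric power2_eq_square)
  also have "\<dots> = (step ^^ (2 * t)) (point x) x"
    using assms finite_S by (simp add: point_def mult_2 funpow_add of_bool_def if_distrib[of "\<lambda>u. u * _"] sum.delta cong: if_cong)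
  finally show ?thesis .
qed

text \<open>Reversibility and the uniform stationary law turn a distance at time \<open>t\<close>
  into a return probability at the even time \<open>2 t\<close>, which the trace bound
  handles.\<close>

lemma chi2_eq_return:
  "x \<in> S \<Longrightarrow> (walk_chi2 n M t x)\<^sup>2 = real (card S) * (step ^^ (2 * t)) (point x) x - 1"
  by (simp add: chi2_eq_sum sum_squares_eq_return)

lemma walk_chi2_nonneg: "0 \<le> walk_chi2 n M t x"
  unfolding walk_chi2_def chi2_dist_def by (intro real_sqrt_ge_zero sum_nonneg) auto

text \<open>The inverse permutation cut down to the small values. The default 0 lies outside
  \<open>{1..f n}\<close>, as the base function of an injection space must.\<close>

definition place :: "(nat \<Rightarrow> nat) \<Rightarrow> nat \<Rightarrow> nat" where
  "place x k = (if k \<in> {1..g n} then inv x k else 0)"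

sublocale pos: injection_space "\<lambda>_. 0 :: nat" "{1..g n}" "{1..f n}"
  by unfold_locales auto

sublocale vals: permutation_space large_val
  by unfold_locales simp

lemma place_injections:
  assumes "x \<in> S"
  shows "place x \<in> pos.injections"
proof -
  have p: "x permutes {1..n}" using S_permutes[OF assms] .
  have "inv x k \<in> {1..f n}" if k: "k \<in> {1..g n}" for k
  proof -
    have "k \<in> {1..n}" using k g_le_f f_less by auto
    then have i: "inv x k \<in> {1..n}" using permutes_in_image[OF permutes_inv[OF p]] by blast
    have "x (inv x k) = k" using permutes_inverses(1)[OF p] .
    then show ?thesis using S_large[OF assms i] k i by force
  qed
  moreover have "inj_on (inv x) {1..g n}"
    using permutes_inj[OF permutes_inv[OF p]] by (rule inj_on_subset) simp
  moreover have "inj_on (place x) {1..g n} \<longleftrightarrow> inj_on (inv x) {1..g n}"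
    by (rule inj_on_cong) (simp add: place_def)
  ultimately show ?thesis
    unfolding pos.injections_def by (simp add: place_def image_subset_iff)
qed

lemma inv_comp_transpose: "bij x \<Longrightarrow> inv (x \<circ> Transposition.transpose i j) = Transposition.transpose i j \<circ> inv x"
  by (simp add: o_inv_distrib)

lemma exchange_eq_transpose_comp:
  assumes "inj x"
  shows "exchange x i j = Transposition.transpose (x i) (x j) \<circ> x"
proof
  fix k
  have "x k = x i \<longleftrightarrow> k = i" "x k = x j \<longleftrightarrow> k = j" using injD[OF assms] by blast+
  then show "exchange x i j k = (Transposition.transpose (x i) (x j) \<circ> x) k"
    by (simp add: exchange_def Transposition.transpose_def)
qed

lemma place_exchange:
  assumes "x \<in> S" "i \<in> low_pos" "j \<in> low_pos"
  shows "place (exchange x i j) = Transposition.transpose i j \<circ> place x"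
  using assms inv_comp_transpose[OF permutes_bij[OF S_permutes[OF assms(1)]], of i j]
  by (auto simp: place_def exchange_def fun_eq_iff Transposition.transpose_def)

lemma place_large:
  assumes "bij x" "u \<in> large_val" "v \<in> large_val"
  shows "place (Transposition.transpose u v \<circ> x) = place x"
proof -
  have "inv (Transposition.transpose u v \<circ> x) = inv x \<circ> Transposition.transpose u v"
    using assms(1) by (simp add: o_inv_distrib)
  then show ?thesis
    using assms(2,3) by (auto simp: place_def fun_eq_iff Transposition.transpose_def)
qed

lemma place_exchange_large:
  assumes x: "x \<in> S" and "i \<in> large_pos x" "j \<in> large_pos x"
  shows "place (exchange x i j) = place x"
proof -
  have "x i \<in> large_val" "x j \<in> large_val"
    using bij_large[OF x] assms(2,3) by (auto simp: bij_betw_def)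
  then show ?thesis
    using S_permutes[OF x] by (simp add: exchange_eq_transpose_comp permutes_inj place_large permutes_bij)
qed

lemma step_split:
  assumes x: "x \<in> S"
  shows "step \<phi> x = ((\<Sum>(i, j)\<in>large_pos x \<times> large_pos x. \<phi> (exchange x i j))
    + (\<Sum>(i, j)\<in>small_pairs x. \<phi> (exchange x i j))) / real pairs"
  unfolding step_def admissible_pairs_eq(1)[OF x]
  by (subst sum.union_disjoint)
    (use admissible_pairs_eq(2)[OF x] in \<open>auto simp: finite_large_pos finite_small_pairs\<close>)

text \<open>Completing \<open>small_pairs\<close> to all pairs of low positions adds the
  \<open>(f n - g n)^2\<close> pairs of low positions holding large values; these leave
  \<open>place\<close> unchanged.\<close>

lemma sum_low_pairs:
  assumes x: "x \<in> S"
  shows "(\<Sum>i\<in>low_pos. \<Sum>j\<in>low_pos. h (Transposition.transpose i j \<circ> place x))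
    = (\<Sum>(i, j)\<in>small_pairs x. h (place (exchange x i j))) + real ((f n - g n)\<^sup>2) * h (place x)"
proof -
  let ?L = "low_pos \<inter> large_pos x"
  have "(\<Sum>i\<in>low_pos. \<Sum>j\<in>low_pos. h (Transposition.transpose i j \<circ> place x))
      = (\<Sum>(i, j)\<in>low_pos \<times> low_pos. h (place (exchange x i j)))"
    by (simp add: sum.cartesian_product case_prod_unfold) (intro sum.cong refl, auto simp: place_exchange[OF x])
  also have "\<dots> = (\<Sum>(i, j)\<in>small_pairs x. h (place (exchange x i j)))
      + (\<Sum>(i, j)\<in>?L \<times> ?L. h (place (exchange x i j)))"
    unfolding low_pairs_split(1)[OF x]
    by (rule sum.union_disjoint[OF finite_small_pairs _ low_pairs_split(2)[OF x]]) simp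
  also have "(\<Sum>(i, j)\<in>?L \<times> ?L. h (place (exchange x i j))) = (\<Sum>(i, j)\<in>?L \<times> ?L. h (place x))"
    by (intro sum.cong refl) (auto simp: place_exchange_large[OF x])
  also have "\<dots> = real ((f n - g n)\<^sup>2) * h (place x)"
    using card_low_large[OF x] by (simp only: case_prod_unfold sum_constant card_cartesian_product power2_eq_square)
  finally show ?thesis .
qed

lemma pairs_split: "real pairs = (real (n - g n))\<^sup>2 + (real (f n))\<^sup>2 - real ((f n - g n)\<^sup>2)"
  using g_le_f f_less pairs_real by (simp add: of_nat_diff)

text \<open>The places form a Markov chain of their own: exchanges of large values do not move them,
  and the remaining pairs act as transpositions of the \<open>f n\<close> sites.\<close>

lemma step_place:
  assumes x: "x \<in> S"
  shows "step (\<lambda>y. coord v (place y)) x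
    = coord (pos.walk_op (1 - (real (f n))\<^sup>2 / real pairs) (1 / real pairs) v) (place x)"
proof -
  have p: "real pairs > 0" using pairs_pos by simp
  have "(\<Sum>(i, j)\<in>large_pos x \<times> large_pos x. coord v (place (exchange x i j)))
      = (\<Sum>(i, j)\<in>large_pos x \<times> large_pos x. coord v (place x))"
    by (intro sum.cong refl) (auto simp: place_exchange_large[OF x])
  also have "\<dots> = (real (n - g n))\<^sup>2 * coord v (place x)"
    by (simp add: case_prod_unfold card_cartesian_product card_large_pos[OF x] power2_eq_square)
  finally have "real pairs * step (\<lambda>y. coord v (place y)) x
      = (real (n - g n))\<^sup>2 * coord v (place x) + (\<Sum>(i, j)\<in>small_pairs x. coord v (place (exchange x i j)))"
    using p by (simp add: step_split[OF x])
  also have "\<dots> = ((real (n - g n))\<^sup>2 - real ((f n - g n)\<^sup>2)) * coord v (place x)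
      + (\<Sum>i\<in>low_pos. \<Sum>j\<in>low_pos. coord v (Transposition.transpose i j \<circ> place x))"
    unfolding sum_low_pairs[OF x] by (simp add: algebra_simps)
  also have "(real (n - g n))\<^sup>2 - real ((f n - g n)\<^sup>2) = real pairs - (real (f n))\<^sup>2"
    using pairs_split by simp
  also have "(real pairs - (real (f n))\<^sup>2) * coord v (place x)
      + (\<Sum>i\<in>low_pos. \<Sum>j\<in>low_pos. coord v (Transposition.transpose i j \<circ> place x))
      = real pairs * coord (pos.walk_op (1 - (real (f n))\<^sup>2 / real pairs) (1 / real pairs) v) (place x)"
    unfolding pos.walk_op_def coord_simps coord_theta using p by (simp add: field_simps)
  finally show ?thesis using p by simp
qed

lemma steps_place:
  assumes x: "x \<in> S"
  shows "(step ^^ t) (\<lambda>y. coord v (place y)) x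
    = coord ((pos.walk_op (1 - (real (f n))\<^sup>2 / real pairs) (1 / real pairs) ^^ t) v) (place x)"
  using x
proof (induction t arbitrary: x)
  case (Suc t)
  have "(step ^^ Suc t) (\<lambda>y. coord v (place y)) x
      = step (\<lambda>y. coord ((pos.walk_op (1 - (real (f n))\<^sup>2 / real pairs) (1 / real pairs) ^^ t) v) (place y)) x"
    unfolding funpow.simps(2) o_apply by (rule step_cong) (rule Suc.IH)
  then show ?case unfolding step_place[OF Suc.prems] by simp
qed simp

end

section \<open>Upper bound on the chi-squared distance\<close>

context two_step_walk
begin

definition rstep :: "((nat \<Rightarrow> nat) \<Rightarrow> real) \<Rightarrow> (nat \<Rightarrow> nat) \<Rightarrow> real" where
  "rstep \<phi> x = (\<Sum>u\<in>large_val. \<Sum>v\<in>large_val. \<phi> (Transposition.transpose u v \<circ> x)) / (real (n - g n))\<^sup>2"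

definition qsum :: "((nat \<Rightarrow> nat) \<Rightarrow> real) \<Rightarrow> (nat \<Rightarrow> nat) \<Rightarrow> real" where
  "qsum \<phi> x = (\<Sum>(i, j)\<in>small_pairs x. \<phi> (exchange x i j))"

text \<open>The two parts of the walk: random transpositions of the large values, which act from the
  left, and exchanges of positions involving a small value, which act from the right. They
  commute.\<close>

definition full :: "((nat \<Rightarrow> nat) \<Rightarrow> real) \<Rightarrow> (nat \<Rightarrow> nat) \<Rightarrow> real" where
  "full \<phi> x = ((real (n - g n))\<^sup>2 * rstep \<phi> x + qsum \<phi> x) / real pairs"

lemma large_card_pos: "0 < real (n - g n)"
  using g_le_f f_less by simp

lemma step_eq_full:
  assumes x: "x \<in> S"
  shows "step \<phi> x = full \<phi> x"
proof -
  have inj: "inj x" using S_permutes[OF x] by (rule permutes_inj)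
  have "(\<Sum>(i, j)\<in>large_pos x \<times> large_pos x. \<phi> (exchange x i j))
      = (\<Sum>i\<in>large_pos x. \<Sum>j\<in>large_pos x. \<phi> (Transposition.transpose (x i) (x j) \<circ> x))"
    by (simp add: sum.cartesian_product exchange_eq_transpose_comp[OF inj])
  also have "\<dots> = (\<Sum>i\<in>large_pos x. \<Sum>v\<in>large_val. \<phi> (Transposition.transpose (x i) v \<circ> x))"
    by (intro sum.cong refl sum.reindex_bij_betw[OF bij_large[OF x]])
  also have "\<dots> = (\<Sum>u\<in>large_val. \<Sum>v\<in>large_val. \<phi> (Transposition.transpose u v \<circ> x))"
    by (rule sum.reindex_bij_betw[OF bij_large[OF x]])
  also have "\<dots> = (real (n - g n))\<^sup>2 * rstep \<phi> x"
    using large_card_pos by (simp add: rstep_def)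
  finally show ?thesis by (simp add: step_split[OF x] full_def qsum_def)
qed

lemma steps_eq_full: "x \<in> S \<Longrightarrow> (step ^^ t) \<phi> x = (full ^^ t) \<phi> x"
proof (induction t arbitrary: x)
  case (Suc t)
  have "(step ^^ Suc t) \<phi> x = step ((full ^^ t) \<phi>) x"
    unfolding funpow.simps(2) o_apply by (rule step_cong) (rule Suc.IH)
  then show ?case by (simp add: step_eq_full[OF Suc.prems])
qed simp

lemma small_pairs_large:
  assumes "u \<in> large_val" "v \<in> large_val"
  shows "small_pairs (Transposition.transpose u v \<circ> x) = small_pairs x"
proof -
  have "Transposition.transpose u v l \<le> g n \<longleftrightarrow> l \<le> g n" for l
    using assms by (simp add: Transposition.transpose_def)
  then show ?thesis by (simp add: small_pairs_def)
qed

lemma exchange_comp: "exchange (\<pi> \<circ> x) i j = \<pi> \<circ> exchange x i j"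
  by (simp add: exchange_def comp_assoc)

text \<open>Left and right composition commute, and exchanging two large values does not alter which
  positions hold small ones. The identity holds at all maps, also off \<open>S\<close>, and can
  therefore be iterated freely; \<open>full\<close> extends \<open>step\<close> for this
  purpose.\<close>

lemma rstep_qsum: "rstep (qsum \<phi>) = qsum (rstep \<phi>)"
proof
  fix x
  let ?c = "(real (n - g n))\<^sup>2"
  have "rstep (qsum \<phi>) x = (\<Sum>u\<in>large_val. \<Sum>v\<in>large_val. \<Sum>(i, j)\<in>small_pairs x.
      \<phi> (Transposition.transpose u v \<circ> exchange x i j)) / ?c"
    unfolding rstep_def qsum_def
    by (intro arg_cong2[of _ _ _ _ "(/)"] sum.cong refl) (simp_all add: small_pairs_large exchange_comp case_prod_unfold)
  also have "\<dots> = (\<Sum>(i, j)\<in>small_pairs x. \<Sum>u\<in>large_val. \<Sum>v\<in>large_val.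
      \<phi> (Transposition.transpose u v \<circ> exchange x i j)) / ?c"
    unfolding case_prod_unfold
    by (subst sum.swap[of _ "small_pairs x"], subst sum.swap[of _ "small_pairs x"]) (rule refl)
  also have "\<dots> = qsum (rstep \<phi>) x"
    by (simp add: qsum_def rstep_def sum_divide_distrib case_prod_unfold)
  finally show "rstep (qsum \<phi>) x = qsum (rstep \<phi>) x" .
qed

lemma rstep_full: "rstep (full \<phi>) = full (rstep \<phi>)"
proof
  fix x
  let ?c = "(real (n - g n))\<^sup>2"
  have "rstep (full \<phi>) x = (?c * rstep (rstep \<phi>) x + rstep (qsum \<phi>) x) / real pairs"
    unfolding rstep_def[of "full \<phi>"] full_def rstep_def[of "rstep \<phi>"] rstep_def[of "qsum \<phi>"]
    by (simp add: sum.distrib sum_distrib_left sum_divide_distrib add_divide_distrib mult.commute)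
  then show "rstep (full \<phi>) x = full (rstep \<phi>) x"
    by (simp add: full_def rstep_qsum)
qed

lemma rsteps_full: "(rstep ^^ k) (full \<phi>) = full ((rstep ^^ k) \<phi>)"
  by (induction k) (simp_all add: rstep_full)

text \<open>The part of the point mass orthogonal to the functions of the small values' places.\<close>

definition residual :: "(nat \<Rightarrow> nat) \<Rightarrow> (nat \<Rightarrow> nat) \<Rightarrow> real" where
  "residual x y = point x y - of_bool (place y = place x) / fact (n - g n)"

text \<open>The fibre of \<open>place\<close> through \<open>x\<close> is contained in a coset of
  the symmetric group of the large values, with coordinate \<open>y \<circ> inv x\<close>.\<close>

lemma same_place_factor:
  assumes x: "x \<in> S" and y: "y \<in> S" and eq: "place y = place x"
  shows "y \<circ> inv x \<in> vals.injections" and "y = (y \<circ> inv x) \<circ> x"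
proof -
  have px: "x permutes {1..n}" and py: "y permutes {1..n}" using S_permutes x y by auto
  have "y \<circ> inv x permutes {1..n}" by (rule permutes_compose[OF permutes_inv[OF px] py])
  moreover have "(y \<circ> inv x) l = l" if "l \<in> {1..n} - large_val" for l
  proof -
    have "l \<in> {1..g n}" using that by auto
    then have "inv x l = inv y l" using fun_cong[OF eq, of l] by (simp add: place_def)
    then show ?thesis by (simp add: permutes_inverses(1)[OF py])
  qed
  ultimately have "y \<circ> inv x permutes large_val"
    by (rule permutes_superset)
  then show "y \<circ> inv x \<in> vals.injections" unfolding vals.injections_eq by (simp only: mem_Collect_eq)
  show "y = (y \<circ> inv x) \<circ> x"
    by (rule ext) (simp add: permutes_inverses(2)[OF px])
qed

lemma card_large_val: "card large_val = n - g n"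
  by simp

text \<open>In the fibre coordinate \<open>w\<close> the left part is the random transposition walk
  on the large values, started at the identity.\<close>

lemma rsteps_point:
  assumes x: "x \<in> S" and w: "w \<in> vals.injections"
  shows "(rstep ^^ k) (point x) (w \<circ> x) = coord ((vals.rand_op ^^ k) (delta id)) w"
  using w
proof (induction k arbitrary: w)
  case 0
  have "w \<circ> x = x \<longleftrightarrow> w = id"
    using permutes_surj[OF S_permutes[OF x]] by (auto simp: fun_eq_iff surj_def) metis
  then show ?case
    unfolding funpow.simps(1) id_apply point_def coord_delta by (simp only: of_bool_def)
next
  case (Suc k)
  have "(rstep ^^ Suc k) (point x) (w \<circ> x)
      = (\<Sum>u\<in>large_val. \<Sum>v\<in>large_val. (rstep ^^ k) (point x) ((Transposition.transpose u v \<circ> w) \<circ> x)) / (real (n - g n))\<^sup>2"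
    by (simp add: rstep_def comp_assoc)
  also have "\<dots> = (\<Sum>u\<in>large_val. \<Sum>v\<in>large_val.
      coord ((vals.rand_op ^^ k) (delta id)) (Transposition.transpose u v \<circ> w)) / (real (n - g n))\<^sup>2"
    using Suc.prems by (intro arg_cong2[of _ _ _ _ "(/)"] sum.cong refl Suc.IH)
      (simp only: vals.swap_injections)
  also have "\<dots> = coord ((vals.rand_op ^^ Suc k) (delta id)) w"
  proof -
    have "vals.rand_op v = 0 *\<^sub>R v + (1 / (real (n - g n))\<^sup>2) *\<^sub>R swap.theta large_val v" for v
      by (simp only: vals.rand_op_def vals.walk_op_def card_large_val)
    moreover have "(vals.rand_op ^^ Suc k) v = vals.rand_op ((vals.rand_op ^^ k) v)" for v by simp
    ultimately show ?thesis by (simp only: coord_simps coord_theta mult_zero_left add_0 times_divide_eq_left mult_1)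
  qed
  finally show ?case .
qed

lemma rsteps_place:
  assumes y: "bij y"
  shows "(rstep ^^ k) (\<lambda>y. h (place y)) y = h (place y)"
  using y
proof (induction k arbitrary: y)
  case (Suc k)
  have "(rstep ^^ k) (\<lambda>y. h (place y)) (Transposition.transpose u v \<circ> y) = h (place y)"
    if "u \<in> large_val" "v \<in> large_val" for u v
  proof -
    have "bij (Transposition.transpose u v \<circ> y)" using Suc.prems by (intro bij_comp) auto
    from Suc.IH[OF this] show ?thesis unfolding place_large[OF Suc.prems that] .
  qed
  then have "(rstep ^^ Suc k) (\<lambda>y. h (place y)) y = (\<Sum>u\<in>large_val. \<Sum>v\<in>large_val. h (place y)) / (real (n - g n))\<^sup>2"
    by (simp add: rstep_def)
  also have "\<dots> = h (place y)" using large_card_pos by (simp add: power2_eq_square)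
  finally show ?case .
qed simp

lemma rsteps_point_other:
  assumes "bij y" "place y \<noteq> place x"
  shows "(rstep ^^ k) (point x) y = 0"
  using assms
proof (induction k arbitrary: y)
  case 0
  then show ?case by (auto simp: point_def)
next
  case (Suc k)
  have "(rstep ^^ k) (point x) (Transposition.transpose u v \<circ> y) = 0"
    if "u \<in> large_val" "v \<in> large_val" for u v
  proof -
    have "bij (Transposition.transpose u v \<circ> y)" using Suc.prems by (intro bij_comp) auto
    moreover have "place (Transposition.transpose u v \<circ> y) \<noteq> place x"
      unfolding place_large[OF Suc.prems(1) that] by (rule Suc.prems(2))
    ultimately show ?thesis by (rule Suc.IH)
  qed
  then have "rstep ((rstep ^^ k) (point x)) y = 0"
    unfolding rstep_def[of "(rstep ^^ k) (point x)"] by simp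
  then show ?case by simp
qed

lemma rstep_diff: "rstep (\<lambda>y. \<phi> y - \<psi> y) = (\<lambda>y. rstep \<phi> y - rstep \<psi> y)"
  by (simp add: rstep_def fun_eq_iff sum_subtractf diff_divide_distrib)

lemma rsteps_diff: "(rstep ^^ k) (\<lambda>y. \<phi> y - \<psi> y) = (\<lambda>y. (rstep ^^ k) \<phi> y - (rstep ^^ k) \<psi> y)"
  by (induction k) (simp_all add: rstep_diff)

text \<open>On the fibre of \<open>x\<close> this is the pointwise mixing bound. Off that fibre both
  the point mass and its fibre average vanish, and left moves never leave a fibre.\<close>

lemma rsteps_residual:
  assumes x: "x \<in> S" and y: "y \<in> S" and M: "12 \<le> n - g n"
  shows "fact (n - g n) * \<bar>(rstep ^^ k) (residual x) y\<bar> \<le> of_bool (place y = place x) * (2 * vals.mixing_sum k)"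
proof -
  have bijy: "bij y" using S_permutes[OF y] by (rule permutes_bij)
  have eq: "(rstep ^^ k) (residual x) y = (rstep ^^ k) (point x) y - of_bool (place y = place x) / fact (n - g n)"
    unfolding residual_def[abs_def] rsteps_diff
    by (subst rsteps_place[OF bijy, of k "\<lambda>p. of_bool (p = place x) / fact (n - g n)"]) simp
  show ?thesis
  proof (cases "place y = place x")
    case True
    note w = same_place_factor[OF x y True]
    have "(rstep ^^ k) (point x) y = coord ((vals.rand_op ^^ k) (delta id)) (y \<circ> inv x)"
      using rsteps_point[OF x w(1), of k] w(2) by simp
    moreover have "id \<in> vals.injections" unfolding vals.injections_eq by (intro CollectI permutes_id)
    moreover have "12 \<le> card large_val" using M by (simp only: card_large_val)
    ultimately show ?thesis
      using vals.rand_op_pointwise[of id "y \<circ> inv x" k] w(1) True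
      unfolding eq by (simp only: card_large_val of_bool_eq mult_1 simp_thms)
  next
    case False
    then show ?thesis unfolding eq using rsteps_point_other[OF bijy False] by simp
  qed
qed

text \<open>The total weight of one step after every left step has been replaced by the scalar
  \<theta>.\<close>

definition tilt :: "real \<Rightarrow> real" where
  "tilt \<theta> = 1 - (real (n - g n))\<^sup>2 / real pairs * (1 - \<theta>)"

definition tilted :: "real \<Rightarrow> (nat \<Rightarrow> nat) fsv \<Rightarrow> (nat \<Rightarrow> nat) fsv" where
  "tilted \<theta> = pos.walk_op (tilt \<theta> - 1 / real pairs * (real (f n))\<^sup>2) (1 / real pairs)"

lemma coord_tilted:
  assumes y: "y \<in> S"
  shows "coord (tilted \<theta> v) (place y)
    = ((real (n - g n))\<^sup>2 * \<theta> * coord v (place y) + qsum (\<lambda>y. coord v (place y)) y) / real pairs"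
proof -
  have p: "real pairs > 0" using pairs_pos by simp
  have "coord (tilted \<theta> v) (place y) = (tilt \<theta> - (real (f n))\<^sup>2 / real pairs) * coord v (place y)
      + (\<Sum>i\<in>low_pos. \<Sum>j\<in>low_pos. coord v (Transposition.transpose i j \<circ> place y)) / real pairs"
    unfolding tilted_def pos.walk_op_def coord_simps coord_theta by simp
  also have "\<dots> = (tilt \<theta> - (real (f n))\<^sup>2 / real pairs + real ((f n - g n)\<^sup>2) / real pairs) * coord v (place y)
      + qsum (\<lambda>y. coord v (place y)) y / real pairs"
    unfolding sum_low_pairs[OF y] qsum_def by (simp add: algebra_simps add_divide_distrib)
  also have "tilt \<theta> - (real (f n))\<^sup>2 / real pairs + real ((f n - g n)\<^sup>2) / real pairs
      = (real (n - g n))\<^sup>2 * \<theta> / real pairs"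
  proof -
    have "tilt \<theta> * real pairs = real pairs - (real (n - g n))\<^sup>2 * (1 - \<theta>)"
      using p by (simp add: tilt_def left_diff_distrib)
    also have "\<dots> = real pairs - (real (n - g n))\<^sup>2 + (real (n - g n))\<^sup>2 * \<theta>"
      by (simp add: right_diff_distrib)
    finally have "tilt \<theta> * real pairs = real pairs - (real (n - g n))\<^sup>2 + (real (n - g n))\<^sup>2 * \<theta>" .
    then have "tilt \<theta> * real pairs - (real (f n))\<^sup>2 + real ((f n - g n)\<^sup>2) = (real (n - g n))\<^sup>2 * \<theta>"
      using pairs_split by linarith
    then show ?thesis using p by (simp add: field_simps)
  qed
  finally show ?thesis by (simp add: add_divide_distrib)
qed

text \<open>Writes \<open>2 * mixing_sum\<close> as a single sum. Its levels start at 1, so slot 0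
  is free to hold the remainder with the factorial; 2 and 6 are the doubled coefficients 1 and
  3.\<close>

definition weight :: "nat \<Rightarrow> real" where
  "weight i = (if i = 0 then 2 * fact (n - g n) else 6 * real (((n - g n) * (n - g n)) choose i))"

definition ratio :: "nat \<Rightarrow> real" where
  "ratio i = (if i = 0 then 1 - real ((n - g n) div 2) / real (n - g n) else 1 - real i / real (n - g n))"

lemma mixing_sum_eq: "2 * vals.mixing_sum k = (\<Sum>i\<le>(n - g n) div 2. weight i * ratio i ^ k)"
proof -
  have "{..(n - g n) div 2} = insert 0 {1..(n - g n) div 2}" by auto
  moreover have "(\<Sum>i=1..(n - g n) div 2. weight i * ratio i ^ k)
      = 6 * (\<Sum>i=1..(n - g n) div 2. real (((n - g n) * (n - g n)) choose i) * (1 - real i / real (n - g n)) ^ k)"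
    unfolding sum_distrib_left by (intro sum.cong refl) (simp add: weight_def ratio_def)
  ultimately show ?thesis
    unfolding vals.mixing_sum_def card_large_val by (simp add: weight_def ratio_def)
qed

lemma weight_nonneg: "0 \<le> weight i"
  by (simp add: weight_def)

lemma ratio_bounds: "i \<le> (n - g n) div 2 \<Longrightarrow> 1 / 2 \<le> ratio i \<and> ratio i \<le> 1"
proof -
  assume i: "i \<le> (n - g n) div 2"
  then have "2 * real i \<le> real (n - g n)" "2 * real ((n - g n) div 2) \<le> real (n - g n)" by linarith+
  then show ?thesis using large_card_pos by (simp add: ratio_def field_simps)
qed

text \<open>Trading a left step for the factor \<open>ratio i\<close> turns the walk into a tilted walk on the places
  of the small values.\<close>

lemma residual_bound:
  assumes x: "x \<in> S" and M: "12 \<le> n - g n" and y: "y \<in> S"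
  shows "fact (n - g n) * \<bar>(rstep ^^ k) ((full ^^ t) (residual x)) y\<bar>
    \<le> (\<Sum>i\<le>(n - g n) div 2. weight i * ratio i ^ k * coord ((tilted (ratio i) ^^ t) (delta (place x))) (place y))"
  using y
proof (induction t arbitrary: k y)
  case 0
  have "fact (n - g n) * \<bar>(rstep ^^ k) (residual x) y\<bar> \<le> of_bool (place y = place x) * (2 * vals.mixing_sum k)"
    by (rule rsteps_residual[OF x 0 M])
  also have "\<dots> = (\<Sum>i\<le>(n - g n) div 2. weight i * ratio i ^ k * coord (delta (place x)) (place y))"
    unfolding mixing_sum_eq coord_delta by simp
  finally show ?case by simp
next
  case (Suc t)
  have p: "real pairs > 0" using pairs_pos by simp
  let ?c = "(real (n - g n))\<^sup>2" and ?I = "{..(n - g n) div 2}"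
  let ?\<phi> = "(full ^^ t) (residual x)"
  let ?H = "\<lambda>i. coord ((tilted (ratio i) ^^ t) (delta (place x)))"
  have ex: "exchange y i j \<in> S" if "(i, j) \<in> small_pairs y" for i j
  proof -
    have "(i, j) \<in> admissible_pairs n M y" using that admissible_pairs_eq(1)[OF Suc.prems] by blast
    then show ?thesis by (rule admissible_in_S)
  qed
  \<comment> \<open>The power of \<open>rstep\<close> passes through \<open>full\<close>: a left
    move raises \<open>k\<close> by one, a right move keeps it. This is why the induction on
    \<open>t\<close> runs over all \<open>k\<close> at once.\<close>
  have eq: "(rstep ^^ k) ((full ^^ Suc t) (residual x)) y = (?c * (rstep ^^ Suc k) ?\<phi> y + qsum ((rstep ^^ k) ?\<phi>) y) / real pairs"
    by (simp add: rsteps_full full_def)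
  have "\<bar>(rstep ^^ k) ((full ^^ Suc t) (residual x)) y\<bar>
      = \<bar>?c * (rstep ^^ Suc k) ?\<phi> y + qsum ((rstep ^^ k) ?\<phi>) y\<bar> / real pairs"
    unfolding eq by simp
  also have "\<dots> \<le> (?c * \<bar>(rstep ^^ Suc k) ?\<phi> y\<bar> + (\<Sum>(i, j)\<in>small_pairs y. \<bar>(rstep ^^ k) ?\<phi> (exchange y i j)\<bar>)) / real pairs"
  proof (intro divide_right_mono order_trans[OF abs_triangle_ineq] add_mono)
    show "\<bar>qsum ((rstep ^^ k) ?\<phi>) y\<bar> \<le> (\<Sum>(i, j)\<in>small_pairs y. \<bar>(rstep ^^ k) ?\<phi> (exchange y i j)\<bar>)"
      unfolding qsum_def case_prod_unfold by (rule sum_abs)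
  qed (simp_all add: abs_mult)
  finally have "fact (n - g n) * \<bar>(rstep ^^ k) ((full ^^ Suc t) (residual x)) y\<bar>
      \<le> fact (n - g n) * ((?c * \<bar>(rstep ^^ Suc k) ?\<phi> y\<bar> + (\<Sum>(i, j)\<in>small_pairs y. \<bar>(rstep ^^ k) ?\<phi> (exchange y i j)\<bar>)) / real pairs)"
    by (rule mult_left_mono) simp
  also have "\<dots> = (?c * (fact (n - g n) * \<bar>(rstep ^^ Suc k) ?\<phi> y\<bar>)
      + (\<Sum>(i, j)\<in>small_pairs y. fact (n - g n) * \<bar>(rstep ^^ k) ?\<phi> (exchange y i j)\<bar>)) / real pairs"
    by (simp add: algebra_simps sum_distrib_left case_prod_unfold add_divide_distrib)
  also have "\<dots> \<le> (?c * (\<Sum>i\<in>?I. weight i * ratio i ^ Suc k * ?H i (place y))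
      + (\<Sum>(i, j)\<in>small_pairs y. \<Sum>l\<in>?I. weight l * ratio l ^ k * ?H l (place (exchange y i j)))) / real pairs"
  proof (intro divide_right_mono add_mono mult_left_mono sum_mono)
    show "fact (n - g n) * \<bar>(rstep ^^ Suc k) ?\<phi> y\<bar> \<le> (\<Sum>i\<in>?I. weight i * ratio i ^ Suc k * ?H i (place y))"
      by (rule Suc.IH[OF Suc.prems])
    show "(case a of (i, j) \<Rightarrow> fact (n - g n) * \<bar>(rstep ^^ k) ?\<phi> (exchange y i j)\<bar>)
        \<le> (case a of (i, j) \<Rightarrow> \<Sum>l\<in>?I. weight l * ratio l ^ k * ?H l (place (exchange y i j)))"
      if "a \<in> small_pairs y" for a
      using that by (cases a) (auto intro: Suc.IH[OF ex])
  qed (use p in simp_all)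
  also have "(\<Sum>(i, j)\<in>small_pairs y. \<Sum>l\<in>?I. weight l * ratio l ^ k * ?H l (place (exchange y i j)))
      = (\<Sum>l\<in>?I. weight l * ratio l ^ k * qsum (\<lambda>y. ?H l (place y)) y)"
    unfolding qsum_def case_prod_unfold by (subst sum.swap) (simp add: sum_distrib_left)
  also have "(?c * (\<Sum>i\<in>?I. weight i * ratio i ^ Suc k * ?H i (place y))
      + (\<Sum>l\<in>?I. weight l * ratio l ^ k * qsum (\<lambda>y. ?H l (place y)) y)) / real pairs
      = (\<Sum>i\<in>?I. weight i * ratio i ^ k * coord (tilted (ratio i) ((tilted (ratio i) ^^ t) (delta (place x)))) (place y))"
    unfolding coord_tilted[OF Suc.prems]
    by (simp add: sum_distrib_left sum.distrib[symmetric] sum_divide_distrib algebra_simps)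
  finally show ?case by simp
qed

lemma card_S_le: "card S \<le> card pos.injections * fact (n - g n)"
proof -
  have "card S = (\<Sum>s\<in>place ` S. card {y \<in> S. place y = s})"
    using sum.image_gen[OF finite_S, of "\<lambda>_. 1 :: nat" place] by simp
  also have "\<dots> \<le> (\<Sum>s\<in>place ` S. fact (n - g n))"
  proof (intro sum_mono)
    fix s assume "s \<in> place ` S"
    then obtain x where x: "x \<in> S" "s = place x" by auto
    have "inj_on (\<lambda>y. y \<circ> inv x) {y \<in> S. place y = s}"
    proof (rule inj_onI)
      fix y y' assume y: "y \<in> {y \<in> S. place y = s}" "y' \<in> {y \<in> S. place y = s}"
        and eq: "y \<circ> inv x = y' \<circ> inv x"
      have "y = (y \<circ> inv x) \<circ> x" by (rule same_place_factor(2)) (use x y in auto)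
      also have "\<dots> = (y' \<circ> inv x) \<circ> x" by (simp only: eq)
      also have "\<dots> = y'" by (rule same_place_factor(2)[symmetric]) (use x y in auto)
      finally show "y = y'" .
    qed
    moreover have "(\<lambda>y. y \<circ> inv x) ` {y \<in> S. place y = s} \<subseteq> vals.injections"
      using same_place_factor(1) x by blast
    ultimately have "card {y \<in> S. place y = s} \<le> card vals.injections"
      using vals.finite_injections by (rule card_inj_on_le)
    also have "\<dots> = fact (n - g n)" by (simp only: vals.card_injections card_large_val)
    finally show "card {y \<in> S. place y = s} \<le> fact (n - g n)" .
  qed
  also have "\<dots> = card (place ` S) * fact (n - g n)" by simp
  also have "\<dots> \<le> card pos.injections * fact (n - g n)"
    using card_mono[OF pos.finite_injections, of "place ` S"] place_injections by (intro mult_right_mono) auto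
  finally show ?thesis .
qed

text \<open>Bounds the trace of the \<open>2 t\<close>-th power of the walk on places. The term
  \<open>j = 0\<close> is 1 and belongs to the constant function.\<close>

definition level_sum :: "nat \<Rightarrow> real" where
  "level_sum t = (\<Sum>j\<le>g n. real ((g n * f n) choose j) * pos.level_rate (1 / real pairs) j ^ (2 * t))"

lemma tilted_return:
  assumes x: "x \<in> S" and \<theta>: "1 / 2 \<le> \<theta>" "\<theta> \<le> 1" and F: "4 * (real (f n))\<^sup>2 \<le> real pairs"
  shows "real (card pos.injections) * coord ((tilted \<theta> ^^ (2 * t)) (delta (place x))) (place x)
      \<le> tilt \<theta> ^ (2 * t) * level_sum t"
    and "0 \<le> coord ((tilted \<theta> ^^ (2 * t)) (delta (place x))) (place x)"
proof -
  have p: "real pairs > 0" using pairs_pos by simp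
  have a: "(real (n - g n))\<^sup>2 / real pairs \<le> 1"
  proof -
    have "real ((f n - g n)\<^sup>2) \<le> real ((f n)\<^sup>2)" by (intro of_nat_mono power_mono) auto
    then show ?thesis using p pairs_split by simp
  qed
  \<comment> \<open>Ratios of at least \<open>1 / 2\<close> keep the tilt at or above
    \<open>1 / 2\<close>; with \<open>4 F^2 \<le> N\<close> this is the lower bound on \<alpha> that
    \<open>return_bound\<close> asks for.\<close>
  have "(real (n - g n))\<^sup>2 / real pairs * (1 - \<theta>) \<le> 1 * (1 / 2)"
    using a \<theta> by (intro mult_mono) auto
  then have t1: "1 / 2 \<le> tilt \<theta>" by (simp add: tilt_def)
  have "0 \<le> (real (n - g n))\<^sup>2 / real pairs * (1 - \<theta>)" using \<theta> by simp
  then have t2: "tilt \<theta> \<le> 1" by (simp add: tilt_def)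
  have "2 * (1 / real pairs) * (real (card low_pos))\<^sup>2 \<le> 1 / 2" using F p by (simp add: field_simps)
  then have *: "2 * (1 / real pairs) * (real (card low_pos))\<^sup>2 \<le> tilt \<theta>" using t1 by linarith
  have b: "0 \<le> 1 / real pairs" by simp
  show "real (card pos.injections) * coord ((tilted \<theta> ^^ (2 * t)) (delta (place x))) (place x)
      \<le> tilt \<theta> ^ (2 * t) * level_sum t"
    using pos.return_bound[OF place_injections[OF x] b t2 *, of t]
    unfolding tilted_def level_sum_def by simp
  have sym: "symmetric_op (tilted \<theta> ^^ t)"
    unfolding tilted_def by (intro symmetric_op_funpow pos.walk_op_symmetric)
  have "coord ((tilted \<theta> ^^ (2 * t)) (delta (place x))) (place x)
      = (tilted \<theta> ^^ t) (delta (place x)) \<bullet> (tilted \<theta> ^^ t) (delta (place x))"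
    using symmetric_opD(2)[OF sym] by (simp add: mult_2 funpow_add inner_delta[symmetric])
  then show "0 \<le> coord ((tilted \<theta> ^^ (2 * t)) (delta (place x))) (place x)" by simp
qed

lemma full_add_place:
  assumes x: "x \<in> S" and y: "y \<in> S"
  shows "(full ^^ t) (point x) y
    = coord ((tilted 1 ^^ t) (delta (place x))) (place y) / fact (n - g n) + (full ^^ t) (residual x) y"
proof -
  have step_add: "(step ^^ t) (\<lambda>y. \<phi> y / c + \<psi> y) y = (step ^^ t) \<phi> y / c + (step ^^ t) \<psi> y"
    for t \<phi> \<psi> y and c :: real
  proof (induction t arbitrary: y)
    case (Suc t)
    have "(step ^^ Suc t) (\<lambda>y. \<phi> y / c + \<psi> y) y = step (\<lambda>y. (step ^^ t) \<phi> y / c + (step ^^ t) \<psi> y) y"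
      unfolding funpow.simps(2) o_apply by (rule arg_cong[of _ _ "\<lambda>h. step h y"], rule ext, rule Suc.IH)
    also have "\<dots> = (step ^^ Suc t) \<phi> y / c + (step ^^ Suc t) \<psi> y"
      by (simp add: step_def case_prod_unfold sum.distrib sum_divide_distrib add_divide_distrib mult.commute)
    finally show ?case .
  qed simp
  have W: "tilted 1 = pos.walk_op (1 - (real (f n))\<^sup>2 / real pairs) (1 / real pairs)"
    unfolding tilted_def tilt_def by simp
  have "point x = (\<lambda>y. coord (delta (place x)) (place y) / fact (n - g n) + residual x y)"
    by (simp add: residual_def coord_delta fun_eq_iff of_bool_def)
  then have "(step ^^ t) (point x) y
      = (step ^^ t) (\<lambda>y. coord (delta (place x)) (place y)) y / fact (n - g n) + (step ^^ t) (residual x) y"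
    using step_add[of t "\<lambda>y. coord (delta (place x)) (place y)" "fact (n - g n)" "residual x" y] by simp
  then show ?thesis
    unfolding steps_eq_full[OF y, symmetric] W steps_place[OF y] .
qed

text \<open>The two contributions follow the splitting of the point mass. The fibre average gives
  the walk on places, with 1 removed for the constant function. The residual gives the same level
  sum once more, multiplied by the tilt powers in which the mixing of the large values is
  stored.\<close>

theorem chi2_upper:
  assumes x: "x \<in> S" and M: "12 \<le> n - g n" and F: "4 * (real (f n))\<^sup>2 \<le> real pairs"
  shows "(walk_chi2 n M t x)\<^sup>2 \<le> level_sum t - 1
    + (\<Sum>i\<le>(n - g n) div 2. weight i * tilt (ratio i) ^ (2 * t)) * level_sum t"
proof -
  let ?I = "{..(n - g n) div 2}" and ?X = "real (card pos.injections)"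
  let ?H = "\<lambda>\<theta>. coord ((tilted \<theta> ^^ (2 * t)) (delta (place x))) (place x)"
  let ?fact = "fact (n - g n) :: real"
  have "fact (n - g n) * (full ^^ (2 * t)) (residual x) x \<le> (\<Sum>i\<in>?I. weight i * ?H (ratio i))"
    using residual_bound[OF x M x, of 0 "2 * t"] by (auto intro: order_trans[OF mult_left_mono[OF abs_ge_self]])
  then have "?fact * (full ^^ (2 * t)) (point x) x \<le> ?H 1 + (\<Sum>i\<in>?I. weight i * ?H (ratio i))"
    by (simp add: full_add_place[OF x x] distrib_left)
  then have ub: "(full ^^ (2 * t)) (point x) x \<le> (?H 1 + (\<Sum>i\<in>?I. weight i * ?H (ratio i))) / ?fact"
    by (simp add: pos_le_divide_eq mult.commute)
  have nn: "0 \<le> ?H 1 + (\<Sum>i\<in>?I. weight i * ?H (ratio i))"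
    using tilted_return(2)[OF x _ _ F] ratio_bounds weight_nonneg
    by (intro add_nonneg_nonneg sum_nonneg mult_nonneg_nonneg) auto
  have "real (card S) * (full ^^ (2 * t)) (point x) x
      \<le> real (card S) * ((?H 1 + (\<Sum>i\<in>?I. weight i * ?H (ratio i))) / ?fact)"
    using ub by (intro mult_left_mono) auto
  also have "\<dots> \<le> (?X * ?fact) * ((?H 1 + (\<Sum>i\<in>?I. weight i * ?H (ratio i))) / ?fact)"
  proof (intro mult_right_mono)
    have "real (card S) \<le> real (card pos.injections * fact (n - g n))" using card_S_le by (rule of_nat_mono)
    then show "real (card S) \<le> ?X * ?fact" by simp
    show "0 \<le> (?H 1 + (\<Sum>i\<in>?I. weight i * ?H (ratio i))) / ?fact" using nn by simp
  qed
  also have "\<dots> = ?X * ?H 1 + (\<Sum>i\<in>?I. weight i * (?X * ?H (ratio i)))"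
  proof -
    have "(X * F) * (Z / F) = X * Z" if "F \<noteq> 0" for X F Z :: real using that by simp
    then have "(?X * ?fact) * ((?H 1 + (\<Sum>i\<in>?I. weight i * ?H (ratio i))) / ?fact)
        = ?X * (?H 1 + (\<Sum>i\<in>?I. weight i * ?H (ratio i)))" by simp
    then show ?thesis by (simp only: distrib_left sum_distrib_left mult.left_commute[of ?X])
  qed
  also have "\<dots> \<le> level_sum t + (\<Sum>i\<in>?I. weight i * (tilt (ratio i) ^ (2 * t) * level_sum t))"
  proof (intro add_mono sum_mono mult_left_mono weight_nonneg)
    show "?X * ?H 1 \<le> level_sum t" using tilted_return(1)[OF x _ _ F, of 1 t] by (simp add: tilt_def)
    show "?X * ?H (ratio i) \<le> tilt (ratio i) ^ (2 * t) * level_sum t" if "i \<in> ?I" for i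
      using tilted_return(1)[OF x _ _ F, of "ratio i" t] ratio_bounds[of i] that by simp
  qed
  also have "\<dots> = level_sum t + (\<Sum>i\<in>?I. weight i * tilt (ratio i) ^ (2 * t)) * level_sum t"
    by (simp add: sum_distrib_right mult.assoc)
  finally show ?thesis using x by (simp add: chi2_eq_return steps_eq_full)
qed

end

section \<open>Lower bound on the chi-squared distance\<close>

context injection_space
begin

lemma theta_cylinder_0:
  "swap.theta A (cylinder {}) = (real (card A))\<^sup>2 *\<^sub>R cylinder {}"
  using theta_cylinder[of "{}" 0] by (simp add: level_def)

lemma theta_cylinder_1:
  assumes "k \<in> K" "p \<in> A"
  shows "swap.theta A (cylinder {(k, p)})
    = ((real (card A))\<^sup>2 - 2 * real (card A)) *\<^sub>R cylinder {(k, p)} + 2 *\<^sub>R cylinder {}"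
proof -
  have "1 \<le> card A" using assms finite_A card_gt_0_iff[of A] by force
  moreover have "{(k, p)} \<in> level 1" using assms by (simp add: level_def)
  ultimately have "swap.theta A (cylinder {(k, p)}) = ((real (card A) - 1)\<^sup>2 - 2) *\<^sub>R cylinder {(k, p)}
      + swap_op p p (cylinder {(k, p)}) + 2 *\<^sub>R cylinder {}"
    using theta_cylinder[of "{(k, p)}" 1] by simp
  also have "swap_op p p (cylinder {(k, p)}) = 1 *\<^sub>R cylinder {(k, p)}" by (simp only: swap_op_same scaleR_one)
  also have "((real (card A) - 1)\<^sup>2 - 2) *\<^sub>R cylinder {(k, p)} + 1 *\<^sub>R cylinder {(k, p)}
      = (((real (card A) - 1)\<^sup>2 - 2) + 1) *\<^sub>R cylinder {(k, p)}" by (simp only: scaleR_left_distrib)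
  also have "((real (card A) - 1)\<^sup>2 - 2) + 1 = (real (card A))\<^sup>2 - 2 * real (card A)"
    by (simp add: power2_eq_square algebra_simps)
  finally show ?thesis .
qed

text \<open>The number of agreements with \<open>s\<close> minus its mean. Under
  \<open>theta\<close> an indicator of one coordinate produces a constant; subtracting the mean
  cancels these constants and leaves an eigenvector.\<close>

definition match_vec :: "('k \<Rightarrow> 'p) \<Rightarrow> ('k \<Rightarrow> 'p) fsv" where
  "match_vec s = (\<Sum>k\<in>K. cylinder {(k, s k)}) - (real (card K) / real (card A)) *\<^sub>R cylinder {}"

lemma walk_op_match_vec:
  assumes s: "s \<in> injections" and A: "A \<noteq> {}"
  shows "walk_op a b (match_vec s) = (a + b * ((real (card A))\<^sup>2 - 2 * real (card A))) *\<^sub>R match_vec s"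
proof -
  interpret L: linear "swap.theta A :: ('k \<Rightarrow> 'p) fsv \<Rightarrow> _"
    by (rule symmetric_opD(1)[OF swap.theta_symmetric])
  let ?F = "real (card A)" and ?G = "real (card K)"
  have F: "?F > 0" using A finite_A by (simp add: card_gt_0_iff)
  have sA: "s k \<in> A" if "k \<in> K" for k using s that by (auto simp: injections_def)
  have "swap.theta A (match_vec s) = (\<Sum>k\<in>K. (?F\<^sup>2 - 2 * ?F) *\<^sub>R cylinder {(k, s k)} + 2 *\<^sub>R cylinder {})
      - (?G / ?F) *\<^sub>R ?F\<^sup>2 *\<^sub>R cylinder {}"
    by (simp add: match_vec_def L.diff L.sum L.scale theta_cylinder_0 theta_cylinder_1 sA)
  also have "\<dots> = (?F\<^sup>2 - 2 * ?F) *\<^sub>R (\<Sum>k\<in>K. cylinder {(k, s k)}) + (2 * ?G - ?G * ?F) *\<^sub>R cylinder {}"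
    using F by (simp add: sum.distrib scaleR_sum_right sum_constant_scaleR power2_eq_square scaleR_left_diff_distrib mult.commute)
  also have "\<dots> = (?F\<^sup>2 - 2 * ?F) *\<^sub>R match_vec s"
  proof -
    have "2 * ?G - ?G * ?F = - ((?F\<^sup>2 - 2 * ?F) * (?G / ?F))"
      using F by (simp add: power2_eq_square field_simps)
    then show ?thesis
      by (simp only: match_vec_def scaleR_right_diff_distrib scaleR_scaleR scaleR_minus_left add_uminus_conv_diff)
  qed
  finally show ?thesis by (simp add: walk_op_def scaleR_left_distrib)
qed

lemma coord_match_vec:
  assumes "u \<in> injections"
  shows "coord (match_vec s) u = (\<Sum>k\<in>K. of_bool (u k = s k)) - real (card K) / real (card A)"
  using assms by (simp add: match_vec_def coord_cylinder)

end

context two_step_walk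
begin

definition matches :: "(nat \<Rightarrow> nat) \<Rightarrow> (nat \<Rightarrow> nat) \<Rightarrow> real" where
  "matches x y = (\<Sum>k\<in>{1..g n}. of_bool (place y k = place x k))"

definition stat :: "(nat \<Rightarrow> nat) \<Rightarrow> (nat \<Rightarrow> nat) \<Rightarrow> real" where
  "stat x y = matches x y - real (g n) / real (f n)"

definition eigval :: real where
  "eigval = 1 - 2 * real (f n) / real pairs"

lemma f_pos: "0 < real (f n)"
  using g_ge1 g_le_f by simp

lemma step_stat:
  assumes x: "x \<in> S" and y: "y \<in> S"
  shows "step (stat x) y = eigval * stat x y"
proof -
  have st: "stat x w = coord (pos.match_vec (place x)) (place w)" if "w \<in> S" for w
    unfolding stat_def matches_def pos.coord_match_vec[OF place_injections[OF that]] by simp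
  have "low_pos \<noteq> {}" using g_ge1 g_le_f by auto
  note walk = pos.walk_op_match_vec[OF place_injections[OF x] this]
  have "step (stat x) y = step (\<lambda>w. coord (pos.match_vec (place x)) (place w)) y"
    by (rule step_cong) (rule st)
  also have "\<dots> = ((1 - (real (f n))\<^sup>2 / real pairs) + (1 / real pairs) * ((real (f n))\<^sup>2 - 2 * real (f n))) * stat x y"
    unfolding step_place[OF y] walk coord_simps st[OF y] by simp
  also have "(1 - (real (f n))\<^sup>2 / real pairs) + (1 / real pairs) * ((real (f n))\<^sup>2 - 2 * real (f n)) = eigval"
    by (simp add: eigval_def diff_divide_distrib)
  finally show ?thesis .
qed

lemma steps_stat:
  assumes x: "x \<in> S" and y: "y \<in> S"
  shows "(step ^^ t) (stat x) y = eigval ^ t * stat x y"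
  using y
proof (induction t arbitrary: y)
  case (Suc t)
  have "(step ^^ Suc t) (stat x) y = step (\<lambda>w. eigval ^ t * stat x w) y"
    unfolding funpow.simps(2) o_apply by (rule step_cong) (rule Suc.IH)
  also have "\<dots> = eigval ^ t * step (stat x) y"
    by (simp add: step_def sum_distrib_left case_prod_unfold)
  finally show ?case using step_stat[OF x Suc.prems] by simp
qed simp

text \<open>By reversibility an eigenfunction with eigenvalue other than 1 has mean zero.\<close>

lemma sum_stat:
  assumes x: "x \<in> S"
  shows "(\<Sum>y\<in>S. stat x y) = 0"
proof -
  have "(\<Sum>y\<in>S. 1 * step (stat x) y) = (\<Sum>y\<in>S. step (\<lambda>_. 1) y * stat x y)" by (rule step_symmetric)
  then have "eigval * (\<Sum>y\<in>S. stat x y) = (\<Sum>y\<in>S. stat x y)"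
    by (simp add: step_stat[OF x] step_const sum_distrib_left)
  moreover have "eigval \<noteq> 1" using f_pos pairs_pos by (simp add: eigval_def)
  ultimately show ?thesis by simp
qed

lemma stat_self: "x \<in> S \<Longrightarrow> stat x x = real (g n) - real (g n) / real (f n)"
  by (simp add: stat_def matches_def)

lemma exchange_low_in_S:
  assumes "y \<in> S" "p \<in> low_pos" "q \<in> low_pos"
  shows "exchange y p q \<in> S"
proof -
  have "p \<in> {1..n}" "q \<in> {1..n}" using assms f_less by auto
  then show ?thesis using exchange_in_S[OF assms(1)] assms by blast
qed

lemma sum_S_exchange:
  assumes "p \<in> low_pos" "q \<in> low_pos"
  shows "(\<Sum>y\<in>S. h (place y)) = (\<Sum>y\<in>S. h (Transposition.transpose p q \<circ> place y))"
  by (rule sum.reindex_bij_witness[of _ "\<lambda>y. exchange y p q" "\<lambda>y. exchange y p q"])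
    (use assms in \<open>auto simp: exchange_exchange exchange_low_in_S place_exchange[symmetric]\<close>)

lemma place_low: "y \<in> S \<Longrightarrow> k \<in> {1..g n} \<Longrightarrow> place y k \<in> low_pos"
  using place_injections[of y] unfolding pos.injections_def by blast

lemma inj_on_place: "y \<in> S \<Longrightarrow> inj_on (place y) {1..g n}"
  using place_injections[of y] unfolding pos.injections_def by blast

text \<open>Exchanging two low positions is a bijection of \<open>S\<close>, so a small value is
  equally likely at each of the \<open>f n\<close> sites.\<close>

lemma card_match_one:
  assumes k: "k \<in> {1..g n}" and p: "p \<in> low_pos"
  shows "real (f n) * (\<Sum>y\<in>S. of_bool (place y k = p)) = real (card S)"
proof -
  have eq: "(\<Sum>y\<in>S. of_bool (place y k = q) :: real) = (\<Sum>y\<in>S. of_bool (place y k = p))"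
    if q: "q \<in> low_pos" for q
  proof -
    have "Transposition.transpose p q l = q \<longleftrightarrow> l = p" for l
      by (auto simp: Transposition.transpose_def)
    then show ?thesis using sum_S_exchange[OF p q, of "\<lambda>s. of_bool (s k = q)"] by simp
  qed
  have "(\<Sum>q\<in>low_pos. \<Sum>y\<in>S. of_bool (place y k = q) :: real) = (\<Sum>y\<in>S. \<Sum>q\<in>low_pos. of_bool (place y k = q))"
    by (rule sum.swap)
  also have "\<dots> = (\<Sum>y\<in>S. 1)"
  proof (intro sum.cong refl)
    fix y assume "y \<in> S"
    then have "place y k \<in> low_pos" using k by (rule place_low)
    then show "(\<Sum>q\<in>low_pos. of_bool (place y k = q) :: real) = 1"
      by (simp add: of_bool_def sum.delta' del: atLeastAtMost_iff)
  qed
  finally show ?thesis using eq by simp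
qed

lemma card_match_two:
  assumes k: "k \<in> {1..g n}" "k' \<in> {1..g n}" "k \<noteq> k'" and p: "p \<in> low_pos" "p' \<in> low_pos" "p \<noteq> p'"
  shows "(real (f n) - 1) * (\<Sum>y\<in>S. of_bool (place y k = p) * of_bool (place y k' = p'))
    = (\<Sum>y\<in>S. of_bool (place y k = p))"
proof -
  have eq: "(\<Sum>y\<in>S. of_bool (place y k = p) * of_bool (place y k' = q) :: real)
      = (\<Sum>y\<in>S. of_bool (place y k = p) * of_bool (place y k' = p'))"
    if q: "q \<in> low_pos - {p}" for q
  proof -
    have "Transposition.transpose p' q l = q \<longleftrightarrow> l = p'" "Transposition.transpose p' q l = p \<longleftrightarrow> l = p" for l
      using q p by (auto simp: Transposition.transpose_def)
    then show ?thesis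
      using sum_S_exchange[of p' q "\<lambda>s. of_bool (s k = p) * of_bool (s k' = q)"] p q by simp
  qed
  have "(\<Sum>q\<in>low_pos - {p}. \<Sum>y\<in>S. of_bool (place y k = p) * of_bool (place y k' = q) :: real)
      = (\<Sum>y\<in>S. \<Sum>q\<in>low_pos - {p}. of_bool (place y k = p) * of_bool (place y k' = q))"
    by (rule sum.swap)
  also have "\<dots> = (\<Sum>y\<in>S. of_bool (place y k = p))"
  proof (intro sum.cong refl)
    fix y assume y: "y \<in> S"
    have "place y k \<noteq> place y k'" using inj_on_place[OF y] k by (meson inj_on_def)
    moreover have "place y k' \<in> low_pos" using y k by (intro place_low)
    ultimately show "(\<Sum>q\<in>low_pos - {p}. of_bool (place y k = p) * of_bool (place y k' = q) :: real) = of_bool (place y k = p)"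
      by (auto simp: of_bool_def sum.delta' simp del: atLeastAtMost_iff)
  qed
  also have "(\<Sum>q\<in>low_pos - {p}. \<Sum>y\<in>S. of_bool (place y k = p) * of_bool (place y k' = q) :: real)
      = real (card (low_pos - {p})) * (\<Sum>y\<in>S. of_bool (place y k = p) * of_bool (place y k' = p'))"
    using eq by simp
  also have "real (card (low_pos - {p})) = real (f n) - 1"
    using p(1) by (subst card_Diff_singleton) (auto simp: of_nat_diff)
  finally show ?thesis .
qed

text \<open>The variance of the number of matches is at most its mean \<open>G / F\<close>: the
  correction has the sign of \<open>(G - 1) / (F - 1) - G / F\<close>, which is not positive because
  \<open>G \<le> F\<close>.\<close>

lemma sum_stat_squares:
  assumes x: "x \<in> S" and F: "2 \<le> f n"
  shows "(\<Sum>y\<in>S. (stat x y)\<^sup>2) \<le> real (card S) * (real (g n) / real (f n))"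
proof -
  define F where "F = real (f n)"
  define G where "G = real (g n)"
  define s where "s = real (card S)"
  have F2: "2 \<le> F" and GF: "1 \<le> G" "G \<le> F" using F g_ge1 g_le_f by (simp_all add: F_def G_def)
  have c: "(\<Sum>y\<in>S. of_bool (place y k = place x k)) = s / F" if "k \<in> {1..g n}" for k
    using card_match_one[OF that place_low[OF x that]] F2 by (simp add: F_def s_def field_simps)
  have d: "(\<Sum>y\<in>S. of_bool (place y k = place x k) * of_bool (place y k' = place x k'))
      = (if k = k' then s / F else s / (F * (F - 1)))" if k: "k \<in> {1..g n}" "k' \<in> {1..g n}" for k k'
  proof (cases "k = k'")
    case True
    have "(\<Sum>y\<in>S. of_bool (place y k' = place x k') * of_bool (place y k' = place x k'))
        = (\<Sum>y\<in>S. of_bool (place y k' = place x k') :: real)"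
      by (intro sum.cong refl) (simp add: of_bool_def)
    then show ?thesis unfolding True c[OF k(2)] by simp
  next
    case False
    have "place x k \<noteq> place x k'" using inj_on_place[OF x] k False by (meson inj_on_def)
    from card_match_two[OF k False place_low[OF x k(1)] place_low[OF x k(2)] this]
    show ?thesis using c[OF k(1)] False F2 by (simp add: F_def[symmetric] field_simps)
  qed
  have Z: "(\<Sum>y\<in>S. matches x y) = G * (s / F)"
    unfolding matches_def by (subst sum.swap) (simp add: c G_def)
  have "(\<Sum>y\<in>S. (matches x y)\<^sup>2) = (\<Sum>y\<in>S. \<Sum>k\<in>{1..g n}. \<Sum>k'\<in>{1..g n}.
      of_bool (place y k = place x k) * of_bool (place y k' = place x k'))"
    unfolding matches_def power2_eq_square sum_product by (rule refl)
  also have "\<dots> = (\<Sum>k\<in>{1..g n}. \<Sum>k'\<in>{1..g n}. \<Sum>y\<in>S.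
      of_bool (place y k = place x k) * of_bool (place y k' = place x k'))"
    by (subst sum.swap, intro sum.cong refl, rule sum.swap)
  also have "\<dots> = (\<Sum>k\<in>{1..g n}. \<Sum>k'\<in>{1..g n}. (if k = k' then s / F else s / (F * (F - 1))))"
    by (intro sum.cong refl d)
  also have "\<dots> = (\<Sum>k\<in>{1..g n}. s / F + (G - 1) * (s / (F * (F - 1))))"
  proof (intro sum.cong refl)
    fix k assume k: "k \<in> {1..g n}"
    have "(\<Sum>k'\<in>{1..g n}. (if k = k' then s / F else s / (F * (F - 1))))
        = s / F + (\<Sum>k'\<in>{1..g n} - {k}. s / (F * (F - 1)))"
      by (subst sum.remove[OF _ k]) (auto intro!: sum.cong)
    moreover have "real (card ({1..g n} - {k})) = G - 1"
      using k by (subst card_Diff_singleton) (auto simp: of_nat_diff G_def)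
    ultimately show "(\<Sum>k'\<in>{1..g n}. (if k = k' then s / F else s / (F * (F - 1))))
        = s / F + (G - 1) * (s / (F * (F - 1)))" by (simp only: sum_constant)
  qed
  also have "\<dots> = G * (s / F) + G * ((G - 1) * (s / (F * (F - 1))))"
    by (simp add: G_def distrib_left)
  finally have ZZ: "(\<Sum>y\<in>S. (matches x y)\<^sup>2) = G * (s / F) + G * ((G - 1) * (s / (F * (F - 1))))" .
  have "(\<Sum>y\<in>S. (stat x y)\<^sup>2) = (\<Sum>y\<in>S. (matches x y)\<^sup>2 - 2 * (G / F) * matches x y + (G / F)\<^sup>2)"
    by (intro sum.cong refl) (simp add: stat_def F_def G_def power2_eq_square algebra_simps)
  also have "\<dots> = (\<Sum>y\<in>S. (matches x y)\<^sup>2) - 2 * (G / F) * (\<Sum>y\<in>S. matches x y) + s * (G / F)\<^sup>2"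
    by (simp add: sum.distrib sum_subtractf sum_distrib_left s_def)
  also have "\<dots> = s * (G / F) + s * (G * (G - 1) / (F * (F - 1)) - (G / F)\<^sup>2)"
    unfolding Z ZZ by (simp add: power2_eq_square algebra_simps)
  also have "\<dots> \<le> s * (G / F) + s * 0"
  proof (intro add_left_mono mult_left_mono)
    have "(G - 1) / (F - 1) \<le> G / F" using F2 GF by (simp add: field_simps)
    then have "G / F * ((G - 1) / (F - 1)) \<le> G / F * (G / F)" using F2 GF by (intro mult_left_mono) auto
    then show "G * (G - 1) / (F * (F - 1)) - (G / F)\<^sup>2 \<le> 0" by (simp add: power2_eq_square)
  qed (simp add: s_def)
  finally show ?thesis by (simp add: s_def F_def G_def)
qed

text \<open>Cauchy-Schwarz against the test function \<open>stat x\<close>. Its value at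
  \<open>x\<close> is \<open>G (1 - 1 / F)\<close> and its second moment at most
  \<open>G / F\<close>; the quotient of the squared value by the second moment supplies the factor
  \<open>G F\<close>, and with it the \<open>ln F + ln G\<close> in the location.\<close>

theorem chi2_lower:
  assumes x: "x \<in> S" and F: "2 \<le> f n"
  shows "eigval ^ (2 * t) * (real (g n) * real (f n) * (1 - 1 / real (f n))\<^sup>2) \<le> (walk_chi2 n M t x)\<^sup>2"
proof -
  define s where "s = real (card S)"
  have s: "s > 0" using card_S_pos by (simp add: s_def)
  define r where "r y = (step ^^ t) (point x) y" for y
  have pt: "(\<Sum>y\<in>S. point x y * h y) = h x" for h
    using x finite_S by (simp add: point_def of_bool_def if_distrib[of "\<lambda>u. u * _"] sum.delta cong: if_cong)
  have one: "(\<Sum>y\<in>S. r y) = 1"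
  proof -
    have "(step ^^ t) (\<lambda>_. 1) y = 1" if "y \<in> S" for y
      using that
    proof (induction t arbitrary: y)
      case (Suc t)
      have "(step ^^ Suc t) (\<lambda>_. 1) y = step (\<lambda>_. 1) y"
        unfolding funpow.simps(2) o_apply by (rule step_cong) (rule Suc.IH)
      then show ?case using step_const[OF Suc.prems] by simp
    qed simp
    then show ?thesis
      using steps_symmetric[of "point x" t "\<lambda>_. 1"] x pt[of "\<lambda>_. 1"] by (simp add: r_def)
  qed
  have "(\<Sum>y\<in>S. (r y - 1 / s) * stat x y) = (\<Sum>y\<in>S. r y * stat x y) - 1 / s * (\<Sum>y\<in>S. stat x y)"
    by (simp only: left_diff_distrib sum_subtractf sum_distrib_left)
  also have "\<dots> = eigval ^ t * stat x x"
    using steps_symmetric[of "point x" t "stat x"] sum_stat[OF x] steps_stat[OF x x]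
    by (simp add: r_def pt)
  finally have "(eigval ^ t * stat x x)\<^sup>2 \<le> (\<Sum>y\<in>S. (r y - 1 / s)\<^sup>2) * (\<Sum>y\<in>S. (stat x y)\<^sup>2)"
    using Cauchy_Schwarz_ineq_sum[of "\<lambda>y. r y - 1 / s" "stat x" S] by simp
  also have "(\<Sum>y\<in>S. (r y - 1 / s)\<^sup>2) = (walk_chi2 n M t x)\<^sup>2 / s"
  proof -
    have "(\<Sum>y\<in>S. (r y - 1 / s)\<^sup>2) = (\<Sum>y\<in>S. (r y)\<^sup>2 - 2 / s * r y + 1 / s\<^sup>2)"
      by (intro sum.cong refl) (simp add: power2_eq_square algebra_simps)
    also have "\<dots> = (\<Sum>y\<in>S. (r y)\<^sup>2) - 2 / s * (\<Sum>y\<in>S. r y) + s * (1 / s\<^sup>2)"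
      unfolding sum.distrib sum_subtractf sum_distrib_left[symmetric] by (simp add: s_def)
    also have "\<dots> = (walk_chi2 n M t x)\<^sup>2 / s"
      unfolding chi2_eq_sum[OF x] r_def[symmetric] s_def[symmetric] one
      using s by (simp add: power2_eq_square field_simps)
    finally show ?thesis .
  qed
  also have "(walk_chi2 n M t x)\<^sup>2 / s * (\<Sum>y\<in>S. (stat x y)\<^sup>2)
      \<le> (walk_chi2 n M t x)\<^sup>2 / s * (s * (real (g n) / real (f n)))"
    using sum_stat_squares[OF x F] s by (intro mult_left_mono) (auto simp: s_def)
  also have "\<dots> = (walk_chi2 n M t x)\<^sup>2 * (real (g n) / real (f n))" using s by simp
  finally have main: "(eigval ^ t * stat x x)\<^sup>2 \<le> (walk_chi2 n M t x)\<^sup>2 * (real (g n) / real (f n))" .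
  have Gp: "real (g n) > 0" using g_ge1 by simp
  have "(eigval ^ t * stat x x)\<^sup>2 = eigval ^ (2 * t) * (real (g n))\<^sup>2 * (1 - 1 / real (f n))\<^sup>2"
  proof -
    have "stat x x = real (g n) * (1 - 1 / real (f n))" by (simp add: stat_self[OF x] right_diff_distrib)
    moreover have "(eigval ^ t)\<^sup>2 = eigval ^ (2 * t)" by (simp only: power_mult[symmetric] mult.commute)
    ultimately show ?thesis by (simp only: power_mult_distrib mult.assoc)
  qed
  also have "\<dots> = (eigval ^ (2 * t) * (real (g n) * real (f n) * (1 - 1 / real (f n))\<^sup>2)) * (real (g n) / real (f n))"
    using f_pos by (simp add: power2_eq_square)
  finally have "(eigval ^ (2 * t) * (real (g n) * real (f n) * (1 - 1 / real (f n))\<^sup>2)) * (real (g n) / real (f n))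
      \<le> (walk_chi2 n M t x)\<^sup>2 * (real (g n) / real (f n))" using main by (simp only:)
  moreover have "0 < real (g n) / real (f n)" using Gp f_pos by simp
  ultimately show ?thesis by (rule mult_right_le_imp_le)
qed

end

section \<open>Numerical estimates\<close>

text \<open>The left side is a single term of the exponential series at \<open>2 j\<close>.\<close>

lemma power_le_exp_fact:
  fixes j :: nat
  shows "(2 * real j) ^ j / fact j \<le> exp (2 * real j)"
proof -
  have "(2 * real j) ^ j /\<^sub>R fact j \<le> (\<Sum>i<Suc j. (2 * real j) ^ i /\<^sub>R fact i)"
    by (intro member_le_sum) auto
  also have "\<dots> \<le> (\<Sum>i. (2 * real j) ^ i /\<^sub>R fact i)"
    by (intro sum_le_suminf summable_exp_generic) auto
  also have "\<dots> = exp (2 * real j)" by (simp add: exp_def)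
  finally show ?thesis by (simp add: divide_inverse mult.commute)
qed

lemma binomial_le_power_fact: "real (m choose j) \<le> real m ^ j / fact j"
proof -
  have "real ((m choose j) * fact j) \<le> real (m ^ j)"
    using binomial_fact_pow[of m j] by (intro of_nat_mono)
  then show ?thesis by (simp add: field_simps)
qed

text \<open>Convexity of \<open>exp\<close> on the segment from \<open>0\<close> to \<open>ln F\<close>.\<close>

lemma exp_interpolate:
  fixes F z :: real
  assumes "1 \<le> F" "0 \<le> z" "z \<le> 1"
  shows "exp (z * ln F) \<le> 1 + z * (F - 1)"
proof -
  have "exp ((1 - z) *\<^sub>R 0 + z *\<^sub>R ln F) \<le> (1 - z) * exp 0 + z * exp (ln F)"
    using convex_onD[OF exp_convex, of z 0 "ln F"] assms by simp
  then show ?thesis using assms by (simp add: algebra_simps)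
qed

text \<open>Since \<open>j (F - j + 1) / F = j - j (j - 1) / F\<close>, only
  \<open>exp (j (j - 1) L / F)\<close> survives of the dimension. By convexity this is at most
  \<open>(2 j)^j\<close>, which the factorial reduces to \<open>exp (2 j)\<close>. The assumption
  \<open>c \<ge> 10\<close> pays for that: it gives \<open>exp (- c - 5 (j - 1))\<close>.\<close>

lemma level_term_small:
  fixes F L c :: real and j :: nat
  assumes F: "12 \<le> F" and L: "0 \<le> L" "L \<le> 2 * ln F" and c: "10 \<le> c" and j: "1 \<le> j" "2 * real j \<le> F"
  shows "exp (real j * L) / fact j * exp (- (real j * (F - real j + 1) / F * (L + c)))
    \<le> exp (- c) * exp (2 - 2 * (real j - 1))"
proof -
  define x where "x = real j"
  have x: "1 \<le> x" "2 * x \<le> F" using j by (auto simp: x_def)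
  \<comment> \<open>The factor 2 comes from \<open>L \<le> 2 ln F\<close>; the range
    \<open>2 j \<le> F\<close> keeps \<open>z\<close> in the unit interval.\<close>
  define z where "z = (x - 1) / F * 2"
  have z: "0 \<le> z" "z \<le> 1" using x F by (auto simp: z_def field_simps)
  have "exp (z * ln F) \<le> 1 + z * (F - 1)" using F z by (intro exp_interpolate) auto
  also have "z * (F - 1) \<le> 2 * (x - 1)" using x F by (simp add: z_def field_simps)
  finally have e1: "exp (z * ln F) \<le> 2 * x" using x by simp
  have "x * L - x * (F - x + 1) / F * (L + c) = x * ((x - 1) / F * L) - c * (x * (F - x + 1) / F)"
    using F by (simp add: field_simps)
  also have "\<dots> \<le> x * (z * ln F) - (c + 5 * (x - 1))"
  proof (intro diff_mono mult_left_mono)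
    have "(x - 1) / F * L \<le> (x - 1) / F * (2 * ln F)" using L x F by (intro mult_left_mono) auto
    then show "(x - 1) / F * L \<le> z * ln F" by (simp only: z_def mult.assoc)
    have "x * (F - x + 1) / F = 1 + (x - 1) * ((F - x) / F)" using F by (simp add: field_simps)
    moreover have "(x - 1) * (1 / 2) \<le> (x - 1) * ((F - x) / F)"
      using x F by (intro mult_left_mono) (auto simp: field_simps)
    ultimately have *: "1 + (x - 1) / 2 \<le> x * (F - x + 1) / F" by simp
    have "c + 5 * (x - 1) \<le> c + c * ((x - 1) / 2)"
      using mult_right_mono[OF c, of "(x - 1) / 2"] x by simp
    also have "\<dots> = c * (1 + (x - 1) / 2)" by (simp add: algebra_simps)
    also have "\<dots> \<le> c * (x * (F - x + 1) / F)" using * c by (intro mult_left_mono) auto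
    finally show "c + 5 * (x - 1) \<le> c * (x * (F - x + 1) / F)" .
  qed (use x in auto)
  finally have "exp (x * L) * exp (- (x * (F - x + 1) / F * (L + c))) \<le> exp (x * (z * ln F)) * exp (- c - 5 * (x - 1))"
    by (simp add: exp_add[symmetric])
  also have "exp (x * (z * ln F)) = exp (z * ln F) ^ j" by (simp add: x_def exp_of_nat_mult)
  also have "exp (z * ln F) ^ j * exp (- c - 5 * (x - 1)) \<le> (2 * x) ^ j * exp (- c - 5 * (x - 1))"
    using e1 by (intro mult_right_mono power_mono) auto
  finally have "exp (x * L) / fact j * exp (- (x * (F - x + 1) / F * (L + c))) \<le> (2 * x) ^ j / fact j * exp (- c - 5 * (x - 1))"
    by (simp add: divide_right_mono)
  also have "\<dots> \<le> exp (2 * x) * exp (- c - 5 * (x - 1))"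
    using power_le_exp_fact[of j] by (intro mult_right_mono) (auto simp: x_def)
  also have "\<dots> = exp (- c) * exp (2 * x - 5 * (x - 1))" by (simp add: exp_add[symmetric])
  also have "\<dots> \<le> exp (- c) * exp (2 - 2 * (x - 1))" using x by simp
  finally show ?thesis by (simp add: x_def)
qed

text \<open>Half of \<open>L\<close> is left over, so at most \<open>F^j\<close> survives of the
  dimension, and \<open>F < 2 j\<close> bounds it by \<open>(2 j)^j\<close>. The final comparison
  \<open>10 - 3 j \<le> 4 - 2 j\<close> requires \<open>j \<ge> 6\<close>, which is where
  \<open>F \<ge> 12\<close> enters.\<close>

lemma level_term_large:
  fixes F L c :: real and j :: nat
  assumes F: "12 \<le> F" and L: "0 \<le> L" "L \<le> 2 * ln F" and c: "10 \<le> c" and j: "F < 2 * real j"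
  shows "exp (real j * L) / fact j * exp (- (real j / 2 * (L + c)))
    \<le> exp (- c) * exp (2 - 2 * (real j - 1))"
proof -
  define x where "x = real j"
  have x: "6 \<le> x" "F \<le> 2 * x" using F j by (auto simp: x_def)
  have "x * L - x / 2 * (L + c) = x * (L / 2) - x / 2 * c" by (simp add: algebra_simps)
  also have "\<dots> \<le> x * ln F - (c + 5 * (x - 2))"
  proof (intro diff_mono mult_left_mono)
    show "L / 2 \<le> ln F" using L by simp
    have "5 * (x - 2) \<le> c * ((x - 2) / 2)" using mult_right_mono[OF c, of "(x - 2) / 2"] x by simp
    then show "c + 5 * (x - 2) \<le> x / 2 * c" by (simp add: algebra_simps)
  qed (use x in auto)
  finally have "exp (x * L) * exp (- (x / 2 * (L + c))) \<le> exp (x * ln F) * exp (- c - 5 * (x - 2))"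
    by (simp add: exp_add[symmetric])
  also have "exp (x * ln F) = F ^ j" using F by (simp add: x_def exp_of_nat_mult)
  also have "F ^ j * exp (- c - 5 * (x - 2)) \<le> (2 * x) ^ j * exp (- c - 5 * (x - 2))"
    using x F by (intro mult_right_mono power_mono) auto
  finally have "exp (x * L) / fact j * exp (- (x / 2 * (L + c))) \<le> (2 * x) ^ j / fact j * exp (- c - 5 * (x - 2))"
    by (simp add: divide_right_mono)
  also have "\<dots> \<le> exp (2 * x) * exp (- c - 5 * (x - 2))"
    using power_le_exp_fact[of j] by (intro mult_right_mono) (auto simp: x_def)
  also have "\<dots> = exp (- c) * exp (2 * x - 5 * (x - 2))" by (simp add: exp_add[symmetric])
  also have "\<dots> \<le> exp (- c) * exp (2 - 2 * (x - 1))" using x by simp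
  finally show ?thesis by (simp add: x_def)
qed

lemma one_minus_power_le_exp:
  fixes y :: real
  assumes "y \<le> 1"
  shows "(1 - y) ^ k \<le> exp (- (real k * y))"
proof -
  have "(1 - y) ^ k \<le> exp (- y) ^ k"
    using exp_ge_add_one_self[of "- y"] assms by (intro power_mono) auto
  also have "\<dots> = exp (- (real k * y))" by (simp add: exp_of_nat_mult[symmetric])
  finally show ?thesis .
qed

text \<open>\<open>exp 2\<close> is at most 9 and the ratio \<open>exp (- 2)\<close> at most
  \<open>1 / 4\<close>, so the sum is at most \<open>9 * (4 / 3)\<close>.\<close>

lemma geometric_exp_sum: "(\<Sum>j=1..m. exp (2 - 2 * (real j - 1))) \<le> (12::real)"
proof -
  have e3: "exp (1::real) \<le> 3" by (rule exp_le)
  have e2: "exp (1::real) \<ge> 2" using exp_ge_add_one_self[of 1] by simp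
  have "exp (2 :: real) = exp 1 * exp 1" by (simp add: exp_add[symmetric])
  then have E: "exp (2 :: real) \<le> 9" "exp (2 :: real) \<ge> 4"
    using mult_mono[OF e3 e3] mult_mono[OF e2 e2] by auto
  define q where "q = exp (- 2 :: real)"
  have q: "0 < q" "q \<le> 1 / 4"
    using E le_imp_inverse_le[of 4 "exp (2 :: real)"] by (auto simp: q_def exp_minus)
  have "(\<Sum>j=1..m. exp (2 - 2 * (real j - 1))) = exp 2 * (\<Sum>j<m. q ^ j)"
  proof -
    have "(\<Sum>j=1..m. exp (2 - 2 * (real j - 1))) = (\<Sum>j<m. exp (2 - 2 * real j))"
      by (simp add: sum.atLeast1_atMost_eq)
    also have "\<dots> = (\<Sum>j<m. exp 2 * q ^ j)"
      by (intro sum.cong refl) (simp add: q_def exp_diff exp_minus exp_of_nat_mult[symmetric] divide_inverse mult.commute flip: exp_minus)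
    finally show ?thesis by (simp add: sum_distrib_left)
  qed
  also have "(\<Sum>j<m. q ^ j) \<le> 4 / 3"
  proof -
    have "(\<Sum>j<m. q ^ j) = (1 - q ^ m) / (1 - q)" using q by (simp add: sum_gp_strict)
    also have "\<dots> \<le> 1 / (1 - q)" using q by (intro divide_right_mono) auto
    also have "\<dots> \<le> 4 / 3" using q by (simp add: field_simps)
    finally show ?thesis .
  qed
  then have "exp 2 * (\<Sum>j<m. q ^ j) \<le> 9 * (4 / 3)"
    using E q by (intro mult_mono) (auto intro: sum_nonneg)
  finally show ?thesis by simp
qed

section \<open>Explicit distance bounds for fixed n\<close>

context two_step_walk
begin

lemma level_sum_bound:
  assumes F: "12 \<le> f n" and N: "4 * (real (f n))\<^sup>2 \<le> real pairs" and c: "10 \<le> c"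
    and t: "real pairs * (ln (real (f n)) + ln (real (g n)) + c) / (4 * real (f n)) \<le> real t"
  shows "level_sum t \<le> 1 + 12 * exp (- c)"
proof -
  define b where "b = 1 / real pairs"
  define L where "L = ln (real (f n)) + ln (real (g n))"
  let ?F = "real (f n)"
  have p: "real pairs > 0" using pairs_pos by simp
  have G: "1 \<le> real (g n)" "real (g n) \<le> ?F" and F': "12 \<le> ?F" using g_ge1 g_le_f F by simp_all
  have L: "0 \<le> L" "L \<le> 2 * ln ?F" using G F' by (auto simp: L_def)
  have eL: "exp L = ?F * real (g n)" using G F' by (simp add: L_def exp_add)
  \<comment> \<open>The time hypothesis in the form in which it multiplies the spectral drops;
    \<open>2 t\<close> appears because the chi-squared distance is a return probability at time
    \<open>2 t\<close>.\<close>
  have tb: "(L + c) / (2 * ?F) \<le> real (2 * t) * b"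
    using t p F' by (simp add: L_def b_def field_simps)
  have Fb: "?F * ?F * b \<le> 1 / 4" using N p by (simp add: b_def field_simps power2_eq_square)
  have b0: "0 \<le> b" by (simp add: b_def)
  have "real ((g n * f n) choose j) * pos.level_rate b j ^ (2 * t) \<le> exp (- c) * exp (2 - 2 * (real j - 1))"
    if j: "j \<in> {1..g n}" for j
  proof -
    let ?x = "real j"
    have x: "1 \<le> ?x" "?x \<le> ?F" using j g_le_f by auto
    have ch: "real ((g n * f n) choose j) \<le> exp (?x * L) / fact j"
    proof -
      have "real (g n * f n) ^ j = exp (?x * L)" 
        unfolding exp_of_nat_mult eL of_nat_mult by (simp only: mult.commute)
      then show ?thesis using binomial_le_power_fact[of "g n * f n" j] by simp
    qed
    show ?thesis
    proof (cases "2 * j \<le> f n")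
      case True
      then have x2: "2 * ?x \<le> ?F" by linarith
      let ?y = "2 * b * ?x * (?F - ?x + 1)"
      have "2 * ?x * (?F - ?x + 1) \<le> ?F * ?F" using x x2 by (intro mult_mono) auto
      then have "b * (2 * ?x * (?F - ?x + 1)) \<le> b * (?F * ?F)" using b0 by (intro mult_left_mono)
      then have y: "?y \<le> 1" using Fb by (simp add: mult_ac)
      have "pos.level_rate b j ^ (2 * t) = (1 - ?y) ^ (2 * t)" using True unfolding pos.level_rate_def by simp
      also have "\<dots> \<le> exp (- (real (2 * t) * ?y))" by (rule one_minus_power_le_exp[OF y])
      also have "\<dots> \<le> exp (- (?x * (?F - ?x + 1) / ?F * (L + c)))"
      proof -
        have "(L + c) / (2 * ?F) * (2 * ?x * (?F - ?x + 1)) \<le> real (2 * t) * b * (2 * ?x * (?F - ?x + 1))"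
          using x by (intro mult_right_mono[OF tb]) auto
        moreover have "(L + c) / (2 * ?F) * (2 * ?x * (?F - ?x + 1)) = ?x * (?F - ?x + 1) / ?F * (L + c)"
          using F' by (simp add: field_simps)
        moreover have "real (2 * t) * b * (2 * ?x * (?F - ?x + 1)) = real (2 * t) * ?y" by (simp only: mult_ac)
        ultimately show ?thesis by (simp only: exp_le_cancel_iff neg_le_iff_le)
      qed
      finally have "real ((g n * f n) choose j) * pos.level_rate b j ^ (2 * t)
          \<le> exp (?x * L) / fact j * exp (- (?x * (?F - ?x + 1) / ?F * (L + c)))"
        using ch by (intro mult_mono) (auto simp: power_mult)
      also have "\<dots> \<le> exp (- c) * exp (2 - 2 * (?x - 1))"
        using j x2 by (intro level_term_small F' L c) auto
      finally show ?thesis .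
    next
      case False
      then have x2: "?F < 2 * ?x" by linarith
      let ?y = "b * ?x * ?F"
      have "b * ?x * ?F \<le> b * ?F * ?F" using x b0 by (intro mult_right_mono mult_left_mono) auto
      then have y: "?y \<le> 1" using Fb by (simp add: mult_ac)
      have "pos.level_rate b j ^ (2 * t) = (1 - ?y) ^ (2 * t)" using False unfolding pos.level_rate_def by simp
      also have "\<dots> \<le> exp (- (real (2 * t) * ?y))" by (rule one_minus_power_le_exp[OF y])
      also have "\<dots> \<le> exp (- (?x / 2 * (L + c)))"
      proof -
        have "(L + c) / (2 * ?F) * (?x * ?F) \<le> real (2 * t) * b * (?x * ?F)"
          using x by (intro mult_right_mono[OF tb]) auto
        moreover have "(L + c) / (2 * ?F) * (?x * ?F) = ?x / 2 * (L + c)"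
          using F' by (simp add: field_simps)
        moreover have "real (2 * t) * b * (?x * ?F) = real (2 * t) * ?y" by (simp only: mult_ac)
        ultimately show ?thesis by (simp only: exp_le_cancel_iff neg_le_iff_le)
      qed
      finally have "real ((g n * f n) choose j) * pos.level_rate b j ^ (2 * t)
          \<le> exp (?x * L) / fact j * exp (- (?x / 2 * (L + c)))"
        using ch by (intro mult_mono) (auto simp: power_mult)
      also have "\<dots> \<le> exp (- c) * exp (2 - 2 * (?x - 1))"
        by (rule level_term_large[OF F' L c x2])
      finally show ?thesis .
    qed
  qed
  then have "(\<Sum>j=1..g n. real ((g n * f n) choose j) * pos.level_rate b j ^ (2 * t))
      \<le> (\<Sum>j=1..g n. exp (- c) * exp (2 - 2 * (real j - 1)))"
    by (intro sum_mono)
  also have "\<dots> \<le> exp (- c) * 12"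
    unfolding sum_distrib_left[symmetric] by (intro mult_left_mono geometric_exp_sum) auto
  finally have "(\<Sum>j=1..g n. real ((g n * f n) choose j) * pos.level_rate b j ^ (2 * t)) \<le> 12 * exp (- c)" by simp
  moreover have "level_sum t = 1 + (\<Sum>j=1..g n. real ((g n * f n) choose j) * pos.level_rate b j ^ (2 * t))"
  proof -
    have "{..g n} = insert 0 {1..g n}" by auto
    then show ?thesis unfolding level_sum_def b_def pos.level_rate_def by simp
  qed
  ultimately show ?thesis by simp
qed

lemma pairs_bounds:
  assumes "2 * f n \<le> n"
  shows "(real n)\<^sup>2 / 4 \<le> real pairs" "real pairs \<le> (real n)\<^sup>2"
proof -
  have h: "2 * real (f n) \<le> real n" "0 \<le> real (g n)" "real (g n) \<le> real (f n)"
    using assms g_le_f by linarith+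
  have "(real n / 2)\<^sup>2 \<le> (real n - real (g n))\<^sup>2" using h by (intro power_mono) auto
  moreover have "(real (f n) - real (g n))\<^sup>2 \<le> (real (f n))\<^sup>2" using h by (intro power_mono) auto
  ultimately show "(real n)\<^sup>2 / 4 \<le> real pairs" using pairs_real by (simp add: power_divide)
  have "real pairs = (real n)\<^sup>2 - 2 * (real (g n) * (real n - real (f n)))"
    using pairs_real by (simp add: power2_eq_square algebra_simps)
  moreover have "0 \<le> real (g n) * (real n - real (f n))" using h f_less by (intro mult_nonneg_nonneg) auto
  ultimately show "real pairs \<le> (real n)\<^sup>2" by simp
qed

text \<open>The constant 12 is dictated by the remainder term: its drop is at least
  \<open>1 / 4 * (1 / 3)\<close>, so \<open>2 t\<close> steps give \<open>n^(- 2 n)\<close> against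
  \<open>2 n!\<close>. That term costs \<open>2 / n\<close>, and the levels, a geometric series in
  \<open>q\<close>, cost \<open>12 / n\<close>.\<close>

lemma tilt_sum_bound:
  assumes n: "24 \<le> n" and F: "2 * f n \<le> n" and t: "12 * real n * ln (real n) \<le> real t"
  shows "(\<Sum>i\<le>(n - g n) div 2. weight i * tilt (ratio i) ^ (2 * t)) \<le> 14 / real n"
proof -
  define m where "m = real (n - g n)"
  define J where "J = (n - g n) div 2"
  define a where "a = m\<^sup>2 / real pairs"
  have p: "real pairs > 0" using pairs_pos by simp
  have nn: "24 \<le> real n" using n by simp
  have ln0: "0 \<le> ln (real n)" using nn by simp
  have mn: "real n / 2 \<le> m" "m \<le> real n" using F g_le_f f_less by (auto simp: m_def of_nat_diff)
  have mp: "12 \<le> m" using mn nn by simp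
  have a4: "1 / 4 \<le> a"
  proof -
    have "(real n / 2)\<^sup>2 \<le> m\<^sup>2" using mn nn by (intro power_mono) auto
    moreover have "(real n / 2)\<^sup>2 = (real n)\<^sup>2 / 4" by (simp add: power_divide)
    ultimately have "real pairs / 4 \<le> m\<^sup>2" using pairs_bounds(2)[OF F] by linarith
    then show ?thesis using p by (simp add: a_def field_simps)
  qed
  have a1: "a \<le> 1"
  proof -
    have "(real (f n - g n))\<^sup>2 \<le> (real (f n))\<^sup>2" by (intro power_mono) auto
    then have "m\<^sup>2 \<le> real pairs" using pairs_split by (simp add: m_def)
    then show ?thesis using p by (simp add: a_def)
  qed
  have am: "1 / (4 * real n) \<le> a / m"
  proof -
    have "1 / 4 / real n \<le> a / m" using a4 mn mp nn by (intro frac_le) auto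
    then show ?thesis by simp
  qed
  have J: "m / 3 \<le> real J" "real J \<le> m"
  proof -
    have "n - g n \<le> 2 * J + 1" "2 * J \<le> n - g n" unfolding J_def by linarith+
    then have "m \<le> 2 * real J + 1" "2 * real J \<le> m" unfolding m_def by linarith+
    then show "m / 3 \<le> real J" "real J \<le> m" using mp by linarith+
  qed
  \<comment> \<open>Passing to the next level multiplies the dimension bound by at most
    \<open>m^2\<close> and the decay by one further exponential factor.\<close>
  define q where "q = m\<^sup>2 * exp (- (real (2 * t) * (a / m)))"
  have q0: "0 \<le> q" by (simp add: q_def)
  have q: "q \<le> 1 / (real n)\<^sup>2"
  proof -
    have "real (2 * t) * (1 / (4 * real n)) \<le> real (2 * t) * (a / m)"
      using am by (intro mult_left_mono) auto
    moreover have "6 * ln (real n) \<le> real (2 * t) * (1 / (4 * real n))"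
      using t nn by (simp add: field_simps)
    ultimately have "4 * ln (real n) \<le> real (2 * t) * (a / m)" using ln0 by linarith
    then have "exp (- (real (2 * t) * (a / m))) \<le> exp (- (real 4 * ln (real n)))" by simp
    also have "\<dots> = 1 / (real n) ^ 4" unfolding exp_minus exp_of_nat_mult using nn by (simp add: divide_inverse)
    finally have "q \<le> (real n)\<^sup>2 * (1 / (real n) ^ 4)"
      unfolding q_def using mn mp by (intro mult_mono power_mono) auto
    also have "\<dots> = 1 / (real n)\<^sup>2" using nn by (simp add: power2_eq_square power4_eq_xxxx)
    finally show ?thesis .
  qed
  have q2: "q \<le> 1 / 2"
  proof -
    have "2 * 1 \<le> real n * real n" using nn by (intro mult_mono) auto
    then have "1 / (real n)\<^sup>2 \<le> 1 / 2" by (intro divide_left_mono) (auto simp: power2_eq_square)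
    then show ?thesis using q by simp
  qed
  have rest: "weight 0 * tilt (ratio 0) ^ (2 * t) \<le> 2 / real n"
  proof -
    have "tilt (ratio 0) = 1 - a * (real J / m)"
      by (simp add: tilt_def ratio_def a_def m_def J_def)
    moreover have le1: "a * (real J / m) \<le> 1"
      using a1 a4 J mp by (intro mult_le_one) auto
    ultimately have "tilt (ratio 0) ^ (2 * t) \<le> exp (- (real (2 * t) * (a * (real J / m))))"
      using one_minus_power_le_exp[OF le1, of "2 * t"] by (simp only:)
    also have "\<dots> \<le> exp (- (2 * real n * ln (real n)))"
    proof -
      have "1 / 4 * (1 / 3) \<le> a * (real J / m)"
        using a4 J mp by (intro mult_mono) (auto simp: field_simps)
      then have "real (2 * t) * (1 / 4 * (1 / 3)) \<le> real (2 * t) * (a * (real J / m))"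
        by (intro mult_left_mono) auto
      then show ?thesis using t by simp
    qed
    finally have tl: "tilt (ratio 0) ^ (2 * t) \<le> exp (- (2 * real n * ln (real n)))" .
    have "fact (n - g n) \<le> (fact n :: real)" by (intro fact_mono) simp
    also have "\<dots> \<le> real n ^ n" using fact_le_power[of n, where 'a = real] by simp
    also have "\<dots> = exp (real n * ln (real n))" using nn by (simp add: exp_of_nat_mult)
    finally have "weight 0 * tilt (ratio 0) ^ (2 * t) \<le> (2 * exp (real n * ln (real n))) * exp (- (2 * real n * ln (real n)))"
      using tl by (intro mult_mono) (auto simp: weight_def power_mult)
    also have "\<dots> = 2 * exp (- (real n * ln (real n)))" by (simp add: exp_add[symmetric])
    also have "\<dots> \<le> 2 * exp (- ln (real n))" using nn ln0 by (simp add: mult_le_cancel_right1)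
    also have "\<dots> = 2 / real n" using nn by (simp add: exp_minus divide_inverse)
    finally show ?thesis .
  qed
  have summand: "weight i * tilt (ratio i) ^ (2 * t) \<le> 6 * q ^ i" if i: "i \<in> {1..J}" for i
  proof -
    have im: "real i \<le> m" using i J by auto
    have "tilt (ratio i) = 1 - a * (real i / m)"
      using i by (simp add: tilt_def ratio_def a_def m_def)
    moreover have le1: "a * (real i / m) \<le> 1"
      using a1 a4 im mp by (intro mult_le_one) auto
    ultimately have "tilt (ratio i) ^ (2 * t) \<le> exp (- (real (2 * t) * (a * (real i / m))))"
      using one_minus_power_le_exp[OF le1, of "2 * t"] by (simp only:)
    also have "\<dots> = exp (- (real (2 * t) * (a / m))) ^ i"
      by (simp add: exp_of_nat_mult[symmetric])
    finally have tl: "tilt (ratio i) ^ (2 * t) \<le> exp (- (real (2 * t) * (a / m))) ^ i" .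
    have "real (((n - g n) * (n - g n)) choose i) \<le> real ((n - g n) * (n - g n)) ^ i / fact i"
      by (rule binomial_le_power_fact)
    also have "\<dots> \<le> (m\<^sup>2) ^ i / 1"
      by (intro frac_le) (auto simp: m_def power2_eq_square)
    finally have "weight i \<le> 6 * (m\<^sup>2) ^ i" using i by (simp add: weight_def)
    then have "weight i * tilt (ratio i) ^ (2 * t) \<le> (6 * (m\<^sup>2) ^ i) * exp (- (real (2 * t) * (a / m))) ^ i"
      using tl weight_nonneg by (intro mult_mono) (auto simp: power_mult)
    then show ?thesis by (simp add: q_def power_mult_distrib)
  qed
  have "(\<Sum>i=1..J. weight i * tilt (ratio i) ^ (2 * t)) \<le> (\<Sum>i=1..J. 6 * q ^ i)"
    by (intro sum_mono summand)
  also have "\<dots> = 6 * q * (\<Sum>i<J. q ^ i)"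
    by (simp add: sum.atLeast1_atMost_eq sum_distrib_left mult.assoc)
  also have "(\<Sum>i<J. q ^ i) \<le> 2"
  proof -
    have "(\<Sum>i<J. q ^ i) = (1 - q ^ J) / (1 - q)" using q2 by (simp add: sum_gp_strict)
    also have "\<dots> \<le> 1 / (1 - q)" using q2 q0 by (intro divide_right_mono) auto
    also have "\<dots> \<le> 2" using q2 by (simp add: field_simps)
    finally show ?thesis .
  qed
  then have "6 * q * (\<Sum>i<J. q ^ i) \<le> 6 * q * 2" using q0 by (intro mult_left_mono) auto
  also have "6 * q * 2 \<le> 12 / real n"
  proof -
    have "1 / (real n)\<^sup>2 \<le> 1 / real n" using nn by (intro divide_left_mono) (auto simp: power2_eq_square)
    then show ?thesis using q by simp
  qed
  finally have "(\<Sum>i=1..J. weight i * tilt (ratio i) ^ (2 * t)) \<le> 12 / real n" .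
  moreover have "{..(n - g n) div 2} = insert 0 {1..J}" by (auto simp: J_def)
  ultimately show ?thesis using rest by (simp add: add_divide_distrib[symmetric])
qed

text \<open>The levels give \<open>12 exp (- c)\<close>. The residual gives at most
  \<open>13 * 14 / n\<close>, and \<open>182 = 13 * 14\<close> explains the condition on
  \<open>n\<close>, which makes it at most \<open>4 exp (- c)\<close>. Together this is
  \<open>16 exp (- c)\<close>, the square of the claim.\<close>

lemma chi2_upper_bound:
  assumes x: "x \<in> S" and F: "12 \<le> f n" "4 * f n \<le> n" and c: "10 \<le> c"
    and t: "real pairs * (ln (real (f n)) + ln (real (g n)) + c) / (4 * real (f n)) \<le> real t"
    and t': "12 * real n * ln (real n) \<le> real t" and n: "182 * exp c \<le> 4 * real n"
  shows "walk_chi2 n M t x \<le> 4 * exp (- c / 2)"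
proof -
  have F2: "2 * f n \<le> n" and n24: "24 \<le> n" using F by linarith+
  have M12: "12 \<le> n - g n" using F g_le_f by linarith
  have N: "4 * (real (f n))\<^sup>2 \<le> real pairs"
  proof -
    have "(4 * real (f n))\<^sup>2 \<le> (real n)\<^sup>2" using F by (intro power_mono) linarith+
    then show ?thesis using pairs_bounds(1)[OF F2] by (simp add: power_mult_distrib)
  qed
  let ?E = "\<Sum>i\<le>(n - g n) div 2. weight i * tilt (ratio i) ^ (2 * t)"
  have E0: "0 \<le> ?E" using weight_nonneg by (intro sum_nonneg mult_nonneg_nonneg) (auto simp: power_mult)
  have ls: "level_sum t \<le> 1 + 12 * exp (- c)" by (rule level_sum_bound[OF F(1) N c t])
  have "exp (- c) \<le> 1" using c by simp
  then have ls13: "level_sum t \<le> 13" using ls by linarith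
  have "(walk_chi2 n M t x)\<^sup>2 \<le> level_sum t - 1 + ?E * level_sum t"
    by (rule chi2_upper[OF x M12 N])
  also have "\<dots> \<le> 12 * exp (- c) + ?E * 13"
    using ls ls13 E0 by (intro add_mono mult_left_mono) auto
  also have "?E * 13 \<le> 14 / real n * 13"
    using tilt_sum_bound[OF n24 F2 t'] by (intro mult_right_mono) auto
  also have "14 / real n * 13 \<le> 4 * exp (- c)"
  proof -
    have "182 \<le> 4 * real n * exp (- c)"
      using mult_right_mono[OF n, of "exp (- c)"] by (simp add: mult.assoc exp_add[symmetric])
    then show ?thesis using n24 by (simp add: field_simps)
  qed
  finally have "(walk_chi2 n M t x)\<^sup>2 \<le> 16 * exp (- c)" by simp
  also have "16 * exp (- c) = (4 * exp (- c / 2))\<^sup>2"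
    by (simp add: power_mult_distrib exp_double[symmetric])
  finally show ?thesis by (rule power2_le_imp_le) simp
qed

text \<open>Replacing \<open>1 - y\<close> by \<open>exp (- y)\<close> costs at most
  \<open>2 y^2\<close> per step in the exponent, in total at most \<open>2 y L \<le> 1 / 8\<close>,
  because \<open>16 f n \<le> n\<close> forces \<open>64 F^2 \<le> N\<close>. The losses
  \<open>7 / 8\<close> and \<open>(11 / 12)^2\<close> stay above \<open>1 / 4\<close>, the square of
  the \<open>1 / 2\<close> in the claim.\<close>

lemma chi2_lower_bound:
  assumes x: "x \<in> S" and F: "12 \<le> f n" "16 * f n \<le> n"
    and t: "real t \<le> real pairs * (ln (real (f n)) + ln (real (g n)) - c) / (4 * real (f n))"
    and c: "0 \<le> c"
  shows "1 / 2 * exp (c / 2) \<le> walk_chi2 n M t x"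
proof -
  define L where "L = ln (real (f n)) + ln (real (g n))"
  define y where "y = 2 * real (f n) / real pairs"
  let ?F = "real (f n)" and ?G = "real (g n)"
  have p: "real pairs > 0" using pairs_pos by simp
  have G: "1 \<le> ?G" "?G \<le> ?F" and F': "12 \<le> ?F" using g_ge1 g_le_f F by simp_all
  have L: "0 \<le> L" "L \<le> 2 * ln ?F" using G F' by (auto simp: L_def)
  have eL: "exp L = ?G * ?F" using G F' by (simp add: L_def exp_add mult.commute)
  have F2: "2 * f n \<le> n" using F by linarith
  have N: "64 * ?F\<^sup>2 \<le> real pairs"
  proof -
    have "(16 * ?F)\<^sup>2 \<le> (real n)\<^sup>2" using F by (intro power_mono) linarith+
    then show ?thesis using pairs_bounds(1)[OF F2] by (simp add: power_mult_distrib)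
  qed
  have y0: "0 < y" using p F' by (simp add: y_def)
  have yL: "y * L \<le> 1 / 16"
  proof -
    have "ln ?F \<le> ?F" using F' ln_le_minus_one[of ?F] by simp
    then have "y * L \<le> y * (2 * ?F)" using L y0 by (intro mult_left_mono) auto
    also have "\<dots> \<le> 1 / 16" using N p by (simp add: y_def field_simps power2_eq_square)
    finally show ?thesis .
  qed
  have y2: "y \<le> 1 / 2"
  proof -
    have "?F * 1 \<le> ?F * ?F" using F' by (intro mult_left_mono) auto
    then show ?thesis using N p by (simp add: y_def field_simps power2_eq_square)
  qed
  have ty: "real (2 * t) * y \<le> L - c"
  proof -
    have "real t * (2 * y) \<le> real pairs * (L - c) / (4 * ?F) * (2 * y)"
      using t y0 by (intro mult_right_mono) (auto simp: L_def)
    also have "\<dots> = L - c" using p F' by (simp add: y_def field_simps)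
    finally show ?thesis by simp
  qed
  have ev: "eigval ^ (2 * t) \<ge> exp (c - L - 1 / 8)"
  proof -
    have e: "eigval = exp (ln (1 - y))" using y2 by (simp add: eigval_def y_def)
    have "- y - 2 * y\<^sup>2 \<le> ln (1 - y)" using y0 y2 by (intro ln_one_minus_pos_lower_bound) auto
    then have "real (2 * t) * (- y - 2 * y\<^sup>2) \<le> real (2 * t) * ln (1 - y)" by (intro mult_left_mono) auto
    moreover have "real (2 * t) * (- y - 2 * y\<^sup>2) = - (real (2 * t) * y) - 2 * y * (real (2 * t) * y)"
      by (simp add: power2_eq_square algebra_simps)
    moreover have "2 * y * (real (2 * t) * y) \<le> 1 / 8"
    proof -
      have "2 * y * (real (2 * t) * y) \<le> 2 * y * L" using ty c y0 by (intro mult_left_mono) auto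
      also have "2 * y * L \<le> 1 / 8" using yL by simp
      finally show ?thesis .
    qed
    ultimately have "c - L - 1 / 8 \<le> real (2 * t) * ln (1 - y)" using ty by linarith
    then show ?thesis unfolding e exp_of_nat_mult[symmetric] by simp
  qed
  have "(1 / 2 * exp (c / 2))\<^sup>2 = exp c * (1 / 4)"
    by (simp add: power_mult_distrib power_divide exp_double[symmetric])
  also have "\<dots> \<le> exp c * (exp (- 1 / 8) * (1 - 1 / ?F)\<^sup>2)"
  proof (intro mult_left_mono)
    have "7 / 8 \<le> exp (- 1 / 8 :: real)" using exp_ge_add_one_self[of "- 1 / 8 :: real"] by simp
    moreover have "(11 / 12)\<^sup>2 \<le> (1 - 1 / ?F)\<^sup>2" using F' by (intro power_mono) (auto simp: field_simps)
    ultimately have "7 / 8 * (11 / 12)\<^sup>2 \<le> exp (- 1 / 8) * (1 - 1 / ?F)\<^sup>2" by (intro mult_mono) auto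
    moreover have "1 / 4 \<le> 7 / 8 * (11 / 12 :: real)\<^sup>2" by (simp add: power2_eq_square)
    ultimately show "1 / 4 \<le> exp (- 1 / 8) * (1 - 1 / ?F)\<^sup>2" by (rule order_trans[rotated])
  qed simp
  also have "\<dots> = exp (c - L - 1 / 8) * (exp L * (1 - 1 / ?F)\<^sup>2)"
    by (simp add: mult.assoc[symmetric] exp_add[symmetric])
  also have "\<dots> \<le> eigval ^ (2 * t) * (?G * ?F * (1 - 1 / ?F)\<^sup>2)"
    unfolding eL using ev by (intro mult_right_mono) auto
  also have "\<dots> \<le> (walk_chi2 n M t x)\<^sup>2" using F by (intro chi2_lower[OF x]) auto
  finally show ?thesis by (rule power2_le_imp_le) (rule walk_chi2_nonneg)
qed

end

section \<open>Asymptotics and cutoff\<close>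

locale two_step_family =
  fixes f g :: "nat \<Rightarrow> nat"
  assumes f_ge1: "\<And>n. n \<ge> 1 \<Longrightarrow> f n \<ge> 1"
    and g_ge1: "\<And>n. n \<ge> 1 \<Longrightarrow> g n \<ge> 1"
    and f_ge_g: "\<And>n. n \<ge> 1 \<Longrightarrow> f n \<ge> g n"
    and f_small: "(\<lambda>n. real (f n) / real n) \<longlonglongrightarrow> 0"
    and f_unbounded: "filterlim f at_top sequentially"
begin

lemma walk: "f n < n \<Longrightarrow> two_step_walk f g n"
  using g_ge1[of n] f_ge_g[of n] by unfold_locales auto

lemma eventually_small: "\<forall>\<^sub>F n in sequentially. k * f n \<le> n"
proof -
  have "\<forall>\<^sub>F n in sequentially. real (f n) / real n < 1 / real (Suc k)"
    using f_small by (rule order_tendstoD) simp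
  moreover have "\<forall>\<^sub>F n in sequentially. 1 \<le> n" by (rule eventually_ge_at_top)
  ultimately show ?thesis
  proof eventually_elim
    case (elim n)
    then have "real (Suc k * f n) < real n" by (simp add: field_simps)
    then have "Suc k * f n < n" by (simp only: of_nat_less_iff)
    then show ?case by simp
  qed
qed

lemma eventually_less: "\<forall>\<^sub>F n in sequentially. f n < n"
  using eventually_small[of 2] eventually_ge_at_top[of 1]
proof eventually_elim
  case (elim n)
  then show ?case using f_ge1[of n] by linarith
qed

lemma eventually_f_ge: "\<forall>\<^sub>F n in sequentially. k \<le> f n"
  using f_unbounded by (auto simp: filterlim_at_top)

lemma ln_f_at_top: "filterlim (\<lambda>n. ln (real (f n))) at_top sequentially"
  by (intro filterlim_compose[OF ln_at_top] filterlim_compose[OF filterlim_real_sequentially f_unbounded])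

text \<open>The cutoff time exceeds the order \<open>n ln n\<close> in which the large values mix.\<close>

lemma eventually_long: "\<forall>\<^sub>F n in sequentially. 192 * real (f n) * ln (real n) \<le> real n * (ln (real (f n)) + 10)"
proof -
  have "\<forall>\<^sub>F n :: nat in sequentially. 192 * ln (real n) \<le> 10 * sqrt (real n)"
    by real_asymp
  then show ?thesis
    using eventually_small[of 384] eventually_f_ge[of 12] eventually_ge_at_top[of 1]
  proof eventually_elim
    case (elim n)
    have F: "12 \<le> real (f n)" and n1: "1 \<le> real n" using elim by simp_all
    have lnF: "0 \<le> ln (real (f n))" and lnn: "0 \<le> ln (real n)" using F n1 by auto
    \<comment> \<open>\<open>f\<close> may grow arbitrarily slowly, or almost as fast as
      \<open>n\<close>. If \<open>n \<le> f^2\<close>, then \<open>ln n\<close> is comparable to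
      \<open>ln f\<close> and smallness of \<open>f / n\<close> decides. Otherwise \<open>f\<close>
      is at most \<open>sqrt n\<close> and the constant 10 suffices.\<close>
    show ?case
    proof (cases "real n \<le> (real (f n))\<^sup>2")
      case True
      moreover have "0 < real n" "0 < (real (f n))\<^sup>2" using n1 F by auto
      ultimately have "ln (real n) \<le> ln ((real (f n))\<^sup>2)" using ln_le_cancel_iff by blast
      also have "\<dots> = 2 * ln (real (f n))" using F by (simp add: ln_realpow)
      finally have "192 * real (f n) * ln (real n) \<le> 192 * real (f n) * (2 * ln (real (f n)))"
        by (intro mult_left_mono) auto
      also have "\<dots> = (384 * real (f n)) * ln (real (f n))" by simp
      also have "\<dots> \<le> real n * ln (real (f n))"
      proof (intro mult_right_mono lnF)
        show "384 * real (f n) \<le> real n" using elim(2) by linarith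
      qed
      also have "\<dots> \<le> real n * (ln (real (f n)) + 10)" by (intro mult_left_mono) auto
      finally show ?thesis .
    next
      case False
      then have "(real (f n))\<^sup>2 \<le> real n" by simp
      then have Fs: "real (f n) \<le> sqrt (real n)" by (rule real_le_rsqrt)
      have "real (f n) * (192 * ln (real n)) \<le> sqrt (real n) * (10 * sqrt (real n))"
        using lnn by (intro mult_mono[OF Fs elim(1)]) (simp, linarith)
      also have "\<dots> = real n * 10" by simp
      also have "\<dots> \<le> real n * (ln (real (f n)) + 10)" using lnF by (intro mult_left_mono) auto
      finally show ?thesis by (simp add: mult_ac)
    qed
  qed
qed

lemma location_window:
  assumes "f n < n"
  shows "cutoff_location f g n + c * cutoff_window f g n
    = real (two_step_walk.pairs f g n) * (ln (real (f n)) + ln (real (g n)) + c) / (4 * real (f n))"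
proof -
  interpret W: two_step_walk f g n using assms by (rule walk)
  show ?thesis
    unfolding cutoff_location_def cutoff_window_def W.pair_count_eq
    by (simp add: distrib_left add_divide_distrib mult.commute)
qed

lemma eventually_upper:
  assumes c: "10 \<le> c"
  shows "\<forall>\<^sub>F n in sequentially. \<forall>x\<in>restricted_perms n (two_step_matrix f g n). \<forall>t.
    cutoff_location f g n + c * cutoff_window f g n \<le> real t \<longrightarrow>
    walk_chi2 n (two_step_matrix f g n) t x \<le> 4 * exp (- c / 2)"
proof -
  obtain m :: nat where m: "182 * exp c \<le> real m" using real_arch_simple by blast
  show ?thesis
    using eventually_small[of 4] eventually_f_ge[of 12] eventually_long eventually_ge_at_top[of m]
      eventually_less eventually_ge_at_top[of 1]
  proof eventually_elim
    case (elim n)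
    interpret W: two_step_walk f g n using elim(5) by (rule walk)
    show ?case
    proof (intro ballI allI impI)
      fix x t assume x: "x \<in> restricted_perms n (two_step_matrix f g n)"
        and t: "cutoff_location f g n + c * cutoff_window f g n \<le> real t"
      have tt: "real W.pairs * (ln (real (f n)) + ln (real (g n)) + c) / (4 * real (f n)) \<le> real t"
        using t by (simp only: location_window[OF elim(5)])
      have F: "12 \<le> real (f n)" and n1: "1 \<le> real n" using elim by simp_all
      have lnG: "0 \<le> ln (real (g n))" using W.g_ge1 by simp
      have lnF: "0 \<le> ln (real (f n))" using F by simp
      \<comment> \<open>\<open>192 = 12 * 16\<close>, where 16 combines
        \<open>N \<ge> n^2 / 4\<close> with the denominator \<open>4 f n\<close> of the cutoff
        time.\<close>
      have "12 * real n * ln (real n) = real n / (16 * real (f n)) * (192 * real (f n) * ln (real n))"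
        using F by simp
      also have "\<dots> \<le> real n / (16 * real (f n)) * (real n * (ln (real (f n)) + 10))"
        using elim(3) by (intro mult_left_mono) auto
      also have "\<dots> = ((real n)\<^sup>2 / 4) * (ln (real (f n)) + 10) / (4 * real (f n))"
        by (simp add: power2_eq_square)
      also have "\<dots> \<le> real W.pairs * (ln (real (f n)) + ln (real (g n)) + c) / (4 * real (f n))"
      proof (intro divide_right_mono mult_mono)
        show "(real n)\<^sup>2 / 4 \<le> real W.pairs" using elim(1) by (intro W.pairs_bounds) simp
      qed (use lnG lnF c in auto)
      finally have t': "12 * real n * ln (real n) \<le> real t" using tt by linarith
      have "182 * exp c \<le> 4 * real n"
      proof -
        have "real m \<le> real n" using elim(4) by simp
        then show ?thesis using m n1 by linarith
      qed
      then show "walk_chi2 n (two_step_matrix f g n) t x \<le> 4 * exp (- c / 2)"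
        using elim by (intro W.chi2_upper_bound[OF x _ _ c tt t']) auto
    qed
  qed
qed

text \<open>Quantified over every \<open>t\<close> up to the threshold, so that the mixing time, of
  which only minimality is known, can be inserted for \<open>t\<close>.\<close>

lemma eventually_lower:
  assumes c: "0 \<le> c"
  shows "\<forall>\<^sub>F n in sequentially. \<forall>x\<in>restricted_perms n (two_step_matrix f g n). \<forall>t.
    real t \<le> cutoff_location f g n - c * cutoff_window f g n \<longrightarrow>
    1 / 2 * exp (c / 2) \<le> walk_chi2 n (two_step_matrix f g n) t x"
  using eventually_small[of 16] eventually_f_ge[of 12] eventually_less
proof eventually_elim
  case (elim n)
  interpret W: two_step_walk f g n using elim(3) by (rule walk)
  show ?case
  proof (intro ballI allI impI)
    fix x t assume x: "x \<in> restricted_perms n (two_step_matrix f g n)"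
      and t: "real t \<le> cutoff_location f g n - c * cutoff_window f g n"
    have "real t \<le> real W.pairs * (ln (real (f n)) + ln (real (g n)) - c) / (4 * real (f n))"
      using t location_window[OF elim(3), of "- c"] by simp
    then show "1 / 2 * exp (c / 2) \<le> walk_chi2 n (two_step_matrix f g n) t x"
      using elim c by (intro W.chi2_lower_bound[OF x]) auto
  qed
qed

text \<open>A negative time would be truncated to 0 by \<open>nat\<close>, which is rounding up; the
  lower bound requires a time rounded down.\<close>

lemma eventually_nonneg: "\<forall>\<^sub>F n in sequentially. 0 \<le> cutoff_location f g n - c * cutoff_window f g n"
proof -
  have "\<forall>\<^sub>F n in sequentially. c \<le> ln (real (f n))"
    using ln_f_at_top by (auto simp: filterlim_at_top)
  then show ?thesis using eventually_less
  proof eventually_elim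
    case (elim n)
    interpret W: two_step_walk f g n using elim(2) by (rule walk)
    have "0 \<le> ln (real (g n))" using W.g_ge1 by simp
    then show ?case using elim(1) location_window[OF elim(2), of "- c"] by simp
  qed
qed

text \<open>The lower shift 2 serves every \<epsilon>: there the distance is at least
  \<open>exp 1 / 2\<close>, hence at least 1. Only the upper constant depends on \<epsilon>.\<close>

lemma mixing_time_bounds:
  assumes \<epsilon>: "0 < \<epsilon>" "\<epsilon> < 1"
  obtains c where "0 \<le> c" "\<forall>\<^sub>F n in sequentially.
    cutoff_location f g n - 2 * cutoff_window f g n \<le> real (chi2_mixing_time n (two_step_matrix f g n) \<epsilon>) \<and>
    real (chi2_mixing_time n (two_step_matrix f g n) \<epsilon>) \<le> cutoff_location f g n + c * cutoff_window f g n + 1"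
proof -
  \<comment> \<open>The second entry solves \<open>4 * exp (- c / 2) = \<epsilon>\<close>; the first
    meets the requirement of the upper bound.\<close>
  define c where "c = max 10 (2 * ln (4 / \<epsilon>))"
  have c: "10 \<le> c" by (simp add: c_def)
  have "exp (- c / 2) \<le> exp (- ln (4 / \<epsilon>))" by (simp add: c_def)
  also have "\<dots> = \<epsilon> / 4" using \<epsilon> by (simp add: exp_minus)
  finally have c\<epsilon>: "4 * exp (- c / 2) \<le> \<epsilon>" by simp
  have "\<forall>\<^sub>F n in sequentially.
    cutoff_location f g n - 2 * cutoff_window f g n \<le> real (chi2_mixing_time n (two_step_matrix f g n) \<epsilon>) \<and>
    real (chi2_mixing_time n (two_step_matrix f g n) \<epsilon>) \<le> cutoff_location f g n + c * cutoff_window f g n + 1"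
    using eventually_upper[OF c] eventually_lower[of 2, simplified] eventually_nonneg[of "- c"] eventually_less
  proof eventually_elim
    case (elim n)
    interpret W: two_step_walk f g n using elim(4) by (rule walk)
    define T where "T = nat \<lceil>cutoff_location f g n + c * cutoff_window f g n\<rceil>"
    have nn: "0 \<le> cutoff_location f g n + c * cutoff_window f g n" using elim(3) by simp
    have T: "cutoff_location f g n + c * cutoff_window f g n \<le> real T"
      unfolding T_def by (rule real_nat_ceiling_ge)
    have T1: "real T \<le> cutoff_location f g n + c * cutoff_window f g n + 1"
      using nn unfolding T_def by linarith
    let ?Q = "\<lambda>t. \<forall>x\<in>restricted_perms n (two_step_matrix f g n). walk_chi2 n (two_step_matrix f g n) t x \<le> \<epsilon>"
    have QT: "?Q T" using elim(1) T c\<epsilon> order_trans by blast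
    have le: "chi2_mixing_time n (two_step_matrix f g n) \<epsilon> \<le> T"
      unfolding chi2_mixing_time_def using QT by (rule Least_le)
    have "?Q (chi2_mixing_time n (two_step_matrix f g n) \<epsilon>)"
      unfolding chi2_mixing_time_def using QT by (rule LeastI)
    then have small: "walk_chi2 n (two_step_matrix f g n) (chi2_mixing_time n (two_step_matrix f g n) \<epsilon>) id \<le> \<epsilon>"
      using W.id_in_S by blast
    have "cutoff_location f g n - 2 * cutoff_window f g n \<le> real (chi2_mixing_time n (two_step_matrix f g n) \<epsilon>)"
    proof (rule ccontr)
      assume "\<not> ?thesis"
      then have "exp 1 / 2 \<le> walk_chi2 n (two_step_matrix f g n) (chi2_mixing_time n (two_step_matrix f g n) \<epsilon>) id"
        using elim(2) W.id_in_S by auto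
      moreover have "exp (1 :: real) \<ge> 2" using exp_ge_add_one_self[of 1] by simp
      ultimately show False using small \<epsilon> by linarith
    qed
    then show ?case using le T1 by linarith
  qed
  with that[of c] c show thesis by simp
qed

text \<open>Window over location is at most \<open>1 / ln (f n)\<close>, which tends to 0. The 1
  lost in rounding is negligible since the location is at least \<open>n / 16\<close>.\<close>

lemma mixing_time_asymp:
  assumes \<epsilon>: "0 < \<epsilon>" "\<epsilon> < 1"
  shows "(\<lambda>n. real (chi2_mixing_time n (two_step_matrix f g n) \<epsilon>) / cutoff_location f g n) \<longlonglongrightarrow> 1"
proof -
  obtain c where c: "0 \<le> c" and bounds: "\<forall>\<^sub>F n in sequentially.
    cutoff_location f g n - 2 * cutoff_window f g n \<le> real (chi2_mixing_time n (two_step_matrix f g n) \<epsilon>) \<and>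
    real (chi2_mixing_time n (two_step_matrix f g n) \<epsilon>) \<le> cutoff_location f g n + c * cutoff_window f g n + 1"
    using mixing_time_bounds[OF \<epsilon>] by blast
  have inv: "(\<lambda>n. d / ln (real (f n))) \<longlonglongrightarrow> 0" for d :: real
    by (rule real_tendsto_divide_at_top[OF tendsto_const ln_f_at_top])
  have inv': "(\<lambda>n. 16 / real n) \<longlonglongrightarrow> 0"
    by (rule real_tendsto_divide_at_top[OF tendsto_const filterlim_real_sequentially])
  have lnF1: "\<forall>\<^sub>F n in sequentially. 1 \<le> ln (real (f n))"
    using ln_f_at_top by (auto simp: filterlim_at_top)
  have ev: "\<forall>\<^sub>F n in sequentially.
      1 - 2 / ln (real (f n)) \<le> real (chi2_mixing_time n (two_step_matrix f g n) \<epsilon>) / cutoff_location f g n \<and>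
      real (chi2_mixing_time n (two_step_matrix f g n) \<epsilon>) / cutoff_location f g n \<le> 1 + c / ln (real (f n)) + 16 / real n"
    using bounds lnF1 eventually_less eventually_small[of 2]
  proof eventually_elim
    case (elim n)
    interpret W: two_step_walk f g n using elim(3) by (rule walk)
    define l where "l = cutoff_location f g n"
    define w where "w = cutoff_window f g n"
    define k where "k = ln (real (f n))"
    define \<tau> where "\<tau> = real (chi2_mixing_time n (two_step_matrix f g n) \<epsilon>)"
    have k: "1 \<le> k" using elim(2) by (simp add: k_def)
    have F: "1 \<le> real (f n)" using W.g_ge1 W.g_le_f by simp
    have n0: "0 < real n" using elim(3) by simp
    have lnG: "0 \<le> ln (real (g n))" using W.g_ge1 by simp
    have w0: "real n / 16 \<le> w"
    proof -
      have "real n / 16 * (4 * real (f n)) \<le> (real n)\<^sup>2 / 4"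
      proof -
        have "real (f n) \<le> real n" using elim(3) by simp
        then have "real n * real (f n) \<le> real n * real n" by (intro mult_left_mono) auto
        then show ?thesis by (simp add: power2_eq_square)
      qed
      also have "\<dots> \<le> real W.pairs" by (rule W.pairs_bounds[OF elim(4)])
      finally show ?thesis using F by (simp add: w_def cutoff_window_def W.pair_count_eq field_simps)
    qed
    then have wp: "0 < w" using n0 by linarith
    have "l = w * (k + ln (real (g n)))"
      by (simp add: l_def w_def k_def cutoff_location_def cutoff_window_def)
    then have lw: "k * w \<le> l" using lnG wp by (simp add: algebra_simps)
    then have lp: "0 < l" using k wp by (smt (verit) mult_pos_pos)
    have wl: "w / l \<le> 1 / k" using lw lp k by (simp add: field_simps)
    have "1 * w \<le> k * w" using k wp by (intro mult_right_mono) auto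
    then have "real n / 16 \<le> l" using lw w0 by linarith
    then have one_l: "1 / l \<le> 16 / real n" using n0 lp by (simp add: field_simps)
    have "l - 2 * w \<le> \<tau>" "\<tau> \<le> l + c * w + 1" using elim(1) by (simp_all add: l_def w_def \<tau>_def)
    then have "(l - 2 * w) / l \<le> \<tau> / l" "\<tau> / l \<le> (l + c * w + 1) / l"
      using lp by (auto intro: divide_right_mono)
    moreover have "(l - 2 * w) / l = 1 - 2 * (w / l)" "(l + c * w + 1) / l = 1 + c * (w / l) + 1 / l"
      using lp by (simp_all add: field_simps)
    moreover have "c * (w / l) \<le> c * (1 / k)" using wl c by (intro mult_left_mono)
    ultimately have "1 - 2 / k \<le> \<tau> / l \<and> \<tau> / l \<le> 1 + c / k + 16 / real n"
      using wl one_l by simp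
    then show ?case by (simp add: l_def k_def \<tau>_def)
  qed
  show ?thesis
  proof (rule tendsto_sandwich)
    show "(\<lambda>n. 1 - 2 / ln (real (f n))) \<longlonglongrightarrow> 1"
      using tendsto_diff[OF tendsto_const inv[of 2], of 1] by simp
    show "(\<lambda>n. 1 + c / ln (real (f n)) + 16 / real n) \<longlonglongrightarrow> 1"
      using tendsto_add[OF tendsto_add[OF tendsto_const inv[of c]] inv', of 1] by simp
  qed (use ev in \<open>auto elim: eventually_mono\<close>)
qed

lemma cutoff: "chi2_cutoff (two_step_matrix f g)"
  unfolding chi2_cutoff_def
proof
  fix \<epsilon> :: real assume "\<epsilon> \<in> {0<..<1}"
  then have \<epsilon>: "0 < \<epsilon>" "\<epsilon> < 1" "0 < 1 - \<epsilon>" "1 - \<epsilon> < 1" by auto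
  let ?T = "\<lambda>\<epsilon> n. real (chi2_mixing_time n (two_step_matrix f g n) \<epsilon>)"
  let ?l = "cutoff_location f g"
  have "(\<lambda>n. (?T \<epsilon> n / ?l n) / (?T (1 - \<epsilon>) n / ?l n)) \<longlonglongrightarrow> 1 / 1"
    using mixing_time_asymp[OF \<epsilon>(1,2)] mixing_time_asymp[OF \<epsilon>(3,4)] by (rule tendsto_divide) simp
  moreover have "\<forall>\<^sub>F n in sequentially. (?T \<epsilon> n / ?l n) / (?T (1 - \<epsilon>) n / ?l n) = ?T \<epsilon> n / ?T (1 - \<epsilon>) n"
  proof -
    have "\<forall>\<^sub>F n in sequentially. 1 / 2 < ?T \<epsilon> n / ?l n"
      using order_tendstoD(1)[OF mixing_time_asymp[OF \<epsilon>(1,2)], of "1 / 2"] by simp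
    then show ?thesis
    proof eventually_elim
      case (elim n)
      \<comment> \<open>Division by 0 yields 0, so a quotient above \<open>1 / 2\<close> forces a
        nonzero location.\<close>
      then have "?l n \<noteq> 0" by auto
      then show ?case by simp
    qed
  qed
  ultimately have "(\<lambda>n. ?T \<epsilon> n / ?T (1 - \<epsilon>) n) \<longlonglongrightarrow> 1 / 1"
    by (rule Lim_transform_eventually)
  then show "(\<lambda>n. ?T \<epsilon> n / ?T (1 - \<epsilon>) n) \<longlonglongrightarrow> 1" by simp
qed

end

theorem theorem2p12:
  fixes f g :: "nat \<Rightarrow> nat"
  assumes f_pos: "\<And>n. n \<ge> 1 \<Longrightarrow> f n \<ge> 1"
    and g_pos: "\<And>n. n \<ge> 1 \<Longrightarrow> g n \<ge> 1"
    and f_ge_g: "\<And>n. n \<ge> 1 \<Longrightarrow> f n \<ge> g n"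
    and f_small: "(\<lambda>n. real (f n) / real n) \<longlonglongrightarrow> 0"
    and f_unbounded: "filterlim f at_top sequentially"
  shows
    "(\<forall>n. f n < n \<longrightarrow>
        (\<forall>\<sigma>\<in>restricted_perms n (two_step_matrix f g n).
           card (neighbours n (two_step_matrix f g n) \<sigma>)
             = graph_degree n (two_step_matrix f g n)) \<and>
        int (pair_count f g n) =
          int n ^ 2 - 2 * int n * int (g n) + 2 * int (f n) * int (g n)) \<and>
     chi2_cutoff (two_step_matrix f g) \<and>
     (\<forall>c>10. \<forall>\<^sub>F n in sequentially.
        \<forall>x\<in>restricted_perms n (two_step_matrix f g n).
          walk_chi2 n (two_step_matrix f g n)
              (nat \<lceil>cutoff_location f g n + c * cutoff_window f g n\<rceil>) x
            \<le> 4 * exp (- c / 2)) \<and>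
     (\<forall>c>0. \<forall>\<^sub>F n in sequentially.
        \<forall>x\<in>restricted_perms n (two_step_matrix f g n).
          walk_chi2 n (two_step_matrix f g n)
              (nat \<lfloor>cutoff_location f g n - c * cutoff_window f g n\<rfloor>) x
            \<ge> 1 / 2 * exp (c / 2))"
proof -
  interpret two_step_family f g
    using f_pos g_pos f_ge_g f_small f_unbounded by unfold_locales
  show ?thesis
  proof (intro conjI allI impI)
    fix n assume n: "f n < n"
    interpret W: two_step_walk f g n using n by (rule walk)
    show "\<forall>\<sigma>\<in>restricted_perms n (two_step_matrix f g n).
        card (neighbours n (two_step_matrix f g n) \<sigma>) = graph_degree n (two_step_matrix f g n)"
      using W.graph_degree_eq by blast
    show "int (pair_count f g n) = int n ^ 2 - 2 * int n * int (g n) + 2 * int (f n) * int (g n)"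
      unfolding W.pair_count_eq by (rule W.pairs_int)
  next
    show "chi2_cutoff (two_step_matrix f g)" by (rule cutoff)
  next
    fix c :: real assume c: "10 < c"
    then show "\<forall>\<^sub>F n in sequentially. \<forall>x\<in>restricted_perms n (two_step_matrix f g n).
        walk_chi2 n (two_step_matrix f g n) (nat \<lceil>cutoff_location f g n + c * cutoff_window f g n\<rceil>) x
          \<le> 4 * exp (- c / 2)"
      using real_nat_ceiling_ge by (auto intro: eventually_mono[OF eventually_upper[of c]])
  next
    fix c :: real assume c: "0 < c"
    then have c0: "0 \<le> c" by simp
    show "\<forall>\<^sub>F n in sequentially. \<forall>x\<in>restricted_perms n (two_step_matrix f g n).
        1 / 2 * exp (c / 2) \<le>
          walk_chi2 n (two_step_matrix f g n) (nat \<lfloor>cutoff_location f g n - c * cutoff_window f g n\<rfloor>) x"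
      using eventually_lower[OF c0] eventually_nonneg[of c]
    proof eventually_elim
      case (elim n)
      have "real (nat \<lfloor>cutoff_location f g n - c * cutoff_window f g n\<rfloor>)
          \<le> cutoff_location f g n - c * cutoff_window f g n"
        using elim(2) by (rule of_nat_floor)
      then show ?case using elim(1) by blast
    qed
  qed
qed

end
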